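(* Let $L>0$, $T>0$, $\Omega=(0,L)$, and assume: (i) $F\in W^1_\infty\bigl((0,T);L_\infty(\Omega)\bigr)$ and $g,g_*\in L_1\bigl((0,T);L_2(\Omega)\bigr)$; (ii) $1+F(x,t)^2\le C_F$ for $0<x<L$ and $0<t<T$, where $C_F$ is a constant; (iii) $1/2<\alpha<1$. Let $u_{0h}\in\mathbb{S}_h$ and let $u_h:[0,T]\to\mathbb{S}_h$ be the solution of $$\langle u_{ht},v\rangle+\langle \partial_t^{1-\alpha}u_{hx},v_x\rangle-\langle F\,\partial_t^{1-\alpha}u_h,v_x\rangle=\langle g(t),v\rangle+\langle g_*(t),v_x\rangle\quad\text{for all }v\in\mathbb{S}_h,$$ with $u_h(0)=u_{0h}$. Then, for $0\le t\le T$, $$\|u_h(t)-u_{0h}\|^2\le\frac{E_{\alpha/2}\bigl(\tfrac58C_Ft^\alpha/(1-\alpha)\bigr)}{(1-\alpha)^2}\biggl(t^{1-\alpha}\int_0^t\Bigl(\tfrac12\|g(s)\|^2+\|g_*(s)\|^2\Bigr)\,ds+\frac{C_Ft^\alpha}{2\alpha-1}\,\|u_{0h}\|_1^2\biggr).$$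
   Context: $\langle\cdot,\cdot\rangle$ and $\|\cdot\|$ are the inner product and norm of $L_2(\Omega)$; $\|\cdot\|_r$ is the norm of $H^r(\Omega)$. Subscripts $x,t$ denote partial derivatives; $u_{ht}=\partial u_h/\partial t$, $u_{hx}=\partial u_h/\partial x$. The fractional integral is $I^\alpha v(t)=\int_0^t\omega_\alpha(t-s)v(s)\,ds$ with $\omega_\alpha(t)=t^{\alpha-1}/\Gamma(\alpha)$, and the Riemann--Liouville derivative is $\partial_t^{1-\alpha}v=(I^\alpha v)_t$. The Mittag--Leffler function is $E_\beta(z)=\sum_{n=0}^\infty z^n/\Gamma(1+n\beta)$. Functions of $(x,t)$ are viewed as functions of $t$ with values in function spaces on $\Omega$. Given a partition $0=x_0<x_1<\cdots<x_P=L$ of $\Omega$, $\mathbb{S}_h\subseteq H^1_0(\Omega)$ is the space of continuous functions on $[0,L]$ that are linear on each $[x_{p-1},x_p]$ and vanish at $0$ and $L$; $h=\max_p(x_p-x_{p-1})$. The equation is the (slightly generalized) Galerkin discretization of $u_t-\kappa_\alpha\partial_t^{1-\alpha}u_{xx}+\mu_\alpha^{-1}(F\partial_t^{1-\alpha}u)_x=g$ with homogeneous Dirichlet boundary conditions and $\kappa_\alpha=\mu_\alpha=1$. Under (i) the problem has a unique continuous solution $u_h$ with $u_h(0)=u_{0h}$. *)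

theory Defs
  imports "HOL-Analysis.Analysis" "HOL-Probability.Essential_Supremum"
begin

text \<open>
  Functions of \<open>(x,t)\<close> are curried with time first, \<open>f :: real \<Rightarrow> real \<Rightarrow> real\<close>, so that \<open>f t\<close>
  is a function on \<open>\<Omega> = (0,L)\<close>.  Elements of the Lebesgue spaces are represented by functions;
  values outside \<open>\<Omega>\<close> (or outside \<open>(0,T)\<close>) are irrelevant.
\<close>

abbreviation (input) Om :: "real \<Rightarrow> real measure" where
  "Om L \<equiv> lebesgue_on {0<..<L}"


subsection \<open>Function spaces on \<open>(0,L)\<close>\<close>

definition L2_space :: "real \<Rightarrow> (real \<Rightarrow> real) set" where
  "L2_space L = {f \<in> borel_measurable (Om L). integrable (Om L) (\<lambda>x. (f x)\<^sup>2)}"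

definition L2_inner :: "real \<Rightarrow> (real \<Rightarrow> real) \<Rightarrow> (real \<Rightarrow> real) \<Rightarrow> real" where
  "L2_inner L f g = (LINT x|Om L. f x * g x)"

definition L2_norm :: "real \<Rightarrow> (real \<Rightarrow> real) \<Rightarrow> real" where
  "L2_norm L f = sqrt (L2_inner L f f)"

definition L1_space :: "real \<Rightarrow> (real \<Rightarrow> real) set" where
  "L1_space L = {f. integrable (Om L) f}"

definition Linf_space :: "real \<Rightarrow> (real \<Rightarrow> real) set" where
  "Linf_space L = {f \<in> borel_measurable (Om L). \<exists>C. AE x in Om L. \<bar>f x\<bar> \<le> C}"

definition Linf_norm :: "real \<Rightarrow> (real \<Rightarrow> real) \<Rightarrow> real" where
  "Linf_norm L f = real_of_ereal (esssup (Om L) (\<lambda>x. ereal \<bar>f x\<bar>))"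

text \<open>
  The derivative is the classical one.  This is the \<open>H\<^sup>1\<close> norm for continuous piecewise
  linear functions, whose weak derivative is the classical derivative off the nodes.
\<close>
definition H1_norm :: "real \<Rightarrow> (real \<Rightarrow> real) \<Rightarrow> real" where
  "H1_norm L v = sqrt ((L2_norm L v)\<^sup>2 + (L2_norm L (deriv v))\<^sup>2)"


subsection \<open>Bochner spaces on \<open>(0,T)\<close>\<close>

text \<open>
  Here \<open>X\<close> is a function space on \<open>\<Omega>\<close> and \<open>N\<close> its (semi)norm.  Strong measurability is almost
  everywhere approximability by \<open>X\<close>-valued simple functions.
\<close>

definition strongly_measurable ::
    "real \<Rightarrow> (real \<Rightarrow> real) set \<Rightarrow> ((real \<Rightarrow> real) \<Rightarrow> real) \<Rightarrow> (real \<Rightarrow> real \<Rightarrow> real) \<Rightarrow> bool" where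
  "strongly_measurable T X N f \<longleftrightarrow>
     (AE t in lebesgue_on {0<..<T}. f t \<in> X) \<and>
     (\<exists>s :: nat \<Rightarrow> real \<Rightarrow> real \<Rightarrow> real.
        (\<forall>n. simple_function (lebesgue_on {0<..<T}) (s n) \<and> (\<forall>t\<in>{0<..<T}. s n t \<in> X)) \<and>
        (AE t in lebesgue_on {0<..<T}. (\<lambda>n. N (\<lambda>x. s n t x - f t x)) \<longlonglongrightarrow> 0))"

definition Bochner_L1 ::
    "real \<Rightarrow> (real \<Rightarrow> real) set \<Rightarrow> ((real \<Rightarrow> real) \<Rightarrow> real) \<Rightarrow> (real \<Rightarrow> real \<Rightarrow> real) set" where
  "Bochner_L1 T X N =
     {f. strongly_measurable T X N f \<and> integrable (lebesgue_on {0<..<T}) (\<lambda>t. N (f t))}"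

definition Bochner_Linf ::
    "real \<Rightarrow> (real \<Rightarrow> real) set \<Rightarrow> ((real \<Rightarrow> real) \<Rightarrow> real) \<Rightarrow> (real \<Rightarrow> real \<Rightarrow> real) set" where
  "Bochner_Linf T X N =
     {f. strongly_measurable T X N f \<and> (\<exists>C. AE t in lebesgue_on {0<..<T}. N (f t) \<le> C)}"

definition test_function :: "real \<Rightarrow> (real \<Rightarrow> real) \<Rightarrow> bool" where
  "test_function T \<phi> \<longleftrightarrow>
     (\<forall>k t. (deriv ^^ k) \<phi> field_differentiable at t) \<and>
     (\<exists>a b. 0 < a \<and> b < T \<and> (\<forall>t. t \<notin> {a..b} \<longrightarrow> \<phi> t = 0))"

text \<open>
  Weak time derivative of an \<open>L\<^sub>\<infinity>(\<Omega>)\<close>-valued function.  The identity between the Bochner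
  integrals \<open>\<integral> \<phi>' f dt = - \<integral> \<phi> f' dt\<close> in \<open>L\<^sub>\<infinity>(\<Omega>)\<close> is expressed by pairing both sides with an
  arbitrary \<open>\<psi> \<in> L\<^sub>1(\<Omega>)\<close>; such pairings commute with the integral and separate points.
\<close>
definition weak_time_deriv ::
    "real \<Rightarrow> real \<Rightarrow> (real \<Rightarrow> real \<Rightarrow> real) \<Rightarrow> (real \<Rightarrow> real \<Rightarrow> real) \<Rightarrow> bool" where
  "weak_time_deriv L T f f' \<longleftrightarrow>
     (\<forall>\<phi> \<psi>. test_function T \<phi> \<longrightarrow> \<psi> \<in> L1_space L \<longrightarrow>
        (LINT t|lebesgue_on {0<..<T}. deriv \<phi> t * (LINT x|Om L. f t x * \<psi> x)) =
        - (LINT t|lebesgue_on {0<..<T}. \<phi> t * (LINT x|Om L. f' t x * \<psi> x)))"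

definition W1inf_Linf :: "real \<Rightarrow> real \<Rightarrow> (real \<Rightarrow> real \<Rightarrow> real) set" where
  "W1inf_Linf L T =
     {f \<in> Bochner_Linf T (Linf_space L) (Linf_norm L).
        \<exists>f' \<in> Bochner_Linf T (Linf_space L) (Linf_norm L). weak_time_deriv L T f f'}"


subsection \<open>Fractional calculus\<close>

definition omega :: "real \<Rightarrow> real \<Rightarrow> real" where
  "omega \<alpha> t = t powr (\<alpha> - 1) / Gamma \<alpha>"

definition frac_int :: "real \<Rightarrow> (real \<Rightarrow> real) \<Rightarrow> real \<Rightarrow> real" where
  "frac_int \<alpha> v t = (LINT s|lebesgue_on {0<..<t}. omega \<alpha> (t - s) * v s)"

text \<open>\<open>RL_deriv \<alpha>\<close> is the Riemann--Liouville derivative of order \<open>1 - \<alpha>\<close>.\<close>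
definition RL_deriv :: "real \<Rightarrow> (real \<Rightarrow> real) \<Rightarrow> real \<Rightarrow> real" where
  "RL_deriv \<alpha> v t = deriv (frac_int \<alpha> v) t"

definition Mittag_Leffler :: "real \<Rightarrow> real \<Rightarrow> real" where
  "Mittag_Leffler \<beta> z = (\<Sum>n. z ^ n / Gamma (1 + real n * \<beta>))"


subsection \<open>The finite element problem\<close>

definition partition_of :: "real \<Rightarrow> nat \<Rightarrow> (nat \<Rightarrow> real) \<Rightarrow> bool" where
  "partition_of L P x \<longleftrightarrow> x 0 = 0 \<and> x P = L \<and> (\<forall>p<P. x p < x (Suc p))"

definition S_h :: "real \<Rightarrow> nat \<Rightarrow> (nat \<Rightarrow> real) \<Rightarrow> (real \<Rightarrow> real) set" where
  "S_h L P x =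
     {v. continuous_on {0..L} v \<and>
         (\<forall>p<P. \<exists>a b. \<forall>y\<in>{x p..x (Suc p)}. v y = a + b * y) \<and>
         v 0 = 0 \<and> v L = 0}"

text \<open>
  Absolute continuity on \<open>[0,T]\<close>, in the form of being the indefinite integral of an
  integrable function.
\<close>
definition abs_cont :: "real \<Rightarrow> (real \<Rightarrow> real) \<Rightarrow> bool" where
  "abs_cont T v \<longleftrightarrow>
     (\<exists>d. integrable (lebesgue_on {0<..<T}) d \<and>
          (\<forall>t\<in>{0..T}. v t = v 0 + (LINT s|lebesgue_on {0<..<t}. d s)))"

text \<open>
  With \<open>g, g\<^sub>* \<in> L\<^sub>1((0,T); L\<^sub>2)\<close> the equation holds for almost every \<open>t\<close>, and the solution is
  absolutely continuous in time.  Since the space of values is finite-dimensional, continuity and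
  differentiability in \<open>t\<close> of \<open>u\<close> as a function with values in it are the same as
  those of \<open>u \<cdot> y\<close> for each \<open>y \<in> [0,L]\<close>.  In particular no regularity of the fractional integral
  needs to be demanded: it inherits absolute continuity from \<open>u\<close>, so that the
  Riemann--Liouville derivatives below exist for almost every \<open>t\<close>.
\<close>
definition Galerkin_solution ::
    "real \<Rightarrow> real \<Rightarrow> real \<Rightarrow> nat \<Rightarrow> (nat \<Rightarrow> real) \<Rightarrow> (real \<Rightarrow> real \<Rightarrow> real) \<Rightarrow>
     (real \<Rightarrow> real \<Rightarrow> real) \<Rightarrow> (real \<Rightarrow> real \<Rightarrow> real) \<Rightarrow> (real \<Rightarrow> real) \<Rightarrow>
     (real \<Rightarrow> real \<Rightarrow> real) \<Rightarrow> bool" where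
  "Galerkin_solution \<alpha> L T P x F g gs u0 u \<longleftrightarrow>
     (\<forall>t\<in>{0..T}. u t \<in> S_h L P x) \<and>
     (\<forall>y\<in>{0..L}. abs_cont T (\<lambda>t. u t y)) \<and>
     (\<forall>y\<in>{0..L}. u 0 y = u0 y) \<and>
     (AE t in lebesgue_on {0<..<T}. \<forall>v \<in> S_h L P x.
        L2_inner L (\<lambda>y. deriv (\<lambda>s. u s y) t) v
        + L2_inner L (\<lambda>y. RL_deriv \<alpha> (\<lambda>s. deriv (u s) y) t) (deriv v)
        - L2_inner L (\<lambda>y. F t y * RL_deriv \<alpha> (\<lambda>s. u s y) t) (deriv v)
        = L2_inner L (g t) v + L2_inner L (gs t) (deriv v))"

end

theory Submission
  imports Defs
begin

text \<open>
  Let \<open>w = u\<^sub>h - u\<^sub>0\<^sub>h\<close> and \<open>\<beta> = \<alpha>/2\<close>. Testing the equation at almost every time with \<open>v = I\<^sup>\<alpha> w'\<close> and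
  absorbing the gradient gives \<open>\<langle>w', I\<^sup>\<alpha> w'\<rangle> \<le> C\<^sub>F/2 \<parallel>I\<^sup>\<alpha> w'\<parallel>\<^sup>2 + b\<close>, where \<open>b\<close> collects the data and
  contains \<open>\<omega>\<^sub>\<alpha>\<^sup>2 C\<^sub>F \<parallel>u\<^sub>0\<^sub>h\<parallel>\<^sub>1\<^sup>2\<close>, which is integrable because \<open>\<alpha> > 1/2\<close>. Put \<open>z = I\<^sup>\<beta> w'\<close> and let
  \<open>Z(t)\<close> be the integral of \<open>\<parallel>z\<parallel>\<^sup>2\<close> over \<open>(0,t)\<close>.

  \<^item> The integral of \<open>\<langle>w', I\<^sup>\<alpha> w'\<rangle>\<close> over \<open>(0,t)\<close> is at least \<open>cos (\<pi>\<beta>) Z(t) \<ge> (1 - \<alpha>) Z(t)\<close>.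

  \<^item> Since \<open>I\<^sup>\<alpha> w' = I\<^sup>\<beta> z\<close>, the Cauchy--Schwarz inequality bounds the integral of \<open>\<parallel>I\<^sup>\<alpha> w'\<parallel>\<^sup>2\<close> over \<open>(0,t)\<close> by
    \<open>\<omega>\<^bsub>1+\<beta>\<^esub>(t) I\<^sup>\<beta> Z(t)\<close>.

  \<^item> Since \<open>w = I\<^bsup>1-\<beta>\<^esup> z\<close>, the same inequality gives \<open>\<parallel>w(t)\<parallel>\<^sup>2 \<le> t\<^bsup>1-\<alpha>\<^esup>/(1-\<alpha>) Z(t)\<close>.

  The first two facts form a Volterra inequality for \<open>Z\<close> with kernel \<open>\<omega>\<^sub>\<beta>\<close>, and iterating it yields the factor
  \<open>E\<^sub>\<beta>\<close>. The integrations need \<open>w'\<close> in \<open>L\<^sub>2(0,t)\<close>: as \<open>w'\<close> is in \<open>L\<^sub>1\<close> and \<open>\<omega>\<^sub>\<alpha>\<close> in \<open>L\<^sub>2\<close>, the function \<open>I\<^sup>\<alpha> w'\<close>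
  is in \<open>L\<^sub>2\<close>, and testing with \<open>v = w'\<close> transfers this to \<open>w'\<close> when the data are square integrable;
  otherwise the right-hand side is infinite.
\<close>

text \<open>The cosine comes from an explicit kernel computation: the overlap integral of two
  shifted copies of \<open>kern \<beta>\<close> is \<open>kern (2 * \<beta>)\<close> of their
  distance divided by 2 cos(pi \<beta>). Hence the integrals of z^2 and of w' I^\<alpha> w' are the
  same quadratic form up to a constant. The exchange of integrals behind this requires absolute
  convergence, which is why w' has to be square integrable. The factor 1/(1-\<alpha>)^2 has two
  sources: one 1/(1-\<alpha>) is divided out before the Volterra inequality is iterated, the other
  belongs to the squared L2 norm of the kernel that leads from z to w. The power t^\<alpha> at the
  initial value is t^(1-\<alpha>) times the factor t^(2\<alpha>-1) from the squared norm of
  \<open>kern \<alpha>\<close>. The equation contains pointwise time derivatives, whereas absolute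
  continuity provides only indefinite integrals; Lebesgue differentiation, applied to finitely many
  scalar coefficients, connects the two.\<close>

section \<open>The kernel of the fractional integral\<close>

text \<open>Extending \<open>\<omega>\<^sub>a\<close> by zero turns \<open>I\<^sup>a\<close> into a convolution on the whole line,
  to be applied to functions that vanish on the negative half-line.\<close>
definition kern :: "real \<Rightarrow> real \<Rightarrow> real" where
  "kern a \<tau> = (if 0 < \<tau> then omega a \<tau> else 0)"

lemma kern_nonneg [simp]: "0 < a \<Longrightarrow> 0 \<le> kern a \<tau>"
  by (simp add: kern_def omega_def Gamma_real_nonneg)

lemma kern_measurable [measurable]: "kern a \<in> borel_measurable borel"
  unfolding kern_def[abs_def] omega_def by measurable

lemma kern_eq_0 [simp]: "\<tau> \<le> 0 \<Longrightarrow> kern a \<tau> = 0"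
  by (simp add: kern_def)

text \<open>Tonelli with a one-variable weight on each side, the shape in which kernel integrals are
  exchanged below.\<close>

lemma nn_integral_mult_swap:
  assumes [measurable]: "f \<in> borel_measurable borel" "g \<in> borel_measurable borel"
    "(\<lambda>(s, r). h s r) \<in> borel_measurable (borel \<Otimes>\<^sub>M borel)"
  shows "(\<integral>\<^sup>+s. f s * (\<integral>\<^sup>+r. h s r * g r \<partial>lborel) \<partial>lborel)
    = (\<integral>\<^sup>+r. (\<integral>\<^sup>+s. f s * h s r \<partial>lborel) * g r \<partial>(lborel :: real measure))"
proof -
  have [measurable]: "h s \<in> borel_measurable borel" "(\<lambda>s. h s r) \<in> borel_measurable borel" for s r
    using measurable_compose[OF measurable_Pair1' assms(3)] measurable_compose[OF measurable_Pair2' assms(3)] by auto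
  have "(\<integral>\<^sup>+s. f s * (\<integral>\<^sup>+r. h s r * g r \<partial>lborel) \<partial>lborel) = (\<integral>\<^sup>+s. \<integral>\<^sup>+r. f s * h s r * g r \<partial>lborel \<partial>lborel)"
    by (simp add: nn_integral_cmult[symmetric] mult.assoc)
  also have "\<dots> = (\<integral>\<^sup>+r. \<integral>\<^sup>+s. f s * h s r * g r \<partial>lborel \<partial>lborel)"
    by (intro lborel_pair.Fubini') measurable
  finally show ?thesis by (simp add: nn_integral_multc)
qed

text \<open>The semigroup law of fractional integration at the level of kernels. The substitution s
  = r + (t - r) u leads to the Beta function, whose Gamma quotient matches the normalisation of
  \<open>omega\<close>.\<close>

lemma nn_integral_kern_kern:
  assumes a: "0 < a" and b: "0 < b"
  shows "(\<integral>\<^sup>+s. ennreal (kern a (t - s)) * ennreal (kern b (s - r)) \<partial>lborel)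
    = ennreal (kern (a + b) (t - r))"
proof (cases "r < t")
  case False
  then have "kern a (t - s) = 0 \<or> kern b (s - r) = 0" for s
    by (auto simp: kern_def)
  then have "(\<lambda>s. ennreal (kern a (t - s)) * ennreal (kern b (s - r))) = (\<lambda>s. 0)"
    by (metis ennreal_0 mult_zero_left mult_zero_right)
  then show ?thesis
    using False by simp
next
  case True
  define D where "D = t - r"
  have D: "D > 0" using True by (simp add: D_def)
  have Ga: "Gamma a > 0" and Gb: "Gamma b > 0"
    using a b by (auto intro: Gamma_real_pos)
  have "(\<integral>\<^sup>+s. ennreal (kern a (t - s)) * ennreal (kern b (s - r)) \<partial>lborel)
    = ennreal \<bar>D\<bar> * (\<integral>\<^sup>+u. ennreal (kern a (t - (r + D * u))) * ennreal (kern b ((r + D * u) - r)) \<partial>lborel)"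
    using D by (intro nn_integral_real_affine) auto
  also have "\<dots> = ennreal \<bar>D\<bar> * (\<integral>\<^sup>+u. ennreal (D powr (a + b - 2) / (Gamma a * Gamma b)) *
      (ennreal (u powr (b - 1) * (1 - u) powr (a - 1)) * indicator {0..1} u) \<partial>lborel)"
  proof (rule arg_cong[where f = "\<lambda>z. ennreal \<bar>D\<bar> * z"], rule nn_integral_cong_AE)
    have "AE u in lborel. u \<noteq> (0::real) \<and> u \<noteq> 1"
      using AE_lborel_singleton[of "0::real"] AE_lborel_singleton[of "1::real"] by eventually_elim auto
    then show "AE u in lborel. ennreal (kern a (t - (r + D * u))) * ennreal (kern b ((r + D * u) - r))
      = ennreal (D powr (a + b - 2) / (Gamma a * Gamma b)) *
        (ennreal (u powr (b - 1) * (1 - u) powr (a - 1)) * indicator {0..1} u)"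
    proof eventually_elim
      case (elim u)
      show ?case
      proof (cases "0 < u \<and> u < 1")
        case True
        have *: "t - (r + D * u) = D * (1 - u)" by (simp add: D_def algebra_simps)
        have ka: "kern a (t - (r + D * u)) = D powr (a - 1) * (1 - u) powr (a - 1) / Gamma a"
          unfolding * using D True by (simp add: kern_def omega_def powr_mult)
        have kb: "kern b ((r + D * u) - r) = D powr (b - 1) * u powr (b - 1) / Gamma b"
          using D True by (simp add: kern_def omega_def powr_mult)
        have "D powr (a + b - 2) = D powr (a - 1) * D powr (b - 1)"
          by (simp add: powr_add[symmetric] algebra_simps)
        then show ?thesis
          unfolding ka kb using True Ga Gb by (simp add: ennreal_mult[symmetric] mult_ac)
      next
        case False
        then have "kern a (t - (r + D * u)) = 0 \<or> kern b ((r + D * u) - r) = 0"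
        proof -
          have *: "t - (r + D * u) = D * (1 - u)" by (simp add: D_def algebra_simps)
          show ?thesis unfolding * using D False elim
            by (auto simp: kern_def zero_less_mult_iff)
        qed
        moreover have "indicator {0..1} u = (0::ennreal)"
          using False elim by (auto simp: indicator_def)
        ultimately show ?thesis by auto
      qed
    qed
  qed
  also have "\<dots> = ennreal \<bar>D\<bar> * (ennreal (D powr (a + b - 2) / (Gamma a * Gamma b)) * ennreal (Beta b a))"
    by (subst nn_integral_cmult, simp,
        subst nn_integral_has_integral_lebesgue'[OF _ has_integral_Beta_real[OF b a]]) auto
  also have "\<dots> = ennreal (D * (D powr (a + b - 2) / (Gamma a * Gamma b) * Beta b a))"
    using D Ga Gb Gamma_real_pos[of "b + a"] a b
    by (simp add: ennreal_mult[symmetric] Beta_def)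
  also have "D * (D powr (a + b - 2) / (Gamma a * Gamma b) * Beta b a) = kern (a + b) (t - r)"
  proof -
    have "D * D powr (a + b - 2) = D powr (a + b - 1)"
      using D powr_add[of D 1 "a + b - 2"] by (simp add: algebra_simps)
    then show ?thesis
      using D Ga Gb by (simp add: kern_def omega_def Beta_def D_def[symmetric] field_simps)
  qed
  finally show ?thesis .
qed

text \<open>Euler's Gamma integral rescaled by p. Read backwards, it writes a negative power of p as
  a superposition of exponentials.\<close>

lemma nn_integral_powr_exp:
  assumes b: "0 < b" and p: "0 < (p::real)"
  shows "(\<integral>\<^sup>+\<tau>. ennreal (if 0 < \<tau> then \<tau> powr (b - 1) * exp (- (p * \<tau>)) else 0) \<partial>lborel)
    = ennreal (Gamma b * p powr (- b))"
proof -
  have "ennreal (Gamma b) = (\<integral>\<^sup>+ t. ennreal (indicator {0..} t * t powr (b - 1) / exp t) \<partial>lborel)"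
    using b by (simp add: Gamma_conv_nn_integral_real)
  also have "\<dots> = ennreal \<bar>p\<bar> * (\<integral>\<^sup>+ t. ennreal (indicator {0..} (0 + p * t) * (0 + p * t) powr (b - 1) / exp (0 + p * t)) \<partial>lborel)"
    using p by (intro nn_integral_real_affine) auto
  also have "\<dots> = ennreal \<bar>p\<bar> * (\<integral>\<^sup>+ t. ennreal (p powr (b - 1)) * ennreal (if 0 < t then t powr (b - 1) * exp (- (p * t)) else 0) \<partial>lborel)"
  proof (rule arg_cong[where f = "\<lambda>z. ennreal \<bar>p\<bar> * z"], rule nn_integral_cong)
    fix t :: real
    show "ennreal (indicator {0..} (0 + p * t) * (0 + p * t) powr (b - 1) / exp (0 + p * t))
      = ennreal (p powr (b - 1)) * ennreal (if 0 < t then t powr (b - 1) * exp (- (p * t)) else 0)"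
      using p by (cases "t > 0"; cases "t = 0")
        (auto simp: indicator_def powr_mult exp_minus field_simps ennreal_mult[symmetric] zero_le_mult_iff)
  qed
  also have "\<dots> = ennreal \<bar>p\<bar> * ennreal (p powr (b - 1)) * (\<integral>\<^sup>+ t. ennreal (if 0 < t then t powr (b - 1) * exp (- (p * t)) else 0) \<partial>lborel)"
    by (subst nn_integral_cmult) (auto simp: mult.assoc)
  also have "ennreal \<bar>p\<bar> * ennreal (p powr (b - 1)) = ennreal (p powr b)"
    using p powr_add[of p 1 "b - 1"] by (simp add: ennreal_mult[symmetric])
  finally have "ennreal (p powr (- b)) * ennreal (Gamma b) = ennreal (p powr (- b)) * ennreal (p powr b) *
      (\<integral>\<^sup>+ t. ennreal (if 0 < t then t powr (b - 1) * exp (- (p * t)) else 0) \<partial>lborel)"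
    by (simp add: mult.assoc)
  moreover have "ennreal (p powr (- b)) * ennreal (p powr b) = 1"
    using p by (simp add: ennreal_mult[symmetric] powr_add[symmetric])
  ultimately show ?thesis
    using b by (simp add: ennreal_mult[symmetric] mult.commute Gamma_real_nonneg)
qed

lemma Gamma_reflection_real: "Gamma x * Gamma (1 - x) = pi / sin (pi * x)" for x :: real
proof -
  have "complex_of_real (Gamma x * Gamma (1 - x)) = complex_of_real (pi / sin (pi * x))"
    using Gamma_reflection_complex[of "complex_of_real x"]
    by (simp flip: Gamma_complex_of_real sin_of_real)
  then show ?thesis by (simp only: of_real_eq_iff)
qed

text \<open>Writing \<open>(\<tau> + \<delta>)\<^bsup>b - 1\<^esup>\<close> as a Laplace transform reduces the integral to Gamma integrals.\<close>
lemma nn_integral_kern_shift: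
  assumes b: "0 < b" "b < 1/2" and \<delta>: "0 < (\<delta>::real)"
  shows "(\<integral>\<^sup>+\<tau>. ennreal (kern b \<tau>) * ennreal (kern b (\<tau> + \<delta>)) \<partial>lborel)
    = ennreal (kern (2 * b) \<delta> / (2 * cos (pi * b)))"
proof -
  let ?q = "\<lambda>\<tau>. ennreal (if 0 < \<tau> then \<tau> powr (b - 1) else 0)"
  define e where "e p \<tau> = (if 0 < \<tau> \<and> 0 < p then exp (- (p * \<tau>)) else (0::real))" for p \<tau>
  have [measurable]: "(\<lambda>(p, \<tau>). e p \<tau>) \<in> borel_measurable (borel \<Otimes>\<^sub>M borel)"
    unfolding e_def by measurable
  have [measurable]: "(\<lambda>x. e (f x) (g x)) \<in> borel_measurable M"
    if "f \<in> borel_measurable M" "g \<in> borel_measurable M" for f g and M :: "'m measure"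
    using that unfolding e_def by measurable
  have G: "Gamma b > 0" "Gamma (1 - b) > 0" "Gamma (2 * b) > 0" "Gamma (1 - 2 * b) > 0"
    using b by (auto intro: Gamma_real_pos)
  have cospos: "cos (pi * b) > 0" "sin (pi * b) > 0"
    using b by (auto intro!: cos_gt_zero sin_gt_zero) 
  have e_nn: "e p \<tau> \<ge> 0" for p \<tau> by (simp add: e_def)
  have L: "ennreal (Gamma (1 - b)) * ennreal (if 0 < x then x powr (b - 1) else 0)
      = (\<integral>\<^sup>+p. ennreal (p powr (- b)) * ennreal (e p x) \<partial>lborel)" for x :: real
  proof (cases "0 < x")
    case True
    have "(\<integral>\<^sup>+p. ennreal (p powr (- b)) * ennreal (e p x) \<partial>lborel)
      = (\<integral>\<^sup>+p. ennreal (if 0 < p then p powr ((1 - b) - 1) * exp (- (x * p)) else 0) \<partial>lborel)"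
      using True by (intro nn_integral_cong) (auto simp: e_def ennreal_mult[symmetric] mult.commute)
    also have "\<dots> = ennreal (Gamma (1 - b) * x powr (- (1 - b)))"
      using b True by (intro nn_integral_powr_exp) auto
    finally show ?thesis using True G by (simp add: ennreal_mult)
  qed (simp add: e_def)
  have kb: "kern b x = (if 0 < x then x powr (b - 1) else 0) / Gamma b" for x
    by (simp add: kern_def omega_def)
  \<comment> \<open>The three Gamma factors clear the denominators of both kernels and of the
    Laplace representation \<open>L\<close>; they are cancelled at the end.\<close>
  have "ennreal (Gamma b * Gamma b * Gamma (1 - b)) *
      (\<integral>\<^sup>+\<tau>. ennreal (kern b \<tau>) * ennreal (kern b (\<tau> + \<delta>)) \<partial>lborel)
    = (\<integral>\<^sup>+\<tau>. ennreal (Gamma b * Gamma b * Gamma (1 - b)) * (ennreal (kern b \<tau>) * ennreal (kern b (\<tau> + \<delta>))) \<partial>lborel)"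
    by (rule nn_integral_cmult[symmetric]) measurable
  also have "\<dots> = (\<integral>\<^sup>+\<tau>. ?q \<tau> *
        (\<integral>\<^sup>+p. ennreal (e p (\<tau> + \<delta>)) * ennreal (p powr (- b)) \<partial>lborel) \<partial>lborel)"
    unfolding L[symmetric] mult.commute[of "ennreal (e _ _)"] kb using G
    by (intro nn_integral_cong) (auto simp: ennreal_mult[symmetric] mult_ac)
  also have "\<dots> = (\<integral>\<^sup>+p. (\<integral>\<^sup>+\<tau>. ?q \<tau> *
        ennreal (e p (\<tau> + \<delta>)) \<partial>lborel) * ennreal (p powr (- b)) \<partial>lborel)"
    by (rule nn_integral_mult_swap) measurable
  also have "\<dots> = (\<integral>\<^sup>+p. ennreal (Gamma b) * ennreal (if 0 < p then p powr ((1 - 2 * b) - 1) * exp (- (\<delta> * p)) else 0) \<partial>lborel)"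
  proof (rule nn_integral_cong)
    fix p :: real
    show "(\<integral>\<^sup>+\<tau>. ?q \<tau> * ennreal (e p (\<tau> + \<delta>)) \<partial>lborel) * ennreal (p powr (- b))
      = ennreal (Gamma b) * ennreal (if 0 < p then p powr ((1 - 2 * b) - 1) * exp (- (\<delta> * p)) else 0)"
    proof (cases "0 < p")
      case True
      have "(\<integral>\<^sup>+\<tau>. ?q \<tau> * ennreal (e p (\<tau> + \<delta>)) \<partial>lborel)
        = (\<integral>\<^sup>+\<tau>. ennreal (exp (- (\<delta> * p))) * ennreal (if 0 < \<tau> then \<tau> powr (b - 1) * exp (- (p * \<tau>)) else 0) \<partial>lborel)"
        using True \<delta> by (intro nn_integral_cong)
          (auto simp: e_def ennreal_mult[symmetric] exp_add[symmetric] algebra_simps)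
      also have "\<dots> = ennreal (exp (- (\<delta> * p))) * ennreal (Gamma b * p powr (- b))"
        by (subst nn_integral_cmult) (use b True in \<open>auto simp: nn_integral_powr_exp\<close>)
      finally have "(\<integral>\<^sup>+\<tau>. ?q \<tau> * ennreal (e p (\<tau> + \<delta>)) \<partial>lborel) * ennreal (p powr (- b))
        = ennreal (Gamma b) * ennreal (p powr (- b) * p powr (- b) * exp (- (\<delta> * p)))"
        using G by (simp add: ennreal_mult[symmetric] mult_ac)
      also have "p powr (- b) * p powr (- b) = p powr ((1 - 2 * b) - 1)"
        by (simp add: powr_add[symmetric])
      finally show ?thesis using True by simp
    qed (simp add: e_def)
  qed
  also have "\<dots> = ennreal (Gamma b) * ennreal (Gamma (1 - 2 * b) * \<delta> powr (- (1 - 2 * b)))"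
    by (subst nn_integral_cmult, simp, subst nn_integral_powr_exp) (use b \<delta> in auto)
  also have "\<dots> = ennreal (Gamma b * Gamma (1 - 2 * b) * \<delta> powr (2 * b - 1))"
    using G by (simp add: ennreal_mult[symmetric] mult_ac)
  also have "Gamma b * Gamma (1 - 2 * b) * \<delta> powr (2 * b - 1)
     = Gamma b * Gamma b * Gamma (1 - b) * (kern (2 * b) \<delta> / (2 * cos (pi * b)))"
  proof -
    \<comment> \<open>Reflection at b and at 2b, with the double angle formula, cancels sin(pi b)
      and leaves the factor 1 / (2 cos(pi b)).\<close>
    have 1: "Gamma b * Gamma (1 - b) = pi / sin (pi * b)"
      by (simp add: Gamma_reflection_real)
    have 2: "Gamma (2 * b) * Gamma (1 - 2 * b) = pi / sin (pi * (2 * b))"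
      by (rule Gamma_reflection_real)
    have 3: "sin (pi * (2 * b)) = 2 * sin (pi * b) * cos (pi * b)"
      using sin_double[of "pi * b"] by (simp add: mult_ac)
    have "Gamma (1 - 2 * b) = pi / (2 * sin (pi * b) * cos (pi * b)) / Gamma (2 * b)"
      using 2 G cospos unfolding 3 by (simp add: eq_divide_eq mult_ac)
    then have "Gamma (1 - 2 * b) = Gamma b * Gamma (1 - b) / (2 * cos (pi * b)) / Gamma (2 * b)"
      unfolding 1 by simp
    then show ?thesis using \<delta> by (simp add: kern_def omega_def mult_ac)
  qed
  finally have *: "ennreal (Gamma b * Gamma b * Gamma (1 - b)) *
      (\<integral>\<^sup>+\<tau>. ennreal (kern b \<tau>) * ennreal (kern b (\<tau> + \<delta>)) \<partial>lborel)
    = ennreal (Gamma b * Gamma b * Gamma (1 - b)) * ennreal (kern (2 * b) \<delta> / (2 * cos (pi * b)))"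
    using G cospos b by (simp add: ennreal_mult[symmetric])
  have "ennreal (Gamma b * Gamma b * Gamma (1 - b)) \<noteq> 0"
    using G by (simp add: mult_pos_pos)
  then show ?thesis
    using * by (subst (asm) ennreal_mult_cancel_left) auto
qed

text \<open>Only one of the two kernels on the right is nonzero, so the value depends on the
  distance of r and r' alone. Convergence at infinity needs b < 1/2. On the diagonal the left side
  is infinite while the right side is 0.\<close>

lemma nn_integral_kern_overlap:
  assumes b: "0 < b" "b < 1/2" and "r \<noteq> r'"
  shows "(\<integral>\<^sup>+\<tau>. ennreal (kern b (\<tau> - r)) * ennreal (kern b (\<tau> - r')) \<partial>lborel)
    = ennreal ((kern (2 * b) (r - r') + kern (2 * b) (r' - r)) / (2 * cos (pi * b)))"
proof -
  have *: "(\<integral>\<^sup>+\<tau>. ennreal (kern b (\<tau> - r)) * ennreal (kern b (\<tau> - r')) \<partial>lborel)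
      = ennreal (kern (2 * b) (r - r') / (2 * cos (pi * b)))" if "r' < r" for r r'
  proof -
    have "(\<integral>\<^sup>+\<tau>. ennreal (kern b (\<tau> - r)) * ennreal (kern b (\<tau> - r')) \<partial>lborel)
      = ennreal \<bar>1\<bar> * (\<integral>\<^sup>+\<tau>. ennreal (kern b ((r + 1 * \<tau>) - r)) * ennreal (kern b ((r + 1 * \<tau>) - r')) \<partial>lborel)"
      by (rule nn_integral_real_affine) auto
    also have "\<dots> = (\<integral>\<^sup>+\<tau>. ennreal (kern b \<tau>) * ennreal (kern b (\<tau> + (r - r'))) \<partial>lborel)"
      by (simp add: algebra_simps)
    also have "\<dots> = ennreal (kern (2 * b) (r - r') / (2 * cos (pi * b)))"
      using b that by (intro nn_integral_kern_shift) auto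
    finally show ?thesis .
  qed
  show ?thesis
  proof (cases "r' < r")
    case True
    then show ?thesis using *[OF True] by simp
  next
    case False
    then have "r < r'" using \<open>r \<noteq> r'\<close> by simp
    from *[OF this] this show ?thesis by (simp add: mult.commute)
  qed
qed

section \<open>Bounds for the Gamma, cosine and Mittag-Leffler functions\<close>

text \<open>Gamma equals 1 at both 1 and 2, and 1 lies between x and 2; log-convexity does the
  rest.\<close>

lemma Gamma_ge_1:
  assumes "0 < x" "x \<le> (1::real)"
  shows "1 \<le> Gamma x"
proof -
  define th where "th = 1 / (2 - x)"
  have th: "0 < th" "th \<le> 1" "th * x + (1 - th) * 2 = 1"
  proof -
    show "0 < th" "th \<le> 1" using assms by (auto simp: th_def field_simps)
    have "th * (2 - x) = 1" using assms by (simp add: th_def)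
    then show "th * x + (1 - th) * 2 = 1" by (simp add: algebra_simps)
  qed
  have eq: "(1 - th) *\<^sub>R 2 + th *\<^sub>R x = 1"
    using th by (simp add: add.commute)
  have "(ln \<circ> Gamma) ((1 - th) *\<^sub>R 2 + th *\<^sub>R x) \<le> (1 - th) * (ln \<circ> Gamma) 2 + th * (ln \<circ> Gamma) x"
    using assms th by (intro convex_onD[OF log_convex_Gamma_real]) auto
  moreover have "Gamma (2::real) = 1"
    using Gamma_fact[of 1, where ?'a = real] by (simp add: numeral_2_eq_2)
  ultimately have "0 \<le> th * ln (Gamma x)" unfolding eq by simp
  then have "0 \<le> ln (Gamma x)" using th by (simp add: zero_le_mult_iff)
  then show ?thesis using Gamma_real_pos[OF assms(1)] by (simp add: ln_ge_zero_iff)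
qed

text \<open>The source of the constant \<open>5/8 = 1/2 * 5/4\<close> of the theorem.\<close>
lemma Gamma_ge_four_fifths:
  assumes "1/4 \<le> s" "s \<le> (1/2::real)"
  shows "4/5 \<le> Gamma (1 + s)"
proof -
  \<comment> \<open>Makes 3/2, where Gamma is sqrt(pi)/2, a convex combination of 1 + s and 2. From
    1/4 \<le> s follows th \<ge> 2/3, which turns the bound for th * ln Gamma into one for ln Gamma
    itself.\<close>
  define th where "th = (1/2) / (1 - s)"
  have th: "2/3 \<le> th" "th \<le> 1" "th * (1 + s) + (1 - th) * 2 = 3/2"
  proof -
    show "2/3 \<le> th" "th \<le> 1" using assms by (auto simp: th_def field_simps)
    have "th * (1 - s) = 1/2" using assms by (simp add: th_def)
    then show "th * (1 + s) + (1 - th) * 2 = 3/2" by (simp add: algebra_simps)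
  qed
  have pos: "Gamma (1 + s) > 0" using assms by (intro Gamma_real_pos) auto
  have eq: "(1 - th) *\<^sub>R 2 + th *\<^sub>R (1 + s) = 3/2"
    using th by (simp add: add.commute)
  have "(ln \<circ> Gamma) ((1 - th) *\<^sub>R 2 + th *\<^sub>R (1 + s)) \<le> (1 - th) * (ln \<circ> Gamma) 2 + th * (ln \<circ> Gamma) (1 + s)"
    using assms th by (intro convex_onD[OF log_convex_Gamma_real]) auto
  moreover have "Gamma (2::real) = 1"
    using Gamma_fact[of 1, where ?'a = real] by (simp add: numeral_2_eq_2)
  ultimately have 1: "ln (Gamma (3/2)) \<le> th * ln (Gamma (1 + s))" unfolding eq by simp
  have "Gamma (3/2::real) = sqrt pi / 2"
    using Gamma_plus1[of "1/2::real"] Gamma_one_half_real nonpos_Ints_nonpos[of "1/2::real"] by auto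
  moreover have "ln (sqrt pi / 2) = 1/2 * ln (pi / 4)"
    by (simp add: ln_div ln_sqrt ln_realpow[of 2 2, simplified])
  ultimately have 2: "1/2 * ln (pi / 4) \<le> th * ln (Gamma (1 + s))" using 1 by (simp only:)
  have 3: "ln (4/5) \<le> 3/4 * ln (pi / 4)"
  proof -
    have "4 * ln (4/5::real) = ln ((4/5) ^ 4)" by (simp add: ln_realpow)
    also have "\<dots> \<le> ln ((pi/4) ^ 3)"
    proof (subst ln_le_cancel_iff)
      have "(3/4::real) ^ 3 \<le> (pi/4) ^ 3"
        using pi_gt3 by (intro power_mono) auto
      then have "(0.78::real) ^ 3 \<le> (pi/4) ^ 3"
        using pi_approx by (intro power_mono) auto
      then show "(4 / 5) ^ 4 \<le> (pi / 4) ^ 3" by (simp add: power_divide)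
    qed auto
    also have "\<dots> = 3 * ln (pi/4)" by (simp add: ln_realpow)
    finally show ?thesis by simp
  qed
  have "ln (4/5) \<le> ln (Gamma (1 + s))"
  proof (cases "ln (Gamma (1 + s)) \<ge> 0")
    case True
    have "ln (4/5::real) \<le> 0" by simp
    then show ?thesis using True by linarith
  next
    case False
    then have "th * ln (Gamma (1 + s)) \<le> 2/3 * ln (Gamma (1 + s))"
      using th by (intro mult_right_mono_neg) auto
    then show ?thesis using 2 3 by linarith
  qed
  then show ?thesis using pos by simp
qed

text \<open>Cosine is concave on [0, pi/2] and lies above its chord.\<close>

lemma cos_ge_linear:
  assumes "0 \<le> a" "a \<le> 1"
  shows "1 - a \<le> cos (pi * (a / 2))"
proof -
  have "convex_on {0..pi/2} (\<lambda>x. - cos x)"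
  proof (rule f''_ge0_imp_convex[where f' = sin and f'' = cos])
    show "convex {0..pi/2}" by simp
    show "((\<lambda>x. - cos x) has_real_derivative sin x) (at x)" for x
      by (auto intro!: derivative_eq_intros)
    show "(sin has_real_derivative cos x) (at x)" for x by (auto intro!: derivative_eq_intros)
    show "0 \<le> cos x" if "x \<in> {0..pi/2}" for x
      using that by (intro cos_ge_zero) auto
  qed
  from convex_onD[OF this, of a 0 "pi/2"] assms show ?thesis
    by (simp add: mult.commute)
qed

text \<open>Keeps only t \<ge> M in Euler's integral, where t^(x-1) \<ge> M^(x-1). As M is free,
  Gamma outgrows every geometric sequence, which gives the convergence of the Mittag-Leffler
  series.\<close>

lemma Gamma_lower_bound:
  assumes M: "0 < M" and x: "1 \<le> (x::real)"
  shows "M powr (x - 1) * exp (- M) \<le> Gamma x"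
proof -
  have "ennreal (M powr (x - 1) * exp (- M)) = (\<integral>\<^sup>+t. ennreal (M powr (x - 1)) * (ennreal (exp (- t)) * indicator {M..} t) \<partial>lborel)"
  proof -
    have "(\<integral>\<^sup>+t. ennreal (exp (- t)) * indicator {M..} t \<partial>lborel) = ennreal (0 - (- exp (- M)))"
    proof (rule nn_integral_FTC_atLeast)
      show "((\<lambda>t. - exp (- t)) has_real_derivative exp (- t)) (at t)" for t
        by (auto intro!: derivative_eq_intros)
      show "((\<lambda>t. - exp (- t::real)) \<longlongrightarrow> 0) at_top"
        using tendsto_minus[OF filterlim_compose[OF exp_at_bot filterlim_uminus_at_bot_at_top]] by simp
    qed auto
    then show ?thesis by (simp add: nn_integral_cmult ennreal_mult)
  qed
  also have "\<dots> \<le> (\<integral>\<^sup>+ t. ennreal (indicator {0..} t * t powr (x - 1) / exp t) \<partial>lborel)"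
    using M x by (intro nn_integral_mono)
      (auto simp: indicator_def exp_minus field_simps ennreal_mult[symmetric] intro!: mult_right_mono powr_mono2)
  also have "\<dots> = ennreal (Gamma x)" using x by (simp add: Gamma_conv_nn_integral_real)
  finally show ?thesis using x by (simp add: Gamma_real_nonneg)
qed

lemma summable_Mittag_Leffler:
  assumes b: "0 < \<beta>"
  shows "summable (\<lambda>n. z ^ n / Gamma (1 + real n * \<beta>))"
proof -
  \<comment> \<open>Chosen so that \<open>M powr \<beta>\<close> equals 2(|z| + 1), which yields a
    geometric majorant with ratio 1/2.\<close>
  define M where "M = (2 * (\<bar>z\<bar> + 1)) powr (1 / \<beta>)"
  have M: "M > 0" by (simp add: M_def)
  have Mb: "M powr (real n * \<beta>) = (2 * (\<bar>z\<bar> + 1)) ^ n" for n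
    using b by (simp add: M_def powr_powr powr_realpow)
  show ?thesis
  proof (rule summable_comparison_test')
    show "summable (\<lambda>n. exp M * (1/2) ^ n)" by (intro summable_mult summable_geometric) simp
    fix n :: nat
    have g: "0 < Gamma (1 + real n * \<beta>)" using b by (intro Gamma_real_pos) (simp add: add_pos_nonneg)
    have "(2 * (\<bar>z\<bar> + 1)) ^ n * exp (- M) \<le> Gamma (1 + real n * \<beta>)"
      using Gamma_lower_bound[OF M, of "1 + real n * \<beta>"] b Mb[of n] by simp
    then have "(2 * (\<bar>z\<bar> + 1)) ^ n \<le> exp M * Gamma (1 + real n * \<beta>)"
      by (simp add: exp_minus field_simps)
    moreover have "\<bar>z\<bar> ^ n \<le> (1/2) ^ n * (2 * (\<bar>z\<bar> + 1)) ^ n"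
      by (subst power_mult_distrib[symmetric]) (auto intro!: power_mono)
    ultimately have "\<bar>z\<bar> ^ n \<le> (1/2) ^ n * (exp M * Gamma (1 + real n * \<beta>))"
      by (meson mult_left_mono order_trans zero_le_divide_1_iff zero_le_numeral zero_le_power)
    then show "norm (z ^ n / Gamma (1 + real n * \<beta>)) \<le> exp M * (1/2) ^ n"
      using g by (simp add: field_simps power_abs)
  qed
qed

lemma Mittag_Leffler_ge_1:
  assumes b: "0 < \<beta>" and z: "0 \<le> z"
  shows "1 \<le> Mittag_Leffler \<beta> z"
proof -
  have "sum (\<lambda>n. z ^ n / Gamma (1 + real n * \<beta>)) {..<1} \<le> Mittag_Leffler \<beta> z"
    unfolding Mittag_Leffler_def using b z
    by (intro sum_le_suminf summable_Mittag_Leffler)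
       (auto intro!: divide_nonneg_nonneg Gamma_real_nonneg add_pos_nonneg)
  then show ?thesis by simp
qed

section \<open>Lebesgue differentiation on the line\<close>

text \<open>Henstock's lemma bounds the total length of disjoint intervals on which the mean value of
  \<open>f\<close> deviates from the value at the tag; the covering lemma turns this into a
  bound for the outer measure of the set of bad tags.\<close>
lemma negligible_bad_tags:
  fixes f :: "real \<Rightarrow> real"
  assumes f: "f integrable_on cbox a b" and \<delta>: "0 < \<delta>"
  shows "negligible {x. \<forall>r>0. \<exists>u v. u < v \<and> v - u < r \<and> x \<in> {u..v} \<and> {u..v} \<subseteq> cbox a b \<and>
           \<delta> * (v - u) < \<bar>integral {u..v} f - f x * (v - u)\<bar>}" (is "negligible ?E")
  unfolding negligible_outer_le
proof (intro allI impI)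
  fix e :: real assume e: "e > 0"
  \<comment> \<open>The 5 pays for the fivefold enlargement in the covering lemma, \<delta> for the
    passage from deviation to length.\<close>
  define e' where "e' = e * \<delta> / 5"
  have e': "e' > 0" using e \<delta> by (simp add: e'_def)
  obtain \<gamma> where \<gamma>: "gauge \<gamma>" and hen: "\<And>p. \<lbrakk>p tagged_partial_division_of (cbox a b); \<gamma> fine p\<rbrakk> \<Longrightarrow>
             sum (\<lambda>(x,k). norm(measure lborel k *\<^sub>R f x - integral k f)) p < e'"
    using Henstock_lemma[OF f e'] by blast
  \<comment> \<open>The bad tagged intervals that are fine for the gauge. Length below 1 supplies
    the bounded radii that the covering lemma asks for.\<close>
  define K where "K = {(x, u, v). u < v \<and> v - u < 1 \<and> x \<in> {u..v} \<and> {u..v} \<subseteq> cbox a b \<and> {u..v} \<subseteq> \<gamma> x \<and>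
           \<delta> * (v - u) < \<bar>integral {u..v} f - f x * (v - u)\<bar>}"
  define c where "c = (\<lambda>(x::real, u::real, v::real). (u + v) / 2)"
  define r where "r = (\<lambda>(x::real, u::real, v::real). (v - u) / 2)"
  have cball_eq: "cball (c i) (r i) = {fst (snd i)..snd (snd i)}" for i
    by (cases i) (simp add: c_def r_def cball_eq_atLeastAtMost field_simps)
  have cov: "?E \<subseteq> (\<Union>i\<in>K. cball (c i) (r i))"
  proof
    fix x assume x: "x \<in> ?E"
    obtain d where d: "d > 0" "ball x d \<subseteq> \<gamma> x"
      using \<gamma> unfolding gauge_def by (meson openE)
    obtain u v where uv: "u < v" "v - u < min d 1" "x \<in> {u..v}" "{u..v} \<subseteq> cbox a b"
       "\<delta> * (v - u) < \<bar>integral {u..v} f - f x * (v - u)\<bar>"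
    proof -
      have "0 < min d 1" using d(1) by simp
      with x have "\<exists>u v. u < v \<and> v - u < min d 1 \<and> x \<in> {u..v} \<and> {u..v} \<subseteq> cbox a b \<and>
           \<delta> * (v - u) < \<bar>integral {u..v} f - f x * (v - u)\<bar>" by blast
      then show thesis using that by blast
    qed
    have "{u..v} \<subseteq> ball x d" using uv by (auto simp: dist_real_def)
    then have "(x, u, v) \<in> K" using uv d by (auto simp: K_def)
    then show "x \<in> (\<Union>i\<in>K. cball (c i) (r i))"
      using uv cball_eq[of "(x, u, v)"] by force
  qed
  have r: "0 < r i \<and> r i \<le> 1" if "i \<in> K" for i
    using that by (auto simp: K_def r_def)
  obtain C where C: "countable C" "C \<subseteq> K"
     "pairwise (\<lambda>i j. disjnt (cball (c i) (r i)) (cball (c j) (r j))) C"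
     "?E \<subseteq> (\<Union>i\<in>C. cball (c i) (5 * r i))"
    by (rule Vitali_covering_lemma_cballs[OF cov r])
  \<comment> \<open>Finitely many disjoint bad intervals form a tagged partial division. Henstock's
    lemma bounds their total deviation, which is at least \<delta> times their total length.\<close>
  have len: "\<delta> * (\<Sum>i\<in>C'. 2 * r i) \<le> e'" if C': "finite C'" "C' \<subseteq> C" for C'
  proof -
    define p where "p = (\<lambda>(x::real, u::real, v). (x, {u..v::real})) ` C'"
    have inK: "i \<in> K" if "i \<in> C'" for i using that C' C by auto
    have dis: "{u..v} \<inter> {u'..v'} = {}" if "(x, u, v) \<in> C'" "(x', u', v') \<in> C'" "(x, u, v) \<noteq> (x', u', v')"
      for x u v x' u' v'
      using C(3) that C'(2) cball_eq[of "(x, u, v)"] cball_eq[of "(x', u', v')"]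
      unfolding pairwise_def disjnt_def by (metis fst_conv snd_conv subsetD)
    have tp: "p tagged_partial_division_of (cbox a b)"
      unfolding tagged_partial_division_of_def
    proof (intro conjI allI impI)
      show "finite p" using C' by (simp add: p_def)
    next
      fix x k assume "(x, k) \<in> p"
      then obtain u v where i: "(x, u, v) \<in> C'" "k = {u..v}" by (auto simp: p_def)
      show "x \<in> k" "k \<subseteq> cbox a b" "\<exists>a b. k = cbox a b"
        using inK[OF i(1)] i(2) by (auto simp: K_def)
    next
      fix x1 k1 x2 k2 assume *: "(x1, k1) \<in> p \<and> (x2, k2) \<in> p \<and> (x1, k1) \<noteq> (x2, k2)"
      then obtain u v u' v' where i: "(x1, u, v) \<in> C'" "k1 = {u..v}" "(x2, u', v') \<in> C'" "k2 = {u'..v'}"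
        by (auto simp: p_def)
      with * have "(x1, u, v) \<noteq> (x2, u', v')" by auto
      from dis[OF i(1) i(3) this] show "interior k1 \<inter> interior k2 = {}"
        using i interior_subset[of k1] interior_subset[of k2] by blast
    qed
    have fine: "\<gamma> fine p"
      unfolding fine_def p_def using inK by (auto simp: K_def)
    have "u < v" if "(x, u, v) \<in> C'" for x u v
      using inK[OF that] by (simp add: K_def)
    then have inj: "inj_on (\<lambda>(x::real, u::real, v). (x, {u..v::real})) C'"
      by (fastforce simp: inj_on_def)
    have "\<delta> * (\<Sum>i\<in>C'. 2 * r i) = (\<Sum>i\<in>C'. \<delta> * (2 * r i))" by (simp add: sum_distrib_left)
    also have "\<dots> \<le> (\<Sum>(x, u, v)\<in>C'. norm (measure lborel {u..v} *\<^sub>R f x - integral {u..v} f))"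
    proof (rule sum_mono)
      fix i assume i: "i \<in> C'"
      obtain x u v where xuv: "i = (x, u, v)" by (cases i)
      have two_r: "2 * r i = v - u" by (simp add: xuv r_def)
      have "u < v" "\<delta> * (v - u) < \<bar>integral {u..v} f - f x * (v - u)\<bar>"
        using inK[OF i] by (simp_all add: xuv K_def)
      then show "\<delta> * (2 * r i) \<le> (case i of (x, u, v) \<Rightarrow> norm (measure lborel {u..v} *\<^sub>R f x - integral {u..v} f))"
        by (subst two_r) (simp add: xuv abs_minus_commute mult.commute)
    qed
    also have "\<dots> = sum (\<lambda>(x,k). norm(measure lborel k *\<^sub>R f x - integral k f)) p"
      unfolding p_def by (subst sum.reindex[OF inj]) (auto intro!: sum.cong simp: case_prod_beta)
    also have "\<dots> \<le> e'" using hen[OF tp fine] by simp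
    finally show ?thesis .
  qed
  let ?T = "\<Union>i\<in>C. cball (c i) (5 * r i)"
  have bound: "measure lebesgue (\<Union>i\<in>C'. cball (c i) (5 * r i)) \<le> e" if C': "C' \<subseteq> C" "finite C'" for C'
  proof -
    have "measure lebesgue (\<Union>i\<in>C'. cball (c i) (5 * r i)) \<le> (\<Sum>i\<in>C'. measure lebesgue (cball (c i) (5 * r i)))"
      using C' by (intro measure_UNION_le) auto
    also have "\<dots> = (\<Sum>i\<in>C'. 10 * r i)"
    proof (rule sum.cong[OF refl])
      fix i assume "i \<in> C'"
      then have "i \<in> K" using C'(1) C(2) by blast
      then have "0 < r i" using r by blast
      then show "measure lebesgue (cball (c i) (5 * r i)) = 10 * r i"
        by (simp add: cball_eq_atLeastAtMost)
    qed
    also have "\<dots> = 5 / \<delta> * (\<delta> * (\<Sum>i\<in>C'. 2 * r i))"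
      using \<delta> by (simp add: sum_distrib_left)
    also have "\<dots> \<le> 5 / \<delta> * e'"
      using len[OF C'(2) C'(1)] \<delta> by (intro mult_left_mono) auto
    also have "\<dots> = e" using \<delta> by (simp add: e'_def)
    finally show ?thesis .
  qed
  have "?T \<in> lmeasurable"
    by (rule fmeasurable_UN_bound[OF C(1) _ bound]) simp_all
  moreover have "measure lebesgue ?T \<le> e"
    by (rule measure_UN_bound[OF C(1) _ bound]) simp_all
  ultimately show "\<exists>T. ?E \<subseteq> T \<and> T \<in> lmeasurable \<and> measure lebesgue T \<le> e"
    using C(4) by blast
qed

text \<open>Lebesgue differentiation for a gauge integrable function. Off the union of the bad sets
  with tolerances 1/(n+1), the mean value over every short interval containing t is close to f t;
  the interval between t and y is the one in the difference quotient.\<close>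

theorem negligible_not_differentiable_integral:
  fixes f :: "real \<Rightarrow> real"
  assumes f: "f integrable_on {a..b}"
  shows "negligible {t \<in> {a<..<b}. \<not> ((\<lambda>s. integral {a..s} f) has_real_derivative f t) (at t)}"
proof -
  define E where "E n = {x. \<forall>r>0. \<exists>u v. u < v \<and> v - u < r \<and> x \<in> {u..v} \<and> {u..v} \<subseteq> cbox a b \<and>
           1 / real (Suc n) * (v - u) < \<bar>integral {u..v} f - f x * (v - u)\<bar>}" for n
  have "negligible (\<Union>n. E n)"
  proof (rule negligible_countable_Union)
    have "negligible (E n)" for n
      unfolding E_def by (rule negligible_bad_tags) (use f in simp_all)
    then show "negligible S" if "S \<in> range E" for S
      using that by blast
  qed simp
  moreover have "{t \<in> {a<..<b}. \<not> ((\<lambda>s. integral {a..s} f) has_real_derivative f t) (at t)} \<subseteq> (\<Union>n. E n)"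
  proof (rule ccontr)
    assume "\<not> ?thesis"
    then obtain t where t: "a < t" "t < b" "\<And>n. t \<notin> E n"
      and nd: "\<not> ((\<lambda>s. integral {a..s} f) has_real_derivative f t) (at t)" by auto
    have diff: "integral {a..v} f - integral {a..u} f = integral {u..v} f" if "a \<le> u" "u \<le> v" "v \<le> b" for u v
      using Henstock_Kurzweil_Integration.integral_combine[of a u v f] that
        integrable_subinterval_real[OF f, of a v] by auto
    have "((\<lambda>y. (integral {a..y} f - integral {a..t} f) / (y - t)) \<longlongrightarrow> f t) (at t)"
      unfolding tendsto_iff
    proof (intro allI impI)
      fix e :: real assume "e > 0"
      then obtain n where n: "1 / real (Suc n) < e" by (metis nat_approx_posE)
      obtain r where r: "r > 0" "\<And>u v. \<lbrakk>u < v; v - u < r; t \<in> {u..v}; {u..v} \<subseteq> cbox a b\<rbrakk> \<Longrightarrow>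
           \<bar>integral {u..v} f - f t * (v - u)\<bar> \<le> 1 / real (Suc n) * (v - u)"
        using t(3)[of n] unfolding E_def by (auto simp: not_less) (meson not_less)
      have "\<forall>\<^sub>F y in at t. y \<in> {a<..<b} \<and> y \<in> {t - r<..<t + r} \<and> y \<noteq> t"
        using t r by (intro eventually_conj eventually_at_in_open' ) 
          (auto simp: eventually_at_filter)
      then show "\<forall>\<^sub>F y in at t. dist ((integral {a..y} f - integral {a..t} f) / (y - t)) (f t) < e"
      proof eventually_elim
        case (elim y)
        define u v where "u = min y t" and "v = max y t"
        have uv: "u < v" "v - u < r" "t \<in> {u..v}" "{u..v} \<subseteq> cbox a b"
          using elim t by (auto simp: u_def v_def)
        have q: "(integral {a..y} f - integral {a..t} f) / (y - t) = integral {u..v} f / (v - u)"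
          using diff[of t y] diff[of y t] elim t
          by (cases "y < t") (auto simp: u_def v_def field_simps)
        have "\<bar>integral {u..v} f / (v - u) - f t\<bar> = \<bar>integral {u..v} f - f t * (v - u)\<bar> / (v - u)"
          using uv(1) by (simp add: field_simps flip: abs_mult_pos)
        also have "\<dots> \<le> 1 / real (Suc n)"
          using r(2)[OF uv] uv(1) by (simp add: pos_divide_le_eq)
        finally show ?case using n by (simp add: q dist_real_def)
      qed
    qed
    then show False using nd by (simp add: has_field_derivative_iff)
  qed
  ultimately show ?thesis by (rule negligible_subset)
qed

section \<open>Fractional integrals on the line\<close>

text \<open>\<open>nfint\<close> serves the Tonelli arguments; \<open>fint\<close> is \<open>0\<close> where the integral does not
  converge absolutely.\<close>
definition nfint :: "real \<Rightarrow> (real \<Rightarrow> ennreal) \<Rightarrow> real \<Rightarrow> ennreal" where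
  "nfint a f t = (\<integral>\<^sup>+s. ennreal (kern a (t - s)) * f s \<partial>lborel)"

definition fint :: "real \<Rightarrow> (real \<Rightarrow> real) \<Rightarrow> real \<Rightarrow> real" where
  "fint a f t = (LINT s|lborel. kern a (t - s) * f s)"

lemma nfint_measurable [measurable]:
  assumes [measurable]: "f \<in> borel_measurable borel"
  shows "nfint a f \<in> borel_measurable borel"
  unfolding nfint_def[abs_def] by measurable

lemma fint_measurable [measurable]:
  assumes [measurable]: "f \<in> borel_measurable borel"
  shows "fint a f \<in> borel_measurable borel"
  unfolding fint_def[abs_def] by measurable

lemma nfint_mono:
  assumes "\<And>s. s < t \<Longrightarrow> f s \<le> g s"
  shows "nfint a f t \<le> nfint a g t"
  unfolding nfint_def
proof (rule nn_integral_mono)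
  fix s show "ennreal (kern a (t - s)) * f s \<le> ennreal (kern a (t - s)) * g s"
    using assms[of s] by (cases "s < t") (auto intro: mult_left_mono)
qed

lemma nfint_cong:
  assumes "\<And>s. s < t \<Longrightarrow> f s = g s"
  shows "nfint a f t = nfint a g t"
  by (intro antisym nfint_mono) (use assms in auto)

lemma fint_cong:
  assumes "\<And>s. s < t \<Longrightarrow> f s = g s"
  shows "fint a f t = fint a g t"
  unfolding fint_def
proof (rule Bochner_Integration.integral_cong[OF refl])
  fix s show "kern a (t - s) * f s = kern a (t - s) * g s"
    using assms[of s] by (cases "s < t") auto
qed

lemma fint_eq_0: "(\<And>s. s < t \<Longrightarrow> f s = 0) \<Longrightarrow> fint a f t = 0"
  using fint_cong[of t f "\<lambda>_. 0" a] by (simp add: fint_def)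

lemma nfint_cmult:
  assumes [measurable]: "f \<in> borel_measurable borel"
  shows "nfint a (\<lambda>s. c * f s) t = c * nfint a f t"
proof -
  have "nfint a (\<lambda>s. c * f s) t = (\<integral>\<^sup>+s. c * (ennreal (kern a (t - s)) * f s) \<partial>lborel)"
    unfolding nfint_def by (simp add: mult_ac)
  also have "\<dots> = c * nfint a f t" unfolding nfint_def by (rule nn_integral_cmult) measurable
  finally show ?thesis .
qed

lemma nfint_add:
  assumes [measurable]: "f \<in> borel_measurable borel" "g \<in> borel_measurable borel"
  shows "nfint a (\<lambda>s. f s + g s) t = nfint a f t + nfint a g t"
  unfolding nfint_def distrib_left by (rule nn_integral_add) measurable

lemma nfint_nfint:
  assumes [measurable]: "f \<in> borel_measurable borel" and ab: "0 < a" "0 < b"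
  shows "nfint a (nfint b f) t = nfint (a + b) f t"
proof -
  have "nfint a (nfint b f) t = (\<integral>\<^sup>+r. (\<integral>\<^sup>+s. ennreal (kern a (t - s)) * ennreal (kern b (s - r)) \<partial>lborel) * f r \<partial>lborel)"
    unfolding nfint_def by (rule nn_integral_mult_swap) measurable
  also have "\<dots> = nfint (a + b) f t"
    unfolding nn_integral_kern_kern[OF ab] nfint_def ..
  finally show ?thesis .
qed

lemma nfint_kern:
  assumes "0 < a" "0 < b"
  shows "nfint a (\<lambda>s. ennreal (kern b s)) t = ennreal (kern (a + b) t)"
  using nn_integral_kern_kern[OF assms, of t 0] by (simp add: nfint_def)

lemma kern_1: "kern 1 \<tau> = indicator {0<..} \<tau>"
  by (simp add: kern_def omega_def indicator_def)

lemma nfint_1: "nfint 1 f t = (\<integral>\<^sup>+s. f s * indicator {..<t} s \<partial>lborel)"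
  unfolding nfint_def kern_1 by (intro nn_integral_cong) (auto simp: indicator_def)

lemma nfint_1_le: "nfint 1 f t \<le> (\<integral>\<^sup>+s. f s \<partial>lborel)"
  unfolding nfint_1 by (intro nn_integral_mono) (auto simp: indicator_def)

lemma fint_1: "fint 1 f t = (LINT s|lborel. indicator {..<t} s * f s)"
  unfolding fint_def kern_1 by (intro Bochner_Integration.integral_cong) (auto simp: indicator_def)

lemma integrable_kern_mult:
  assumes [measurable]: "f \<in> borel_measurable borel" and a: "0 < a"
    and "nfint a (\<lambda>s. ennreal \<bar>f s\<bar>) t < \<infinity>"
  shows "integrable lborel (\<lambda>s. kern a (t - s) * f s)"
proof (rule integrableI_bounded)
  have "(\<integral>\<^sup>+ s. ennreal (norm (kern a (t - s) * f s)) \<partial>lborel) = nfint a (\<lambda>s. ennreal \<bar>f s\<bar>) t"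
    unfolding nfint_def using a by (intro nn_integral_cong) (simp add: abs_mult ennreal_mult)
  then show "(\<integral>\<^sup>+ s. ennreal (norm (kern a (t - s) * f s)) \<partial>lborel) < \<infinity>" using assms by simp
qed measurable

lemma abs_fint_le:
  assumes [measurable]: "f \<in> borel_measurable borel" and a: "0 < a"
  shows "ennreal \<bar>fint a f t\<bar> \<le> nfint a (\<lambda>s. ennreal \<bar>f s\<bar>) t"
proof (cases "nfint a (\<lambda>s. ennreal \<bar>f s\<bar>) t < \<infinity>")
  case True
  have "ennreal \<bar>fint a f t\<bar> \<le> (\<integral>\<^sup>+ s. ennreal (norm (kern a (t - s) * f s)) \<partial>lborel)"
    using integral_norm_bound_ennreal[OF integrable_kern_mult[OF assms True]] by (simp add: fint_def)
  also have "\<dots> = nfint a (\<lambda>s. ennreal \<bar>f s\<bar>) t"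
    unfolding nfint_def using a by (intro nn_integral_cong) (simp add: abs_mult ennreal_mult)
  finally show ?thesis .
next
  case False
  then have "nfint a (\<lambda>s. ennreal \<bar>f s\<bar>) t = top" by (simp add: not_less top_unique)
  then show ?thesis by simp
qed

text \<open>Fubini, justified by absolute convergence of the double integral at this one t. The
  inner integral may diverge at exceptional times, where \<open>fint\<close> is 0; these form a null
  set for the outer integral.\<close>

lemma fint_fint:
  assumes [measurable]: "f \<in> borel_measurable borel" and ab: "0 < a" "0 < b"
    and fin: "nfint (a + b) (\<lambda>s. ennreal \<bar>f s\<bar>) t < \<infinity>"
  shows "fint a (fint b f) t = fint (a + b) f t"
proof -
  let ?k = "\<lambda>s r. kern a (t - s) * (kern b (s - r) * f r)"
  have int: "integrable (lborel \<Otimes>\<^sub>M lborel) (\<lambda>(s, r). ?k s r)"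
  proof (rule integrableI_bounded)
    have "(\<integral>\<^sup>+z. ennreal (norm (case z of (s, r) \<Rightarrow> ?k s r)) \<partial>(lborel \<Otimes>\<^sub>M lborel))
      = (\<integral>\<^sup>+s. \<integral>\<^sup>+r. ennreal (kern a (t - s)) * (ennreal (kern b (s - r)) * ennreal \<bar>f r\<bar>) \<partial>lborel \<partial>lborel)"
      using ab by (subst lborel.nn_integral_fst[symmetric]) (auto simp: abs_mult ennreal_mult)
    also have "\<dots> = nfint a (nfint b (\<lambda>s. ennreal \<bar>f s\<bar>)) t"
      unfolding nfint_def by (intro nn_integral_cong nn_integral_cmult) measurable
    also have "\<dots> < \<infinity>"
      using fin ab by (subst nfint_nfint) auto
    finally show "(\<integral>\<^sup>+z. ennreal (norm (case z of (s, r) \<Rightarrow> ?k s r)) \<partial>(lborel \<Otimes>\<^sub>M lborel)) < \<infinity>" .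
  qed measurable
  have "fint a (fint b f) t = (LINT s|lborel. LINT r|lborel. ?k s r)"
    unfolding fint_def by simp
  also have "\<dots> = (LINT r|lborel. LINT s|lborel. ?k s r)"
    using lborel_pair.Fubini_integral[OF int] by simp
  also have "\<dots> = (LINT r|lborel. kern (a + b) (t - r) * f r)"
  proof (rule Bochner_Integration.integral_cong[OF refl])
    fix r
    have "(LINT s|lborel. kern a (t - s) * kern b (s - r)) = kern (a + b) (t - r)"
    proof -
      have "(\<integral>\<^sup>+s. ennreal (kern a (t - s) * kern b (s - r)) \<partial>lborel) = ennreal (kern (a + b) (t - r))"
        using ab by (simp add: ennreal_mult nn_integral_kern_kern)
      then show ?thesis using ab by (simp add: integral_eq_nn_integral)
    qed
    moreover have "(LINT s|lborel. ?k s r)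
      = (LINT s|lborel. kern a (t - s) * kern b (s - r)) * f r"
      by (simp flip: mult.assoc)
    ultimately show "(LINT s|lborel. ?k s r) = kern (a + b) (t - r) * f r"
      by simp
  qed
  finally show ?thesis by (simp add: fint_def)
qed

section \<open>Cauchy-Schwarz estimates for fractional integrals\<close>

lemma nfint_sq_le:
  assumes [measurable]: "z \<in> borel_measurable borel" and z: "\<And>s. s \<le> 0 \<Longrightarrow> z s = 0" and b: "0 < b"
  shows "(nfint b z t)\<^sup>2 \<le> ennreal (kern (1 + b) t) * nfint b (\<lambda>s. (z s)\<^sup>2) t"
proof -
  \<comment> \<open>The kernel is split evenly between the two factors. Inserting
    \<open>kern 1 s\<close>, the indicator of s > 0, changes nothing as z vanishes for s \<le> 0,
    but makes the first factor the finite I^b 1.\<close>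
  have "nfint b z t = (\<integral>\<^sup>+s. ennreal (sqrt (kern b (t - s) * kern 1 s)) * (ennreal (sqrt (kern b (t - s))) * z s) \<partial>lborel)"
    unfolding nfint_def
  proof (rule nn_integral_cong)
    fix s show "ennreal (kern b (t - s)) * z s = ennreal (sqrt (kern b (t - s) * kern 1 s)) * (ennreal (sqrt (kern b (t - s))) * z s)"
      using z[of s] b by (cases "s \<le> 0") (auto simp: kern_1 mult.assoc[symmetric] ennreal_mult[symmetric])
  qed
  also have "\<dots>\<^sup>2 \<le> (\<integral>\<^sup>+s. (ennreal (sqrt (kern b (t - s) * kern 1 s)))\<^sup>2 \<partial>lborel) * (\<integral>\<^sup>+s. (ennreal (sqrt (kern b (t - s))) * z s)\<^sup>2 \<partial>lborel)"
    by (intro Cauchy_Schwarz_nn_integral) measurable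
  also have "(\<integral>\<^sup>+s. (ennreal (sqrt (kern b (t - s) * kern 1 s)))\<^sup>2 \<partial>lborel) = nfint b (\<lambda>s. ennreal (kern 1 s)) t"
    unfolding nfint_def using b by (intro nn_integral_cong) (simp add: power2_eq_square ennreal_mult[symmetric])
  also have "\<dots> = ennreal (kern (1 + b) t)"
    using b by (subst nfint_kern) (auto simp: add.commute)
  also have "(\<integral>\<^sup>+s. (ennreal (sqrt (kern b (t - s))) * z s)\<^sup>2 \<partial>lborel) = nfint b (\<lambda>s. (z s)\<^sup>2) t"
  proof -
    have "(ennreal (sqrt (kern b (t - s))) * z s)\<^sup>2 = ennreal (kern b (t - s)) * (z s)\<^sup>2" for s
      using b by (simp add: power_mult_distrib ennreal_power)
    then show ?thesis by (simp add: nfint_def)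
  qed
  finally show ?thesis .
qed

lemma kern_mono: "1 \<le> a \<Longrightarrow> s \<le> t \<Longrightarrow> kern a s \<le> kern a t"
  using Gamma_real_pos[of a] by (auto simp: kern_def omega_def intro!: divide_right_mono powr_mono2)

text \<open>\<open>kern (1 + b)\<close> is nondecreasing, so it can be frozen at t, and I^1 commutes
  with I^b. The right-hand side is thus a fractional integral of the primitive of z^2, the form that
  can be iterated.\<close>

lemma nfint_1_nfint_sq_le:
  assumes [measurable]: "z \<in> borel_measurable borel" and z: "\<And>s. s \<le> 0 \<Longrightarrow> z s = 0" and b: "0 < b"
  shows "nfint 1 (\<lambda>s. (nfint b z s)\<^sup>2) t \<le> ennreal (kern (1 + b) t) * nfint b (nfint 1 (\<lambda>s. (z s)\<^sup>2)) t"
proof -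
  have "nfint 1 (\<lambda>s. (nfint b z s)\<^sup>2) t \<le> nfint 1 (\<lambda>s. ennreal (kern (1 + b) t) * nfint b (\<lambda>s. (z s)\<^sup>2) s) t"
  proof (rule nfint_mono)
    fix s assume "s < t"
    have "(nfint b z s)\<^sup>2 \<le> ennreal (kern (1 + b) s) * nfint b (\<lambda>s. (z s)\<^sup>2) s"
      by (rule nfint_sq_le) (use z b in auto)
    also have "\<dots> \<le> ennreal (kern (1 + b) t) * nfint b (\<lambda>s. (z s)\<^sup>2) s"
      using \<open>s < t\<close> b by (intro mult_right_mono ennreal_leI kern_mono) auto
    finally show "(nfint b z s)\<^sup>2 \<le> ennreal (kern (1 + b) t) * nfint b (\<lambda>s. (z s)\<^sup>2) s" .
  qed
  also have "\<dots> = ennreal (kern (1 + b) t) * nfint 1 (nfint b (\<lambda>s. (z s)\<^sup>2)) t"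
    by (rule nfint_cmult) measurable
  also have "nfint 1 (nfint b (\<lambda>s. (z s)\<^sup>2)) t = nfint b (nfint 1 (\<lambda>s. (z s)\<^sup>2)) t"
    using b by (simp add: nfint_nfint add.commute)
  finally show ?thesis .
qed

text \<open>The primitive of g is nondecreasing, so its value at t comes out of the integral and
  only the kernel is integrated.\<close>

lemma nfint_le_nfint_1:
  assumes [measurable]: "g \<in> borel_measurable borel" and g: "\<And>s. s \<le> 0 \<Longrightarrow> g s = 0" and b: "0 < b"
  shows "nfint b (nfint 1 g) t \<le> ennreal (kern (1 + b) t) * nfint 1 g t"
proof -
  have "nfint b (nfint 1 g) t \<le> nfint b (\<lambda>s. nfint 1 g t * ennreal (kern 1 s)) t"
  proof (rule nfint_mono)
    fix s assume st: "s < t"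
    show "nfint 1 g s \<le> nfint 1 g t * ennreal (kern 1 s)"
    proof (cases "s \<le> 0")
      case True
      then have "nfint 1 g s = nfint 1 (\<lambda>s. 0) s" using g by (intro nfint_cong) auto
      then show ?thesis by (simp add: nfint_def)
    next
      case False
      then show ?thesis using st unfolding kern_1 nfint_1
        by (auto intro!: nn_integral_mono simp: indicator_def)
    qed
  qed
  also have "\<dots> = nfint 1 g t * ennreal (kern (1 + b) t)"
    using b by (simp add: nfint_cmult nfint_kern add.commute)
  finally show ?thesis by (simp add: mult.commute)
qed

text \<open>(s^(a-1))^2 = s^((2a-1)-1): the square is again a kernel, and squared L2 norms of
  kernels follow from the semigroup law.\<close>

lemma kern_square:
  assumes "1/2 < a"
  shows "(kern a s)\<^sup>2 = Gamma (2 * a - 1) / (Gamma a)\<^sup>2 * kern (2 * a - 1) s"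
proof (cases "0 < s")
  case True
  have G: "0 < Gamma (2 * a - 1)" using assms by (intro Gamma_real_pos) auto
  have "(s powr (a - 1))\<^sup>2 = s powr (2 * a - 2)"
    using True by (simp add: power2_eq_square powr_add[symmetric])
  moreover have "kern (2 * a - 1) s = s powr (2 * a - 2) / Gamma (2 * a - 1)"
    "kern a s = s powr (a - 1) / Gamma a"
    using True by (simp_all add: kern_def omega_def)
  ultimately show ?thesis
    using less_imp_neq[OF G] by (simp only: power_divide) simp
qed simp

text \<open>Gamma(2a) = (2a-1) Gamma(2a-1) produces the denominator, and Gamma a \<ge> 1 is dropped.
  Used with a = \<alpha> for the initial value and with a = 1 - \<alpha>/2 for the factor
  t^(1-\<alpha>)/(1-\<alpha>).\<close>

lemma kern_square_bound:
  assumes a: "1/2 < a" "a \<le> 1" and t: "0 \<le> t"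
  shows "Gamma (2 * a - 1) / (Gamma a)\<^sup>2 * kern (2 * a) t \<le> t powr (2 * a - 1) / (2 * a - 1)"
proof (cases "t = 0")
  case False
  have G: "0 < Gamma (2 * a - 1)" "1 \<le> Gamma a"
    using a by (auto intro!: Gamma_real_pos Gamma_ge_1)
  have "Gamma (2 * a) = (2 * a - 1) * Gamma (2 * a - 1)"
    using Gamma_plus1[of "2 * a - 1"] a nonpos_Ints_nonpos[of "2 * a - 1"] by (auto simp: algebra_simps)
  then have "kern (2 * a) t = t powr (2 * a - 1) / ((2 * a - 1) * Gamma (2 * a - 1))"
    using t False by (simp add: kern_def omega_def)
  then have "Gamma (2 * a - 1) / (Gamma a)\<^sup>2 * kern (2 * a) t = t powr (2 * a - 1) / (2 * a - 1) / (Gamma a)\<^sup>2"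
    using less_imp_neq[OF G(1)] by (simp only:) simp
  also have "\<dots> \<le> t powr (2 * a - 1) / (2 * a - 1) / 1"
    using a G by (intro divide_left_mono) auto
  finally show ?thesis by simp
qed simp

text \<open>Writes I^1 f as I^(1-b) of I^b f. As b < 1/2, the index 1 - b exceeds 1/2, so the kernel
  is locally square integrable and can stand alone in one factor of Cauchy-Schwarz.\<close>

lemma fint_1_sq_le:
  assumes [measurable]: "f \<in> borel_measurable borel" and f: "\<And>s. s \<le> 0 \<Longrightarrow> f s = 0"
    and b: "0 < b" "b < 1/2" and fin: "nfint 1 (\<lambda>s. ennreal \<bar>f s\<bar>) t < \<infinity>" and t: "0 \<le> t"
  shows "ennreal ((fint 1 f t)\<^sup>2)
    \<le> ennreal (t powr (1 - 2 * b) / (1 - 2 * b)) * nfint 1 (\<lambda>s. ennreal ((fint b f s)\<^sup>2)) t"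
proof -
  define c where "c = Gamma (1 - 2 * b) / (Gamma (1 - b))\<^sup>2"
  have c: "0 \<le> c" using b by (auto simp: c_def intro!: divide_nonneg_nonneg Gamma_real_nonneg)
  have z0: "fint b f s = 0" if "s \<le> 0" for s using f that by (intro fint_eq_0) auto
  have "ennreal \<bar>fint 1 f t\<bar> = ennreal \<bar>fint (1 - b) (fint b f) t\<bar>"
    using b fin by (subst fint_fint) auto
  also have "\<dots> \<le> nfint (1 - b) (\<lambda>s. ennreal \<bar>fint b f s\<bar>) t"
    using b by (intro abs_fint_le) auto
  finally have "(ennreal \<bar>fint 1 f t\<bar>)\<^sup>2 \<le> (nfint (1 - b) (\<lambda>s. ennreal \<bar>fint b f s\<bar>) t)\<^sup>2"
    by (intro power_mono) auto
  also have "nfint (1 - b) (\<lambda>s. ennreal \<bar>fint b f s\<bar>) t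
    = (\<integral>\<^sup>+s. ennreal (kern (1 - b) (t - s) * kern 1 s) * (ennreal \<bar>fint b f s\<bar> * indicator {..<t} s) \<partial>lborel)"
    unfolding nfint_def
  proof (rule nn_integral_cong)
    fix s show "ennreal (kern (1 - b) (t - s)) * ennreal \<bar>fint b f s\<bar>
      = ennreal (kern (1 - b) (t - s) * kern 1 s) * (ennreal \<bar>fint b f s\<bar> * indicator {..<t} s)"
      using z0[of s] by (cases "s \<le> 0"; cases "s < t") (auto simp: kern_1)
  qed
  also have "\<dots>\<^sup>2 \<le> (\<integral>\<^sup>+s. (ennreal (kern (1 - b) (t - s) * kern 1 s))\<^sup>2 \<partial>lborel)
      * (\<integral>\<^sup>+s. (ennreal \<bar>fint b f s\<bar> * indicator {..<t} s)\<^sup>2 \<partial>lborel)"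
    by (intro Cauchy_Schwarz_nn_integral) measurable
  also have "(\<integral>\<^sup>+s. (ennreal \<bar>fint b f s\<bar> * indicator {..<t} s)\<^sup>2 \<partial>lborel) = nfint 1 (\<lambda>s. ennreal ((fint b f s)\<^sup>2)) t"
    unfolding nfint_1 by (intro nn_integral_cong) (auto simp: indicator_def ennreal_power)
  also have "(\<integral>\<^sup>+s. (ennreal (kern (1 - b) (t - s) * kern 1 s))\<^sup>2 \<partial>lborel)
     = (\<integral>\<^sup>+s. ennreal c * (ennreal (kern (1 - 2 * b) (t - s)) * ennreal (kern 1 (s - 0))) \<partial>lborel)"
    using kern_square[of "1 - b"] b c by (intro nn_integral_cong)
      (simp add: c_def[symmetric] kern_1 ennreal_power ennreal_mult[symmetric] power_mult_distrib indicator_def)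
  also have "\<dots> = ennreal (c * kern (2 - 2 * b) t)"
    using b c by (subst nn_integral_cmult, simp, subst nn_integral_kern_kern) (auto simp: ennreal_mult)
  also have "\<dots> \<le> ennreal (t powr (1 - 2 * b) / (1 - 2 * b))"
    using kern_square_bound[of "1 - b" t] b t by (intro ennreal_leI) (simp add: c_def)
  finally show ?thesis by (simp add: ennreal_power mult_right_mono)
qed

section \<open>Positivity and a Gronwall inequality\<close>

text \<open>Expand both fractional integrals and integrate over \<tau> first. The overlap kernel is
  symmetric in r and r'; its halves r' < r and r < r' give the two pairings on the right.\<close>

lemma nn_integral_nfint_mult:
  assumes [measurable]: "f \<in> borel_measurable borel" "g \<in> borel_measurable borel"
    and b: "0 < b" "b < 1/2"
  shows "(\<integral>\<^sup>+\<tau>. nfint b f \<tau> * nfint b g \<tau> \<partial>lborel) = ennreal (1 / (2 * cos (pi * b))) *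
     ((\<integral>\<^sup>+s. f s * nfint (2 * b) g s \<partial>lborel) + (\<integral>\<^sup>+s. g s * nfint (2 * b) f s \<partial>lborel))"
proof -
  let ?k = "\<lambda>r r'. \<integral>\<^sup>+\<tau>. ennreal (kern b (\<tau> - r)) * ennreal (kern b (\<tau> - r')) \<partial>lborel"
  let ?h = "\<lambda>r. \<integral>\<^sup>+r'. ennreal (kern (2 * b) (r' - r)) * g r' \<partial>lborel"
  define c where "c = 1 / (2 * cos (pi * b))"
  have c: "c > 0" using b by (auto simp: c_def intro!: cos_gt_zero)
  have inner: "(\<integral>\<^sup>+\<tau>. ennreal (kern b (\<tau> - r)) * nfint b g \<tau> \<partial>lborel)
     = ennreal c * (nfint (2 * b) g r + ?h r)" for r
  proof -
    have "(\<integral>\<^sup>+\<tau>. ennreal (kern b (\<tau> - r)) * nfint b g \<tau> \<partial>lborel)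
      = (\<integral>\<^sup>+r'. ?k r r' * g r' \<partial>lborel)"
      unfolding nfint_def by (rule nn_integral_mult_swap) measurable
    also have "\<dots> = (\<integral>\<^sup>+r'. ennreal c * (ennreal (kern (2 * b) (r - r')) * g r' + ennreal (kern (2 * b) (r' - r)) * g r') \<partial>lborel)"
    proof (rule nn_integral_cong_AE)
      \<comment> \<open>The diagonal r' = r, where the overlap integral is infinite, has to be left
        out.\<close>
      show "AE r' in lborel. ?k r r' * g r'
        = ennreal c * (ennreal (kern (2 * b) (r - r')) * g r' + ennreal (kern (2 * b) (r' - r)) * g r')"
        using AE_lborel_singleton[of r]
      proof eventually_elim
        case (elim r')
        then have "?k r r'
          = ennreal (c * (kern (2 * b) (r - r') + kern (2 * b) (r' - r)))"
          using b by (subst nn_integral_kern_overlap) (auto simp: c_def)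
        also have "\<dots> = ennreal c * (ennreal (kern (2 * b) (r - r')) + ennreal (kern (2 * b) (r' - r)))"
          using c b by (simp add: ennreal_mult)
        finally show ?case by (simp add: distrib_left distrib_right mult_ac)
      qed
    qed
    also have "\<dots> = ennreal c * (nfint (2 * b) g r + ?h r)"
      unfolding nfint_def by (subst nn_integral_cmult, measurable, subst nn_integral_add) auto
    finally show ?thesis .
  qed
  have swap: "(\<integral>\<^sup>+r. f r * ?h r \<partial>lborel)
     = (\<integral>\<^sup>+r. g r * nfint (2 * b) f r \<partial>lborel)"
    by (subst nn_integral_mult_swap) (measurable, simp add: nfint_def mult.commute)
  have "(\<integral>\<^sup>+\<tau>. nfint b f \<tau> * nfint b g \<tau> \<partial>lborel)
    = (\<integral>\<^sup>+\<tau>. nfint b g \<tau> * (\<integral>\<^sup>+r. ennreal (kern b (\<tau> - r)) * f r \<partial>lborel) \<partial>lborel)"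
    by (simp add: nfint_def mult.commute)
  also have "\<dots> = (\<integral>\<^sup>+r. (\<integral>\<^sup>+\<tau>. nfint b g \<tau> * ennreal (kern b (\<tau> - r)) \<partial>lborel) * f r \<partial>lborel)"
    by (rule nn_integral_mult_swap) measurable
  also have "\<dots> = (\<integral>\<^sup>+r. f r * (\<integral>\<^sup>+\<tau>. ennreal (kern b (\<tau> - r)) * nfint b g \<tau> \<partial>lborel) \<partial>lborel)"
    by (simp add: mult.commute)
  also have "\<dots> = (\<integral>\<^sup>+r. ennreal c * (f r * nfint (2 * b) g r + f r * ?h r) \<partial>lborel)"
    unfolding inner by (simp add: distrib_left mult_ac)
  also have "\<dots> = ennreal c * ((\<integral>\<^sup>+r. f r * nfint (2 * b) g r \<partial>lborel)
      + (\<integral>\<^sup>+r. f r * ?h r \<partial>lborel))"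
    by (subst nn_integral_cmult, measurable, subst nn_integral_add) auto
  finally show ?thesis unfolding swap c_def .
qed

text \<open>Carries an identity in \<open>ennreal\<close> over to real integrals: the product is
  infinite only on a null set, so \<open>enn2real\<close> loses nothing.\<close>

lemma integral_enn2real_mult:
  assumes [measurable]: "u \<in> borel_measurable M" "v \<in> borel_measurable M"
    and fin: "(\<integral>\<^sup>+x. u x * v x \<partial>M) < \<infinity>"
  shows "integrable M (\<lambda>x. enn2real (u x) * enn2real (v x))" (is ?i)
    and "(LINT x|M. enn2real (u x) * enn2real (v x)) = enn2real (\<integral>\<^sup>+x. u x * v x \<partial>M)" (is ?e)
proof -
  have "AE x in M. u x * v x \<noteq> \<infinity>"
    by (rule nn_integral_PInf_AE) (use fin in auto)
  then have *: "(\<integral>\<^sup>+x. ennreal (enn2real (u x) * enn2real (v x)) \<partial>M) = (\<integral>\<^sup>+x. u x * v x \<partial>M)"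
    by (intro nn_integral_cong_AE, eventually_elim) (simp add: enn2real_mult[symmetric] less_top)
  show ?i by (rule integrableI_nonneg) (use fin * in auto)
  show ?e by (simp add: integral_eq_nn_integral *)
qed

lemma fint_eq_diff:
  assumes [measurable]: "f \<in> borel_measurable borel" and a: "0 < a"
    and fin: "nfint a (\<lambda>s. ennreal \<bar>f s\<bar>) t < \<infinity>"
  shows "fint a f t = enn2real (nfint a (\<lambda>s. ennreal (f s)) t) - enn2real (nfint a (\<lambda>s. ennreal (- f s)) t)"
proof -
  have "ennreal (kern a (t - s) * f s) = ennreal (kern a (t - s)) * ennreal (f s)"
       "ennreal (- (kern a (t - s) * f s)) = ennreal (kern a (t - s)) * ennreal (- f s)" for s
    using a by (simp_all flip: ennreal_mult')
  then show ?thesis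
    unfolding fint_def real_lebesgue_integral_def[OF integrable_kern_mult[OF assms]] nfint_def by simp
qed

text \<open>Both sides are the quadratic form with kernel \<open>\<bar>r - s\<bar>\<^bsup>2b - 1\<^esup>\<close>, up to a constant.\<close>
theorem integral_mult_fint:
  assumes [measurable]: "f \<in> borel_measurable borel" and b: "0 < b" "b < 1/2"
    and fin: "(\<integral>\<^sup>+s. ennreal \<bar>f s\<bar> * nfint (2 * b) (\<lambda>s. ennreal \<bar>f s\<bar>) s \<partial>lborel) < \<infinity>"
    and ae: "AE s in lborel. nfint (2 * b) (\<lambda>s. ennreal \<bar>f s\<bar>) s < \<infinity>"
  shows "integrable lborel (\<lambda>s. (fint b f s)\<^sup>2)"
    and "integrable lborel (\<lambda>s. f s * fint (2 * b) f s)"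
    and "(LINT s|lborel. f s * fint (2 * b) f s) = cos (pi * b) * (LINT s|lborel. (fint b f s)\<^sup>2)"
proof -
  \<comment> \<open>The bilinear identity is available for nonnegative functions only. Both sides
    become combinations of pairings between the parts of f, all dominated by the pairing of |f| with
    itself, which \<open>fin\<close> makes finite.\<close>
  define fp fn fa where "fp s = ennreal (f s)" and "fn s = ennreal (- f s)" and "fa s = ennreal \<bar>f s\<bar>" for s
  have [measurable]: "fp \<in> borel_measurable borel" "fn \<in> borel_measurable borel" "fa \<in> borel_measurable borel"
    by (simp_all add: fp_def[abs_def] fn_def[abs_def] fa_def[abs_def])
  define c where "c = 1 / (2 * cos (pi * b))"
  have cos: "cos (pi * b) > 0" using b by (auto intro!: cos_gt_zero)
  have c: "c > 0" using cos by (simp add: c_def)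
  have le: "fp s \<le> fa s" "fn s \<le> fa s" for s by (auto simp: fp_def fn_def fa_def ennreal_leI)
  note nle = nfint_mono[of _ fp fa, OF le(1)] nfint_mono[of _ fn fa, OF le(2)]
  have bound: "(\<integral>\<^sup>+s. u s * nfint (2 * b) v s \<partial>lborel) < \<infinity>" if "u \<in> {fp, fn, fa}" "v \<in> {fp, fn, fa}" for u v
  proof -
    have "u s \<le> fa s" "nfint (2 * b) v s \<le> nfint (2 * b) fa s" for s
      using that le nle by auto
    then have "(\<integral>\<^sup>+s. u s * nfint (2 * b) v s \<partial>lborel) \<le> (\<integral>\<^sup>+s. fa s * nfint (2 * b) fa s \<partial>lborel)"
      by (intro nn_integral_mono mult_mono) auto
    then show ?thesis using fin by (simp add: fa_def[abs_def] le_less_trans)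
  qed
  have bil: "(\<integral>\<^sup>+\<tau>. nfint b u \<tau> * nfint b v \<tau> \<partial>lborel) = ennreal c *
     ((\<integral>\<^sup>+s. u s * nfint (2 * b) v s \<partial>lborel) + (\<integral>\<^sup>+s. v s * nfint (2 * b) u s \<partial>lborel))"
    if [measurable]: "u \<in> borel_measurable borel" "v \<in> borel_measurable borel" for u v
    unfolding c_def by (rule nn_integral_nfint_mult[OF that b])
  have bound': "(\<integral>\<^sup>+\<tau>. nfint b u \<tau> * nfint b v \<tau> \<partial>lborel) < \<infinity>" if "u \<in> {fp, fn, fa}" "v \<in> {fp, fn, fa}" for u v
  proof -
    have "u \<in> borel_measurable borel" "v \<in> borel_measurable borel" using that by auto
    then show ?thesis using bound[OF that] bound[OF that(2,1)]
      by (simp add: bil ennreal_mult_less_top)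
  qed
  have "AE s in lborel. nfint b fa s * nfint b fa s \<noteq> \<infinity>"
    by (rule nn_integral_PInf_AE) (use bound'[of fa fa] in auto)
  then have aeb: "AE s in lborel. nfint b fa s < \<infinity>"
    by eventually_elim (auto simp: less_top ennreal_mult_eq_top_iff)
  note I = integral_enn2real_mult[OF _ _ bound'] integral_enn2real_mult[OF _ _ bound]
  define p n P N where "p s = enn2real (nfint b fp s)" and "n s = enn2real (nfint b fn s)"
    and "P s = enn2real (nfint (2 * b) fp s)" and "N s = enn2real (nfint (2 * b) fn s)" for s
  define f1 f2 where "f1 s = enn2real (fp s)" and "f2 s = enn2real (fn s)" for s
  define X Y V W where "X = (LINT s|lborel. f1 s * P s)" and "Y = (LINT s|lborel. f1 s * N s)"
    and "V = (LINT s|lborel. f2 s * P s)" and "W = (LINT s|lborel. f2 s * N s)"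
  have i1: "integrable lborel (\<lambda>s. p s * p s)" "integrable lborel (\<lambda>s. p s * n s)" "integrable lborel (\<lambda>s. n s * n s)"
    unfolding p_def n_def by (intro I; simp)+
  have i2: "integrable lborel (\<lambda>s. f1 s * P s)" "integrable lborel (\<lambda>s. f1 s * N s)"
     "integrable lborel (\<lambda>s. f2 s * P s)" "integrable lborel (\<lambda>s. f2 s * N s)"
    unfolding f1_def f2_def P_def N_def by (intro I; simp)+
  have lb: "enn2real (\<integral>\<^sup>+\<tau>. nfint b u \<tau> * nfint b v \<tau> \<partial>lborel)
     = c * (enn2real (\<integral>\<^sup>+s. u s * nfint (2 * b) v s \<partial>lborel) + enn2real (\<integral>\<^sup>+s. v s * nfint (2 * b) u s \<partial>lborel))"
    if uv: "u \<in> {fp, fn, fa}" "v \<in> {fp, fn, fa}" for u v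
  proof -
    have "u \<in> borel_measurable borel" "v \<in> borel_measurable borel" using uv by auto
    then show ?thesis using bound[OF uv] bound[OF uv(2,1)] c
      by (simp add: bil enn2real_mult enn2real_plus)
  qed
  \<comment> \<open>The identity yields only the symmetrised mixed pairing, which is enough: Y and V
    enter the square through their sum.\<close>
  have e1: "(LINT s|lborel. p s * p s) = c * (X + X)" "(LINT s|lborel. p s * n s) = c * (Y + V)"
     "(LINT s|lborel. n s * n s) = c * (W + W)"
    unfolding p_def n_def X_def Y_def V_def W_def f1_def f2_def P_def N_def
    by (subst I(2) I(4); simp add: I(4) lb)+
  have ae1: "AE s in lborel. p s * p s - 2 * (p s * n s) + n s * n s = (fint b f s)\<^sup>2"
    using aeb
  proof eventually_elim
    case (elim s)
    have "fint b f s = p s - n s"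
      unfolding p_def n_def fp_def[abs_def] fn_def[abs_def] using elim[unfolded fa_def[abs_def]] b by (intro fint_eq_diff) auto
    show ?case unfolding \<open>fint b f s = p s - n s\<close> by (simp add: power2_eq_square algebra_simps)
  qed
  have ae2: "AE s in lborel. f1 s * P s - f1 s * N s - f2 s * P s + f2 s * N s = f s * fint (2 * b) f s"
    using ae
  proof eventually_elim
    case (elim s)
    then have a: "fint (2 * b) f s = P s - N s"
      unfolding P_def N_def fp_def[abs_def] fn_def[abs_def] using b by (intro fint_eq_diff) auto
    have b: "f s = f1 s - f2 s" unfolding f1_def f2_def fp_def fn_def
      by (cases "f s \<ge> 0") (auto simp: ennreal_neg)
    show ?case unfolding a b by (simp add: algebra_simps)
  qed
  have j1: "integrable lborel (\<lambda>s. p s * p s - 2 * (p s * n s) + n s * n s)" using i1 by auto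
  have j2: "integrable lborel (\<lambda>s. f1 s * P s - f1 s * N s - f2 s * P s + f2 s * N s)" using i2 by auto
  show "integrable lborel (\<lambda>s. (fint b f s)\<^sup>2)"
    using j1 by (rule integrable_cong_AE_imp) (use ae1 in auto)
  show "integrable lborel (\<lambda>s. f s * fint (2 * b) f s)"
    using j2 by (rule integrable_cong_AE_imp) (use ae2 in auto)
  have "(LINT s|lborel. (fint b f s)\<^sup>2) = (LINT s|lborel. p s * p s - 2 * (p s * n s) + n s * n s)"
    by (rule integral_cong_AE) (use ae1 j1 in \<open>auto simp: eq_commute\<close>)
  also have "\<dots> = (LINT s|lborel. p s * p s) - 2 * (LINT s|lborel. p s * n s) + (LINT s|lborel. n s * n s)"
    using i1 by simp
  also have "\<dots> = 2 * c * (X - Y - V + W)"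
    unfolding e1 by (simp add: algebra_simps)
  also have "X - Y - V + W = (LINT s|lborel. f1 s * P s - f1 s * N s - f2 s * P s + f2 s * N s)"
    using i2 by (simp add: X_def Y_def V_def W_def)
  also have "\<dots> = (LINT s|lborel. f s * fint (2 * b) f s)"
    by (rule integral_cong_AE) (use ae2 j2 in \<open>auto simp: eq_commute\<close>)
  finally show "(LINT s|lborel. f s * fint (2 * b) f s) = cos (pi * b) * (LINT s|lborel. (fint b f s)\<^sup>2)"
    using cos by (simp add: c_def)
qed

section \<open>Iteration of the Volterra inequality\<close>

lemma nfint_sum_kern:
  assumes "0 < \<beta>" "\<And>k. 0 \<le> c k"
  shows "nfint \<beta> (\<lambda>s. ennreal (\<Sum>k\<le>n. c k * kern (1 + real k * \<beta>) s)) t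
    = ennreal (\<Sum>k\<le>n. c k * kern (1 + real (Suc k) * \<beta>) t)"
proof (induction n)
  have pos: "0 < 1 + real k * \<beta>" for k using assms by (simp add: add_pos_nonneg)
  have step: "nfint \<beta> (\<lambda>s. ennreal (c k * kern (1 + real k * \<beta>) s)) t = ennreal (c k * kern (1 + real (Suc k) * \<beta>) t)" for k
  proof -
    have "nfint \<beta> (\<lambda>s. ennreal (c k * kern (1 + real k * \<beta>) s)) t
      = nfint \<beta> (\<lambda>s. ennreal (c k) * ennreal (kern (1 + real k * \<beta>) s)) t"
      using assms pos by (simp add: ennreal_mult)
    also have "\<dots> = ennreal (c k) * ennreal (kern (\<beta> + (1 + real k * \<beta>)) t)"
      using assms pos[of k] by (simp add: nfint_cmult nfint_kern)
    also have "\<beta> + (1 + real k * \<beta>) = 1 + real (Suc k) * \<beta>" by (simp add: algebra_simps)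
    finally show ?thesis using assms pos[of "Suc k"] by (simp add: ennreal_mult)
  qed
  {
    case 0
    then show ?case using step[of 0] by simp
  next
    case (Suc n)
    have "nfint \<beta> (\<lambda>s. ennreal (\<Sum>k\<le>Suc n. c k * kern (1 + real k * \<beta>) s)) t
      = nfint \<beta> (\<lambda>s. ennreal (\<Sum>k\<le>n. c k * kern (1 + real k * \<beta>) s) + ennreal (c (Suc n) * kern (1 + real (Suc n) * \<beta>) s)) t"
      using assms pos[of "Suc n"] pos by (subst ennreal_plus[symmetric]) (auto intro!: sum_nonneg mult_nonneg_nonneg simp del: of_nat_Suc)
    also have "\<dots> = ennreal (\<Sum>k\<le>n. c k * kern (1 + real (Suc k) * \<beta>) t) + ennreal (c (Suc n) * kern (1 + real (Suc (Suc n)) * \<beta>) t)"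
      by (subst nfint_add) (auto simp: Suc step simp del: of_nat_Suc)
    also have "\<dots> = ennreal (\<Sum>k\<le>Suc n. c k * kern (1 + real (Suc k) * \<beta>) t)"
      using assms pos[of "Suc (Suc n)"] pos by (subst ennreal_plus[symmetric]) (auto intro!: sum_nonneg mult_nonneg_nonneg simp del: of_nat_Suc)
    finally show ?case .
  }
qed

text \<open>I^\<beta> raises the index of a kernel by \<beta>, so each use of the hypothesis adds
  one term of the Mittag-Leffler series. The a priori bound B ends up multiplied by a term of a
  convergent series, which tends to 0.\<close>

theorem fractional_Gronwall:
  fixes Z :: "real \<Rightarrow> ennreal"
  assumes \<beta>: "0 < \<beta>" and A: "0 \<le> A" and l: "0 \<le> l" and t: "0 < t" and B: "0 \<le> B"
    and Z0: "\<And>s. s \<le> 0 \<Longrightarrow> Z s = 0" and ZB: "\<And>s. s \<le> t \<Longrightarrow> Z s \<le> ennreal B"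
    and Z: "\<And>s. 0 < s \<Longrightarrow> s \<le> t \<Longrightarrow> Z s \<le> ennreal A + ennreal l * nfint \<beta> Z s"
  shows "Z t \<le> ennreal (A * Mittag_Leffler \<beta> (l * t powr \<beta>))"
proof -
  \<comment> \<open>Coefficients after n iterations: the terms already produced carry A, the last
    one, k = n, still carries B.\<close>
  define c where "c n k = (if k < n then A * l ^ k else B * l ^ n)" for n k :: nat
  have c: "0 \<le> c n k" for n k using A B l by (simp add: c_def)
  have pos: "0 < 1 + real k * \<beta>" for k using \<beta> by (simp add: add_pos_nonneg)
  have it: "Z s \<le> ennreal (\<Sum>k\<le>n. c n k * kern (1 + real k * \<beta>) s)" if "s \<le> t" for s n
    using that
  proof (induction n arbitrary: s)
    case 0
    then show ?case using Z0[of s] ZB[of s] by (cases "s \<le> 0") (auto simp: c_def kern_1)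
  next
    case (Suc n)
    show ?case
    proof (cases "s \<le> 0")
      case False
      have "Z s \<le> ennreal A + ennreal l * nfint \<beta> Z s" using Z Suc False by simp
      also have "nfint \<beta> Z s \<le> nfint \<beta> (\<lambda>s. ennreal (\<Sum>k\<le>n. c n k * kern (1 + real k * \<beta>) s)) s"
        using Suc by (intro nfint_mono) auto
      also have "\<dots> = ennreal (\<Sum>k\<le>n. c n k * kern (1 + real (Suc k) * \<beta>) s)"
        using \<beta> c by (rule nfint_sum_kern)
      finally have "Z s \<le> ennreal A + ennreal l * ennreal (\<Sum>k\<le>n. c n k * kern (1 + real (Suc k) * \<beta>) s)"
        by (simp add: mult_left_mono add_left_mono)
      also have "\<dots> = ennreal (A + l * (\<Sum>k\<le>n. c n k * kern (1 + real (Suc k) * \<beta>) s))"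
        using A l c pos by (subst ennreal_mult[symmetric] , simp, 
            fastforce intro!: sum_nonneg mult_nonneg_nonneg kern_nonneg simp del: of_nat_Suc,
            subst ennreal_plus[symmetric]) (auto intro!: sum_nonneg mult_nonneg_nonneg kern_nonneg simp del: of_nat_Suc)
      also have "A + l * (\<Sum>k\<le>n. c n k * kern (1 + real (Suc k) * \<beta>) s) = (\<Sum>k\<le>Suc n. c (Suc n) k * kern (1 + real k * \<beta>) s)"
      proof -
        have "l * c n k = c (Suc n) (Suc k)" if "k \<le> n" for k using that by (auto simp: c_def)
        then have "l * (\<Sum>k\<le>n. c n k * kern (1 + real (Suc k) * \<beta>) s) = (\<Sum>k\<le>n. c (Suc n) (Suc k) * kern (1 + real (Suc k) * \<beta>) s)"
          unfolding sum_distrib_left by (intro sum.cong) (auto simp: mult.assoc[symmetric] simp del: of_nat_Suc)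
        moreover have "A = c (Suc n) 0 * kern (1 + real 0 * \<beta>) s" using False by (simp add: c_def kern_1)
        ultimately show ?thesis by (subst sum.atMost_Suc_shift) simp
      qed
      finally show ?thesis .
    qed (use Z0 in simp)
  qed
  define x where "x = l * t powr \<beta>"
  have x: "0 \<le> x" using l by (simp add: x_def)
  have kt: "l ^ k * kern (1 + real k * \<beta>) t = x ^ k / Gamma (1 + real k * \<beta>)" for k
    using t by (simp add: kern_def omega_def x_def power_mult_distrib powr_power)
  have sm: "summable (\<lambda>k. x ^ k / Gamma (1 + real k * \<beta>))" by (rule summable_Mittag_Leffler[OF \<beta>])
  have b: "Z t \<le> ennreal (A * Mittag_Leffler \<beta> x + B * (x ^ n / Gamma (1 + real n * \<beta>)))" for n
  proof -
    have "(\<Sum>k\<le>n. c n k * kern (1 + real k * \<beta>) t) = A * (\<Sum>k<n. x ^ k / Gamma (1 + real k * \<beta>)) + B * (x ^ n / Gamma (1 + real n * \<beta>))"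
      unfolding lessThan_Suc_atMost[symmetric] sum.lessThan_Suc
      unfolding kt[symmetric] by (simp add: c_def sum_distrib_left mult.assoc)
    also have "\<dots> \<le> A * Mittag_Leffler \<beta> x + B * (x ^ n / Gamma (1 + real n * \<beta>))"
      unfolding Mittag_Leffler_def using A x pos
      by (intro add_right_mono mult_left_mono sum_le_suminf sm)
        (auto intro!: divide_nonneg_nonneg Gamma_real_nonneg)
    finally show ?thesis using it[of t n] by (meson ennreal_leI order_trans order_refl)
  qed
  have "(\<lambda>n. ennreal (A * Mittag_Leffler \<beta> x + B * (x ^ n / Gamma (1 + real n * \<beta>)))) \<longlonglongrightarrow> ennreal (A * Mittag_Leffler \<beta> x + B * 0)"
    by (intro tendsto_intros summable_LIMSEQ_zero[OF sm])
  then have "Z t \<le> ennreal (A * Mittag_Leffler \<beta> x + B * 0)"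
    by (rule LIMSEQ_le_const) (use b in auto)
  then show ?thesis by (simp add: x_def)
qed

section \<open>Integrability of fractional integrals and the positivity estimate\<close>

lemma integrable_mult_of_squares:
  fixes f g :: "'a \<Rightarrow> real"
  assumes [measurable]: "f \<in> borel_measurable M" "g \<in> borel_measurable M"
    and "integrable M (\<lambda>x. (f x)\<^sup>2)" "integrable M (\<lambda>x. (g x)\<^sup>2)"
  shows "integrable M (\<lambda>x. f x * g x)"
proof (rule Bochner_Integration.integrable_bound)
  show "integrable M (\<lambda>x. (f x)\<^sup>2 + (g x)\<^sup>2)" using assms by auto
  have "\<bar>f x\<bar> * \<bar>g x\<bar> \<le> (f x)\<^sup>2 + (g x)\<^sup>2" for x
  proof -
    have "2 * (\<bar>f x\<bar> * \<bar>g x\<bar>) \<le> (f x)\<^sup>2 + (g x)\<^sup>2"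
      using sum_squares_bound[of "\<bar>f x\<bar>" "\<bar>g x\<bar>"] by (simp add: mult.assoc)
    moreover have "0 \<le> \<bar>f x\<bar> * \<bar>g x\<bar>" by simp
    ultimately show ?thesis by linarith
  qed
  then show "AE x in M. norm (f x * g x) \<le> norm ((f x)\<^sup>2 + (g x)\<^sup>2)"
    by (simp add: abs_mult)
qed measurable

text \<open>Kernels of index above 1 are bounded on bounded sets, so integrability of d gives
  finiteness at every t.\<close>

lemma nfint_1_plus_finite:
  assumes [measurable]: "d \<in> borel_measurable borel" and d: "integrable lborel d"
    and d0: "\<And>s. s \<le> 0 \<Longrightarrow> d s = 0" and a: "0 < a"
  shows "nfint (1 + a) (\<lambda>s. ennreal \<bar>d s\<bar>) t < \<infinity>"
proof -
  have "nfint (1 + a) (\<lambda>s. ennreal \<bar>d s\<bar>) t = nfint a (nfint 1 (\<lambda>s. ennreal \<bar>d s\<bar>)) t"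
    using a by (simp add: nfint_nfint add.commute)
  also have "\<dots> \<le> ennreal (kern (1 + a) t) * nfint 1 (\<lambda>s. ennreal \<bar>d s\<bar>) t"
    using a d0 by (intro nfint_le_nfint_1) auto
  also have "\<dots> \<le> ennreal (kern (1 + a) t) * (\<integral>\<^sup>+s. ennreal \<bar>d s\<bar> \<partial>lborel)"
    by (intro mult_left_mono nfint_1_le) simp
  also have "\<dots> < \<infinity>"
    using d unfolding integrable_iff_bounded by (simp add: ennreal_mult_less_top)
  finally show ?thesis .
qed

text \<open>The primitive of I^a |f| is finite at every time, so I^a |f| is finite almost everywhere
  below each k; countably many k exhaust the line.\<close>

lemma AE_nfint_finite:
  assumes [measurable]: "f \<in> borel_measurable borel" and a: "0 < a"
    and f0: "\<And>s. s \<le> 0 \<Longrightarrow> f s = 0" and f: "integrable lborel f"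
  shows "AE s in lborel. nfint a (\<lambda>s. ennreal \<bar>f s\<bar>) s < \<infinity>"
proof -
  have fin: "nfint 1 (nfint a (\<lambda>s. ennreal \<bar>f s\<bar>)) T < \<infinity>" for T
    using nfint_1_plus_finite[OF assms(1) f f0 a] a by (simp add: nfint_nfint)
  have "AE s in lborel. \<forall>k::nat. nfint a (\<lambda>s. ennreal \<bar>f s\<bar>) s * indicator {..<real k} s \<noteq> \<infinity>"
    unfolding AE_all_countable
  proof
    fix k :: nat
    show "AE s in lborel. nfint a (\<lambda>s. ennreal \<bar>f s\<bar>) s * indicator {..<real k} s \<noteq> \<infinity>"
      by (rule nn_integral_PInf_AE) (use fin[of "real k"] in \<open>auto simp: nfint_1\<close>)
  qed
  then show ?thesis
  proof eventually_elim
    case (elim s)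
    obtain k :: nat where "s < real k" using reals_Archimedean2 by blast
    then show ?case using elim[rule_format, of k] by (simp add: less_top)
  qed
qed

text \<open>L2 boundedness of I^a up to time t: \<open>nfint_1_nfint_sq_le\<close> and
  \<open>nfint_le_nfint_1\<close> each contribute one factor \<open>kern (1 + a) t\<close>.\<close>

lemma nn_integral_nfint_sq_le:
  assumes [measurable]: "g \<in> borel_measurable borel" and a: "0 < a"
    and g0: "\<And>s. s \<le> 0 \<Longrightarrow> g s = 0"
  shows "nfint 1 (\<lambda>s. (nfint a g s)\<^sup>2) t \<le> (ennreal (kern (1 + a) t))\<^sup>2 * nfint 1 (\<lambda>s. (g s)\<^sup>2) t"
proof -
  have "nfint 1 (\<lambda>s. (nfint a g s)\<^sup>2) t \<le> ennreal (kern (1 + a) t) * nfint a (nfint 1 (\<lambda>s. (g s)\<^sup>2)) t"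
    by (rule nfint_1_nfint_sq_le) (use a g0 in auto)
  also have "nfint a (nfint 1 (\<lambda>s. (g s)\<^sup>2)) t \<le> ennreal (kern (1 + a) t) * nfint 1 (\<lambda>s. (g s)\<^sup>2) t"
    by (rule nfint_le_nfint_1) (use a g0 in auto)
  finally show ?thesis by (simp add: power2_eq_square mult_left_mono mult.assoc)
qed

lemma integrable_of_square_bounded_support:
  fixes f :: "real \<Rightarrow> real"
  assumes [measurable]: "f \<in> borel_measurable borel"
    and f0: "\<And>s. s \<notin> {0<..<t} \<Longrightarrow> f s = 0" and f2: "integrable lborel (\<lambda>s. (f s)\<^sup>2)"
  shows "integrable lborel f"
proof (rule Bochner_Integration.integrable_bound)
  show "integrable lborel (\<lambda>s. indicator {0<..<t} s + (f s)\<^sup>2)"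
    using f2 by (intro Bochner_Integration.integrable_add integrable_real_indicator emeasure_bounded_finite)
      (auto intro: bounded_subset[OF bounded_closed_interval greaterThanLessThan_subseteq_atLeastAtMost_iff[THEN iffD2]])
  have "\<bar>f s\<bar> \<le> 1 + (f s)\<^sup>2" for s
    using zero_le_power2[of "\<bar>f s\<bar> - 1"] unfolding power2_diff power2_abs one_power2 by linarith
  then show "AE s in lborel. norm (f s) \<le> norm (indicator {0<..<t} s + (f s)\<^sup>2)"
    using f0 by (intro AE_I2) (auto simp: indicator_def)
qed measurable

text \<open>The whole-line identity is applied to f cut off at s. By causality the fractional
  integrals before s do not see the cut; after s, I^b of the cut function continues, and discarding
  its square turns the identity into an inequality.\<close>

lemma fint_positivity:
  assumes [measurable]: "f \<in> borel_measurable borel" and b: "0 < b" "b < 1/2"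
    and f0: "\<And>r. r \<notin> {0<..<t} \<Longrightarrow> f r = 0" and f2: "integrable lborel (\<lambda>r. (f r)\<^sup>2)"
  shows "ennreal (cos (pi * b)) * nfint 1 (\<lambda>r. ennreal ((fint b f r)\<^sup>2)) s
    \<le> ennreal (LINT r|lborel. indicator {..<s} r * (f r * fint (2 * b) f r))"
    and "0 \<le> (LINT r|lborel. indicator {..<s} r * (f r * fint (2 * b) f r))"
proof -
  define h where "h r = indicator {..<s} r * f r" for r
  define ha where "ha r = ennreal \<bar>h r\<bar>" for r
  have [measurable]: "h \<in> borel_measurable borel" "ha \<in> borel_measurable borel"
    by (simp_all add: h_def[abs_def] ha_def[abs_def])
  have cos: "cos (pi * b) > 0" using b by (auto intro!: cos_gt_zero)
  have h0: "h r = 0" if "r \<notin> {0<..<t}" for r using f0[OF that] by (simp add: h_def)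
  have h2: "integrable lborel (\<lambda>r. (h r)\<^sup>2)"
    by (rule Bochner_Integration.integrable_bound[OF f2]) (auto simp: h_def indicator_def)
  have h1: "integrable lborel h"
    by (rule integrable_of_square_bounded_support[OF _ h0 h2]) auto
  have ae: "AE r in lborel. nfint (2 * b) (\<lambda>s. ennreal \<bar>h s\<bar>) r < \<infinity>"
    by (rule AE_nfint_finite) (use b h0 h1 in auto)
  have h2': "(\<integral>\<^sup>+r. (ha r)\<^sup>2 \<partial>lborel) < \<infinity>"
    using h2 unfolding integrable_iff_bounded by (simp add: ha_def ennreal_power)
  \<comment> \<open>By xy \<le> x^2 + y^2 it is enough to control I^(2b) |h| in L2 up to t, beyond
    which h vanishes.\<close>
  have fin: "(\<integral>\<^sup>+r. ha r * nfint (2 * b) ha r \<partial>lborel) < \<infinity>"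
  proof -
    have "(\<integral>\<^sup>+r. ha r * nfint (2 * b) ha r \<partial>lborel) \<le> (\<integral>\<^sup>+r. (ha r)\<^sup>2 + (nfint (2 * b) ha r)\<^sup>2 * indicator {..<t} r \<partial>lborel)"
    proof (rule nn_integral_mono)
      fix r
      show "ha r * nfint (2 * b) ha r \<le> (ha r)\<^sup>2 + (nfint (2 * b) ha r)\<^sup>2 * indicator {..<t} r"
      proof (cases "r < t")
        case True
        have "x * y \<le> x\<^sup>2 + y\<^sup>2" for x y :: ennreal
        proof (cases "x \<le> y")
          case True
          then have "x * y \<le> y\<^sup>2" unfolding power2_eq_square by (rule mult_right_mono) simp
          then show ?thesis by (rule add_increasing[OF zero_le])
        next
          case False
          then have "x * y \<le> x\<^sup>2" unfolding power2_eq_square by (intro mult_left_mono) auto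
          then show ?thesis by (rule add_increasing2[OF zero_le])
        qed
        then show ?thesis using True by simp
      qed (use h0[of r] in \<open>auto simp: ha_def\<close>)
    qed
    also have "\<dots> = (\<integral>\<^sup>+r. (ha r)\<^sup>2 \<partial>lborel) + nfint 1 (\<lambda>r. (nfint (2 * b) ha r)\<^sup>2) t"
      unfolding nfint_1 by (intro nn_integral_add) auto
    also have "nfint 1 (\<lambda>r. (nfint (2 * b) ha r)\<^sup>2) t \<le> (ennreal (kern (1 + 2 * b) t))\<^sup>2 * nfint 1 (\<lambda>r. (ha r)\<^sup>2) t"
      using b h0 by (intro nn_integral_nfint_sq_le) (auto simp: ha_def)
    also have "nfint 1 (\<lambda>r. (ha r)\<^sup>2) t \<le> (\<integral>\<^sup>+r. (ha r)\<^sup>2 \<partial>lborel)" by (rule nfint_1_le)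
    finally have "(\<integral>\<^sup>+r. ha r * nfint (2 * b) ha r \<partial>lborel)
      \<le> (\<integral>\<^sup>+r. (ha r)\<^sup>2 \<partial>lborel) + (ennreal (kern (1 + 2 * b) t))\<^sup>2 * (\<integral>\<^sup>+r. (ha r)\<^sup>2 \<partial>lborel)"
      by (simp add: mult_left_mono add_left_mono)
    also have "\<dots> < \<infinity>" using h2' by (simp add: ennreal_mult_less_top power2_eq_square)
    finally show ?thesis .
  qed
  note P = integral_mult_fint[OF \<open>h \<in> borel_measurable borel\<close> b fin[unfolded ha_def[abs_def]] ae]
  have "nfint 1 (\<lambda>r. ennreal ((fint b f r)\<^sup>2)) s = nfint 1 (\<lambda>r. ennreal ((fint b h r)\<^sup>2)) s"
  proof (rule nfint_cong)
    fix r assume "r < s"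
    then have "fint b f r = fint b h r" by (intro fint_cong) (auto simp: h_def)
    then show "ennreal ((fint b f r)\<^sup>2) = ennreal ((fint b h r)\<^sup>2)" by simp
  qed
  also have "\<dots> \<le> (\<integral>\<^sup>+r. ennreal ((fint b h r)\<^sup>2) \<partial>lborel)" by (rule nfint_1_le)
  also have "\<dots> = ennreal (LINT r|lborel. (fint b h r)\<^sup>2)"
    using P(1) by (intro nn_integral_eq_integral) auto
  finally have "ennreal (cos (pi * b)) * nfint 1 (\<lambda>r. ennreal ((fint b f r)\<^sup>2)) s
    \<le> ennreal (cos (pi * b)) * ennreal (LINT r|lborel. (fint b h r)\<^sup>2)"
    by (intro mult_left_mono) auto
  also have "\<dots> = ennreal (LINT r|lborel. h r * fint (2 * b) h r)"
    unfolding P(3) using cos by (simp add: ennreal_mult)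
  also have eq: "(LINT r|lborel. h r * fint (2 * b) h r) = (LINT r|lborel. indicator {..<s} r * (f r * fint (2 * b) f r))"
  proof (rule Bochner_Integration.integral_cong[OF refl])
    fix r
    show "h r * fint (2 * b) h r = indicator {..<s} r * (f r * fint (2 * b) f r)"
    proof (cases "r < s")
      case True
      then have "fint (2 * b) f r = fint (2 * b) h r" by (intro fint_cong) (auto simp: h_def)
      then show ?thesis using True by (simp add: h_def)
    qed (simp add: h_def)
  qed
  finally show "ennreal (cos (pi * b)) * nfint 1 (\<lambda>r. ennreal ((fint b f r)\<^sup>2)) s
    \<le> ennreal (LINT r|lborel. indicator {..<s} r * (f r * fint (2 * b) f r))" .
  show "0 \<le> (LINT r|lborel. indicator {..<s} r * (f r * fint (2 * b) f r))"
    unfolding eq[symmetric] P(3) using cos by simp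
qed

text \<open>I^(2b) f = I^b (I^b f) wherever I^(2b) |f| is finite, hence almost everywhere; the
  nonnegative estimate then applies to |I^b f|.\<close>

lemma nfint_1_fint_sq_le:
  assumes [measurable]: "f \<in> borel_measurable borel" and b: "0 < b"
    and f0: "\<And>r. r \<le> 0 \<Longrightarrow> f r = 0" and f1: "integrable lborel f"
  shows "nfint 1 (\<lambda>r. ennreal ((fint (2 * b) f r)\<^sup>2)) s
    \<le> ennreal (kern (1 + b) s) * nfint b (nfint 1 (\<lambda>r. ennreal ((fint b f r)\<^sup>2))) s"
proof -
  have ae: "AE r in lborel. nfint (2 * b) (\<lambda>s. ennreal \<bar>f s\<bar>) r < \<infinity>"
    by (rule AE_nfint_finite) (use b f0 f1 in auto)
  have z0: "fint b f r = 0" if "r \<le> 0" for r using f0 that by (intro fint_eq_0) auto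
  have "nfint 1 (\<lambda>r. ennreal ((fint (2 * b) f r)\<^sup>2)) s \<le> nfint 1 (\<lambda>r. (nfint b (\<lambda>q. ennreal \<bar>fint b f q\<bar>) r)\<^sup>2) s"
    unfolding nfint_1
  proof (rule nn_integral_mono_AE)
    show "AE r in lborel. ennreal ((fint (2 * b) f r)\<^sup>2) * indicator {..<s} r
       \<le> (nfint b (\<lambda>q. ennreal \<bar>fint b f q\<bar>) r)\<^sup>2 * indicator {..<s} r"
      using ae
    proof eventually_elim
      case (elim r)
      have "ennreal \<bar>fint (2 * b) f r\<bar> = ennreal \<bar>fint b (fint b f) r\<bar>"
        using fint_fint[of f b b r] b elim by (simp add: mult_2[symmetric])
      also have "\<dots> \<le> nfint b (\<lambda>q. ennreal \<bar>fint b f q\<bar>) r"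
        using b by (intro abs_fint_le) auto
      finally have "(ennreal \<bar>fint (2 * b) f r\<bar>)\<^sup>2 \<le> (nfint b (\<lambda>q. ennreal \<bar>fint b f q\<bar>) r)\<^sup>2"
        by (intro power_mono) auto
      then have "ennreal ((fint (2 * b) f r)\<^sup>2) \<le> (nfint b (\<lambda>q. ennreal \<bar>fint b f q\<bar>) r)\<^sup>2"
        by (simp add: ennreal_power)
      then show ?case by (rule mult_right_mono) simp
    qed
  qed
  also have "\<dots> \<le> ennreal (kern (1 + b) s) * nfint b (nfint 1 (\<lambda>r. (ennreal \<bar>fint b f r\<bar>)\<^sup>2)) s"
    by (rule nfint_1_nfint_sq_le) (use b z0 in auto)
  finally show ?thesis by (simp add: ennreal_power)
qed

text \<open>Holds for every h: a negative part only lowers the left side, and a non-integrable h has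
  integral 0 by convention.\<close>

lemma ennreal_integral_le: "ennreal (LINT x|M. h x) \<le> (\<integral>\<^sup>+x. ennreal (h x) \<partial>M)"
proof (cases "integrable M h")
  case True
  have "(\<integral>\<^sup>+x. ennreal (h x) \<partial>M) < \<infinity>"
    using True unfolding real_integrable_def by (simp add: less_top)
  moreover have "(LINT x|M. h x) \<le> enn2real (\<integral>\<^sup>+x. ennreal (h x) \<partial>M)"
    unfolding real_lebesgue_integral_def[OF True] by simp
  ultimately show ?thesis
    by (metis ennreal_enn2real ennreal_leI infinity_ennreal_def)
qed (simp add: not_integrable_integral_eq)

lemma nfint_nn_integral:
  assumes "sigma_finite_measure M" and [measurable]: "(\<lambda>(y, r). g y r) \<in> borel_measurable (M \<Otimes>\<^sub>M borel)"
  shows "nfint a (\<lambda>r. \<integral>\<^sup>+y. g y r \<partial>M) s = (\<integral>\<^sup>+y. nfint a (g y) s \<partial>M)"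
proof -
  interpret M: sigma_finite_measure M by fact
  interpret pair_sigma_finite M lborel ..
  have "nfint a (\<lambda>r. \<integral>\<^sup>+y. g y r \<partial>M) s = (\<integral>\<^sup>+r. \<integral>\<^sup>+y. ennreal (kern a (s - r)) * g y r \<partial>M \<partial>lborel)"
    unfolding nfint_def
  proof (rule nn_integral_cong)
    fix r :: real
    have "(\<lambda>y. (y, r)) \<in> measurable M (M \<Otimes>\<^sub>M borel)" by measurable
    from measurable_compose[OF this assms(2)]
    have "(\<lambda>y. g y r) \<in> borel_measurable M" by simp
    then show "ennreal (kern a (s - r)) * (\<integral>\<^sup>+y. g y r \<partial>M) = (\<integral>\<^sup>+y. ennreal (kern a (s - r)) * g y r \<partial>M)"
      by (rule nn_integral_cmult[symmetric])
  qed
  also have "\<dots> = (\<integral>\<^sup>+y. \<integral>\<^sup>+r. ennreal (kern a (s - r)) * g y r \<partial>lborel \<partial>M)"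
    by (rule Fubini') measurable
  finally show ?thesis unfolding nfint_def .
qed

lemma fint_sum:
  assumes "\<And>p. p \<in> I \<Longrightarrow> integrable lborel (\<lambda>s. kern a (t - s) * d p s)"
  shows "fint a (\<lambda>s. \<Sum>p\<in>I. d p s * c p) t = (\<Sum>p\<in>I. fint a (d p) t * c p)"
proof -
  have "fint a (\<lambda>s. \<Sum>p\<in>I. d p s * c p) t = (LINT s|lborel. (\<Sum>p\<in>I. kern a (t - s) * d p s * c p))"
    by (simp add: fint_def sum_distrib_left mult.assoc)
  also have "\<dots> = (\<Sum>p\<in>I. fint a (d p) t * c p)"
    using assms by (simp add: fint_def)
  finally show ?thesis .
qed

section \<open>The abstract energy bound\<close>

lemma integral_double_sum:
  fixes h :: "nat \<Rightarrow> nat \<Rightarrow> 'm \<Rightarrow> real"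
  assumes "\<And>p q. p < n \<Longrightarrow> q < n \<Longrightarrow> integrable M (h p q)"
  shows "(LINT x|M. (\<Sum>p<n. \<Sum>q<n. c p q * h p q x)) = (\<Sum>p<n. \<Sum>q<n. c p q * (LINT x|M. h p q x))"
proof -
  have "(LINT x|M. (\<Sum>p<n. \<Sum>q<n. c p q * h p q x)) = (\<Sum>p<n. LINT x|M. (\<Sum>q<n. c p q * h p q x))"
    using assms by (intro Bochner_Integration.integral_sum Bochner_Integration.integrable_sum) auto
  also have "\<dots> = (\<Sum>p<n. \<Sum>q<n. LINT x|M. c p q * h p q x)"
    using assms by (intro sum.cong refl Bochner_Integration.integral_sum) auto
  finally show ?thesis by simp
qed

text \<open>All inequalities except the hypothesis \<open>energy\<close> hold for each fixed \<open>y\<close>; integrating over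
  \<open>y\<close> afterwards avoids a theory of vector-valued fractional integrals.\<close>
theorem energy_bound:
  fixes M :: "'m measure" and \<rho> :: "nat \<Rightarrow> 'm \<Rightarrow> real" and d :: "nat \<Rightarrow> real \<Rightarrow> real" and \<beta> :: "real \<Rightarrow> ennreal"
  assumes "sigma_finite_measure M"
    and \<rho>_meas [measurable]: "\<And>p. \<rho> p \<in> borel_measurable M"
    and \<rho>_int: "\<And>p q. p < n \<Longrightarrow> q < n \<Longrightarrow> integrable M (\<lambda>y. \<rho> p y * \<rho> q y)"
    and d_meas [measurable]: "\<And>p. d p \<in> borel_measurable borel"
    and d0: "\<And>p r. r \<notin> {0<..<t} \<Longrightarrow> d p r = 0"
    and d2: "\<And>p. p < n \<Longrightarrow> integrable lborel (\<lambda>r. (d p r)\<^sup>2)"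
    and \<alpha>: "1/2 \<le> \<alpha>" "\<alpha> < 1" and t: "0 < t" and C: "0 \<le> C"
    and \<beta>_meas [measurable]: "\<beta> \<in> borel_measurable borel"
    and energy: "AE r in lborel. r \<in> {0<..<t} \<longrightarrow>
        ennreal (LINT y|M. (\<Sum>p<n. d p r * \<rho> p y) * (\<Sum>p<n. fint \<alpha> (d p) r * \<rho> p y))
        \<le> ennreal (C / 2 * (LINT y|M. (\<Sum>p<n. fint \<alpha> (d p) r * \<rho> p y)\<^sup>2)) + \<beta> r"
  shows "(\<integral>\<^sup>+y. ennreal ((\<Sum>p<n. fint 1 (d p) t * \<rho> p y)\<^sup>2) \<partial>M)
    \<le> ennreal (Mittag_Leffler (\<alpha>/2) (5/8 * C * t powr \<alpha> / (1 - \<alpha>)) / (1 - \<alpha>)\<^sup>2) *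
       (ennreal (t powr (1 - \<alpha>)) * nfint 1 \<beta> t)"
proof (cases "nfint 1 \<beta> t = \<infinity>")
  case True
  define m where "m = Mittag_Leffler (\<alpha>/2) (5/8 * C * t powr \<alpha> / (1 - \<alpha>)) / (1 - \<alpha>)\<^sup>2"
  \<comment> \<open>Positivity matters because the product of 0 and infinity is 0 in
    \<open>ennreal\<close>.\<close>
  have "0 < m"
    using Mittag_Leffler_ge_1[of "\<alpha>/2" "5/8 * C * t powr \<alpha> / (1 - \<alpha>)"] \<alpha> C
    unfolding m_def by (intro divide_pos_pos) auto
  then show ?thesis
    unfolding m_def[symmetric] using True t by (simp add: ennreal_mult_top ennreal_top_mult)
next
  case False
  interpret M: sigma_finite_measure M by fact
  interpret MP: pair_sigma_finite M lborel ..
  define b where "b = \<alpha> / 2"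
  have b: "0 < b" "b < 1/2" "1/4 \<le> b" and \<alpha>b: "\<alpha> = 2 * b" using \<alpha> by (auto simp: b_def)
  define f where "f y r = (\<Sum>p<n. d p r * \<rho> p y)" for y r
  define D where "D p = fint \<alpha> (d p)" for p
  \<comment> \<open>Gram matrix of the basis. The quadratic forms expand into finite sums with these
    coefficients, which replaces an exchange of integrals over M and over time for signed
    functions.\<close>
  let ?G = "\<lambda>p q. LINT y|M. \<rho> p y * \<rho> q y" and ?N = "\<lambda>r. \<integral>\<^sup>+y. ennreal ((fint \<alpha> (f y) r)\<^sup>2) \<partial>M"
  define K where "K p q s = (LINT r|lborel. indicator {..<s} r * (d p r * D q r))" for p q s
  have [measurable]: "D p \<in> borel_measurable borel" for p by (simp add: D_def)
  have [measurable]: "f y \<in> borel_measurable borel" for y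
    unfolding f_def[abs_def] by measurable
  have f_meas2 [measurable]: "(\<lambda>(y, r). f y r) \<in> borel_measurable (M \<Otimes>\<^sub>M borel)"
    unfolding f_def[abs_def] by measurable
  have fint_meas2 [measurable]: "(\<lambda>(y, r). fint a (f y) r) \<in> borel_measurable (M \<Otimes>\<^sub>M borel)" for a
    unfolding f_def[abs_def] fint_def[abs_def] by measurable
  have f0: "f y r = 0" if "r \<notin> {0<..<t}" for y r using d0[OF that] by (simp add: f_def)
  have d1: "integrable lborel (d p)" if "p < n" for p
    by (rule integrable_of_square_bounded_support[OF _ d0 d2[OF that]]) auto
  have f2: "integrable lborel (\<lambda>r. (f y r)\<^sup>2)" for y
  proof -
    have dd: "integrable lborel (\<lambda>r. d p r * d q r)" if "p < n" "q < n" for p q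
      using d2 that by (intro integrable_mult_of_squares) auto
    have "(\<lambda>r. (f y r)\<^sup>2) = (\<lambda>r. \<Sum>p<n. \<Sum>q<n. (d p r * d q r) * (\<rho> p y * \<rho> q y))"
      by (simp add: f_def power2_eq_square sum_product mult_ac)
    moreover have "integrable lborel (\<lambda>r. \<Sum>p<n. \<Sum>q<n. (d p r * d q r) * (\<rho> p y * \<rho> q y))"
      by (intro Bochner_Integration.integrable_sum Bochner_Integration.integrable_mult_left) (use dd in auto)
    ultimately show ?thesis by simp
  qed
  have f1: "integrable lborel (f y)" for y
    by (rule integrable_of_square_bounded_support[OF _ f0 f2]) auto
  have fin: "AE r in lborel. \<forall>p\<in>{..<n}. nfint \<alpha> (\<lambda>s. ennreal \<bar>d p s\<bar>) r < \<infinity>"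
  proof (rule AE_finite_allI)
    show "AE r in lborel. nfint \<alpha> (\<lambda>s. ennreal \<bar>d p s\<bar>) r < \<infinity>" if "p \<in> {..<n}" for p
      by (rule AE_nfint_finite) (use \<alpha> d0 d1 that in auto)
  qed simp
  \<comment> \<open>One null set of times serves all y, since only the n coefficients have to be
    finite.\<close>
  have lin: "AE r in lborel. \<forall>y. fint \<alpha> (f y) r = (\<Sum>p<n. D p r * \<rho> p y)"
    using fin
  proof eventually_elim
    case (elim r)
    show ?case unfolding f_def[abs_def] D_def
      by (intro allI fint_sum integrable_kern_mult) (use elim \<alpha> in auto)
  qed
  define Zy where "Zy y = nfint 1 (\<lambda>r. ennreal ((fint b (f y) r)\<^sup>2))" for y
  have Zy_meas [measurable]: "(\<lambda>(y, s). Zy y s) \<in> borel_measurable (M \<Otimes>\<^sub>M borel)"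
    unfolding Zy_def nfint_def[abs_def] by measurable
  define Z where "Z s = (\<integral>\<^sup>+y. Zy y s \<partial>M)" for s
  have Z_meas [measurable]: "Z \<in> borel_measurable borel" unfolding Z_def[abs_def] by measurable
  define B where "B = nfint 1 \<beta> t"
  have cos: "1 - \<alpha> \<le> cos (pi * b)" using cos_ge_linear[of \<alpha>] \<alpha> by (simp add: b_def)

  have dD: "integrable lborel (\<lambda>r. indicator {..<s} r * (d p r * D q r))" if "p < n" "q < n" for p q s
  proof -
    have "(\<integral>\<^sup>+r. ennreal ((indicator {..<t} r * D q r)\<^sup>2) \<partial>lborel) = nfint 1 (\<lambda>r. (ennreal \<bar>D q r\<bar>)\<^sup>2) t"
      unfolding nfint_1 by (intro nn_integral_cong) (auto simp: ennreal_power indicator_def)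
    also have "\<dots> \<le> nfint 1 (\<lambda>r. (nfint \<alpha> (\<lambda>s. ennreal \<bar>d q s\<bar>) r)\<^sup>2) t"
      unfolding D_def using \<alpha> by (intro nfint_mono power_mono abs_fint_le) auto
    also have "\<dots> \<le> (ennreal (kern (1 + \<alpha>) t))\<^sup>2 * nfint 1 (\<lambda>r. (ennreal \<bar>d q r\<bar>)\<^sup>2) t"
      using \<alpha> d0 by (intro nn_integral_nfint_sq_le) auto
    also have "\<dots> \<le> (ennreal (kern (1 + \<alpha>) t))\<^sup>2 * (\<integral>\<^sup>+r. (ennreal \<bar>d q r\<bar>)\<^sup>2 \<partial>lborel)"
      by (intro mult_left_mono nfint_1_le) simp
    also have "\<dots> < \<infinity>"
      using d2[OF that(2)] unfolding integrable_iff_bounded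
      by (simp add: ennreal_mult_less_top ennreal_power power2_eq_square[of "ennreal (kern _ _)"])
    finally have "integrable lborel (\<lambda>r. (indicator {..<t} r * D q r)\<^sup>2)"
      by (intro integrableI_nonneg) auto
    then have "integrable lborel (\<lambda>r. d p r * (indicator {..<t} r * D q r))"
      using d2[OF that(1)] by (intro integrable_mult_of_squares) auto
    then show ?thesis
      by (rule Bochner_Integration.integrable_bound) (auto simp: indicator_def d0)
  qed

  have Zbound: "ennreal (1 - \<alpha>) * Z s \<le> ennreal (\<Sum>p<n. \<Sum>q<n. ?G p q * K p q s)" for s
  proof -
    define u where "u y = (\<Sum>p<n. \<Sum>q<n. (\<rho> p y * \<rho> q y) * K p q s)" for y
    have u_eq: "(LINT r|lborel. indicator {..<s} r * (f y r * fint \<alpha> (f y) r)) = u y" for y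
    proof -
      have "(LINT r|lborel. indicator {..<s} r * (f y r * fint \<alpha> (f y) r))
        = (LINT r|lborel. (\<Sum>p<n. \<Sum>q<n. (\<rho> p y * \<rho> q y) * (indicator {..<s} r * (d p r * D q r))))"
      proof (rule integral_cong_AE)
        show "AE r in lborel. indicator {..<s} r * (f y r * fint \<alpha> (f y) r)
          = (\<Sum>p<n. \<Sum>q<n. (\<rho> p y * \<rho> q y) * (indicator {..<s} r * (d p r * D q r)))"
          using lin
        proof eventually_elim
          case (elim r)
          show ?case unfolding elim[rule_format] f_def sum_product by (simp add: sum_distrib_left mult_ac)
        qed
      qed measurable
      also have "\<dots> = u y"
        unfolding u_def K_def by (rule integral_double_sum) (rule dD)
      finally show ?thesis .
    qed
    have le: "ennreal (1 - \<alpha>) * Zy y s \<le> ennreal (u y)" for y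
    proof -
      have "ennreal (1 - \<alpha>) * Zy y s \<le> ennreal (cos (pi * b)) * Zy y s"
        using cos by (intro mult_right_mono ennreal_leI) auto
      also have "\<dots> \<le> ennreal (LINT r|lborel. indicator {..<s} r * (f y r * fint (2 * b) (f y) r))"
        unfolding Zy_def by (rule fint_positivity(1)) (use b f0 f2 in auto)
      finally show ?thesis using u_eq[of y] by (simp add: \<alpha>b)
    qed
    have u0: "0 \<le> u y" for y
      using fint_positivity(2)[of "f y" b t s] b f0 f2[of y] u_eq[of y] by (simp add: \<alpha>b)
    have "ennreal (1 - \<alpha>) * Z s = (\<integral>\<^sup>+y. ennreal (1 - \<alpha>) * Zy y s \<partial>M)"
      unfolding Z_def by (rule nn_integral_cmult[symmetric]) measurable
    also have "\<dots> \<le> (\<integral>\<^sup>+y. ennreal (u y) \<partial>M)" by (intro nn_integral_mono le)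
    also have "\<dots> = ennreal (LINT y|M. u y)"
      using u0 \<rho>_int unfolding u_def[abs_def]
      by (intro nn_integral_eq_integral Bochner_Integration.integrable_sum Bochner_Integration.integrable_mult_left) auto
    also have "(LINT y|M. u y) = (\<Sum>p<n. \<Sum>q<n. ?G p q * K p q s)"
      using integral_double_sum[of n M "\<lambda>p q y. \<rho> p y * \<rho> q y" "\<lambda>p q. K p q s"] \<rho>_int
      unfolding u_def by (simp add: mult.commute[of "K _ _ s"])
    finally show ?thesis .
  qed
  have G_eq: "(LINT y|M. (\<Sum>p<n. x p * \<rho> p y) * (\<Sum>q<n. z q * \<rho> q y))
      = (\<Sum>p<n. \<Sum>q<n. ?G p q * (x p * z q))" for x z
  proof -
    have "(LINT y|M. (\<Sum>p<n. x p * \<rho> p y) * (\<Sum>q<n. z q * \<rho> q y))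
      = (LINT y|M. (\<Sum>p<n. \<Sum>q<n. (\<rho> p y * \<rho> q y) * (x p * z q)))"
      by (simp add: sum_product mult_ac)
    also have "\<dots> = (\<Sum>p<n. \<Sum>q<n. ?G p q * (x p * z q))"
      using integral_double_sum[of n M "\<lambda>p q y. \<rho> p y * \<rho> q y" "\<lambda>p q. x p * z q"] \<rho>_int
      by (simp add: mult.commute[of "x _ * z _"])
    finally show ?thesis .
  qed

  have step: "ennreal (1 - \<alpha>) * Z s \<le> B + ennreal (C / 2) * (ennreal (kern (1 + b) s) * nfint b Z s)" if s: "s \<le> t" for s
  proof -
    define e where "e r = (LINT y|M. (\<Sum>p<n. d p r * \<rho> p y) * (\<Sum>p<n. D p r * \<rho> p y))" for r
    have "(\<Sum>p<n. \<Sum>q<n. ?G p q * K p q s)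
      = (LINT r|lborel. (\<Sum>p<n. \<Sum>q<n. ?G p q * (indicator {..<s} r * (d p r * D q r))))"
      unfolding K_def by (rule integral_double_sum[symmetric]) (rule dD)
    also have "\<dots> = (LINT r|lborel. indicator {..<s} r * e r)"
      unfolding e_def G_eq by (simp add: sum_distrib_left mult_ac)
    finally have "ennreal (1 - \<alpha>) * Z s \<le> ennreal (LINT r|lborel. indicator {..<s} r * e r)"
      using Zbound[of s] by simp
    \<comment> \<open>Only the positive part of e is kept, which is exactly what
      \<open>energy\<close> bounds.\<close>
    also have "\<dots> \<le> (\<integral>\<^sup>+r. ennreal (indicator {..<s} r * e r) \<partial>lborel)" by (rule ennreal_integral_le)
    also have "\<dots> \<le> (\<integral>\<^sup>+r. \<beta> r * indicator {..<s} r
        + ennreal (C / 2) * (?N r * indicator {..<s} r) \<partial>lborel)"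
    proof (rule nn_integral_mono_AE)
      show "AE r in lborel. ennreal (indicator {..<s} r * e r) \<le> \<beta> r * indicator {..<s} r
        + ennreal (C / 2) * (?N r * indicator {..<s} r)"
        using lin energy
      proof eventually_elim
        case (elim r)
        show ?case
        proof (cases "r < s \<and> 0 < r")
          case True
          then have "ennreal (e r) \<le> ennreal (C / 2 * (LINT y|M. (\<Sum>p<n. D p r * \<rho> p y)\<^sup>2)) + \<beta> r"
            using elim(2) s by (simp add: e_def D_def)
          also have "ennreal (C / 2 * (LINT y|M. (\<Sum>p<n. D p r * \<rho> p y)\<^sup>2))
             = ennreal (C / 2) * ennreal (LINT y|M. (\<Sum>p<n. D p r * \<rho> p y)\<^sup>2)"
            using C by (intro ennreal_mult) auto
          also have "ennreal (LINT y|M. (\<Sum>p<n. D p r * \<rho> p y)\<^sup>2) \<le> ?N r"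
            using ennreal_integral_le[of M "\<lambda>y. (\<Sum>p<n. D p r * \<rho> p y)\<^sup>2"] elim(1) by simp
          finally show ?thesis using True by (simp add: mult_left_mono add_right_mono add.commute)
        next
          case False
          then have "indicator {..<s} r * e r = 0"
            by (cases "r < s") (auto simp: e_def d0)
          then show ?thesis by (simp only: ennreal_0 zero_le)
        qed
      qed
    qed
    also have "\<dots> = nfint 1 \<beta> s + ennreal (C / 2) * nfint 1 (\<lambda>r. ?N r) s"
      unfolding nfint_1 by (subst nn_integral_add, measurable, subst nn_integral_cmult) auto
    also have "nfint 1 (\<lambda>r. ?N r) s = (\<integral>\<^sup>+y. nfint 1 (\<lambda>r. ennreal ((fint \<alpha> (f y) r)\<^sup>2)) s \<partial>M)"
      by (rule nfint_nn_integral) (fact, measurable)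
    also have "\<dots> \<le> (\<integral>\<^sup>+y. ennreal (kern (1 + b) s) * nfint b (Zy y) s \<partial>M)"
      unfolding Zy_def \<alpha>b by (intro nn_integral_mono nfint_1_fint_sq_le) (use b f0 f1 in auto)
    also have "\<dots> = ennreal (kern (1 + b) s) * (\<integral>\<^sup>+y. nfint b (Zy y) s \<partial>M)"
      unfolding nfint_def[of b] by (rule nn_integral_cmult) measurable
    also have "(\<integral>\<^sup>+y. nfint b (Zy y) s \<partial>M) = nfint b Z s"
      unfolding Z_def[abs_def] by (rule nfint_nn_integral[symmetric]) (fact, measurable)
    also have "nfint 1 \<beta> s \<le> B"
      unfolding B_def nfint_1 using s by (intro nn_integral_mono) (auto simp: indicator_def)
    finally show ?thesis by (simp add: mult_left_mono add_mono)
  qed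

  obtain B' where B': "B = ennreal B'" "0 \<le> B'"
    using False unfolding B_def by (cases "nfint 1 \<beta> t") auto
  \<comment> \<open>The product of 1/(1 - \<alpha>), C/2 and the bound 5/4 * t powr b for
    \<open>kern (1 + b)\<close>. A second factor t powr b of the Mittag-Leffler argument comes from
    \<open>fractional_Gronwall\<close>.\<close>
  define l where "l = 5/8 * C * t powr b / (1 - \<alpha>)"
  have l: "0 \<le> l" using C \<alpha> by (simp add: l_def)
  have inv: "Z s = ennreal (1 / (1 - \<alpha>)) * (ennreal (1 - \<alpha>) * Z s)" for s
    using \<alpha> by (simp add: mult.assoc[symmetric] ennreal_mult[symmetric])
  have gron: "Z s \<le> ennreal (B' / (1 - \<alpha>)) + ennreal l * nfint b Z s" if s: "0 < s" "s \<le> t" for s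
  proof -
    have G: "4/5 \<le> Gamma (1 + b)" using b by (intro Gamma_ge_four_fifths) auto
    have kb: "kern (1 + b) s \<le> 5/4 * t powr b"
    proof -
      have "s powr b \<le> t powr b" using s b by (intro powr_mono2) auto
      also have "t powr b = 5/4 * t powr b * (4/5)" by simp
      also have "\<dots> \<le> 5/4 * t powr b * Gamma (1 + b)" using G by (intro mult_left_mono) auto
      finally show ?thesis using s G by (simp add: kern_def omega_def pos_divide_le_eq)
    qed
    have "Z s \<le> ennreal (1 / (1 - \<alpha>)) * (B + ennreal (C / 2) * (ennreal (kern (1 + b) s) * nfint b Z s))"
      by (subst inv) (intro mult_left_mono step s(2) zero_le)
    also have "\<dots> = ennreal (B' / (1 - \<alpha>)) + ennreal (1 / (1 - \<alpha>) * (C / 2) * kern (1 + b) s) * nfint b Z s"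
      using \<alpha> B' C b by (simp add: distrib_left ennreal_mult[symmetric] mult.assoc[symmetric])
    also have "1 / (1 - \<alpha>) * (C / 2) * kern (1 + b) s \<le> 1 / (1 - \<alpha>) * (C / 2) * (5/4 * t powr b)"
      using \<alpha> C kb by (intro mult_left_mono) auto
    also have "1 / (1 - \<alpha>) * (C / 2) * (5/4 * t powr b) = l" by (simp add: l_def)
    finally show ?thesis by (simp add: mult_right_mono ennreal_leI add_left_mono)
  qed
  have Z0: "Z s = 0" if "s \<le> 0" for s
  proof -
    have "Zy y s = 0" for y
    proof -
      have "fint b (f y) r = 0" if "r < s" for r
        using f0 that \<open>s \<le> 0\<close> by (intro fint_eq_0) auto
      then have "Zy y s = nfint 1 (\<lambda>_. 0) s" unfolding Zy_def by (intro nfint_cong) simp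
      then show ?thesis by (simp add: nfint_def)
    qed
    then show ?thesis by (simp add: Z_def)
  qed
  have Zmono: "Z s \<le> Z t" if "s \<le> t" for s
    unfolding Z_def Zy_def nfint_1 using that by (intro nn_integral_mono) (auto simp: indicator_def)
  \<comment> \<open>The finite a priori bound for the iteration: the right-hand side of
    \<open>Zbound\<close> is \<open>ennreal\<close> of a real number.\<close>
  have "Z t < \<infinity>"
  proof -
    have "Z t \<le> ennreal (1 / (1 - \<alpha>)) * ennreal (\<Sum>p<n. \<Sum>q<n. ?G p q * K p q t)"
      by (subst inv) (intro mult_left_mono Zbound zero_le)
    also have "\<dots> < \<infinity>" by (simp add: ennreal_mult_less_top)
    finally show ?thesis .
  qed
  then obtain Z' where Z': "Z t = ennreal Z'" "0 \<le> Z'" by (cases "Z t") auto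
  have "Z t \<le> ennreal (B' / (1 - \<alpha>) * Mittag_Leffler b (l * t powr b))"
    by (rule fractional_Gronwall[where B = Z']) (use b \<alpha> B' l t Z0 Zmono Z' gron in auto)
  also have "l * t powr b = 5/8 * C * t powr \<alpha> / (1 - \<alpha>)"
    by (simp add: l_def \<alpha>b powr_add[symmetric])
  finally have Zt: "Z t \<le> ennreal (B' / (1 - \<alpha>) * Mittag_Leffler b (5/8 * C * t powr \<alpha> / (1 - \<alpha>)))" .
  have "(\<integral>\<^sup>+y. ennreal ((\<Sum>p<n. fint 1 (d p) t * \<rho> p y)\<^sup>2) \<partial>M) = (\<integral>\<^sup>+y. ennreal ((fint 1 (f y) t)\<^sup>2) \<partial>M)"
  proof (intro nn_integral_cong)
    fix y
    have "integrable lborel (\<lambda>s. kern 1 (t - s) * d p s)" if "p < n" for p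
      by (rule Bochner_Integration.integrable_bound[OF d1[OF that]]) (auto simp: kern_1 indicator_def)
    then have "fint 1 (f y) t = (\<Sum>p<n. fint 1 (d p) t * \<rho> p y)"
      unfolding f_def[abs_def] by (intro fint_sum) auto
    then show "ennreal ((\<Sum>p<n. fint 1 (d p) t * \<rho> p y)\<^sup>2) = ennreal ((fint 1 (f y) t)\<^sup>2)" by simp
  qed
  also have "\<dots> \<le> (\<integral>\<^sup>+y. ennreal (t powr (1 - 2 * b) / (1 - 2 * b)) * Zy y t \<partial>M)"
    unfolding Zy_def
  proof (intro nn_integral_mono fint_1_sq_le)
    fix y
    have "nfint 1 (\<lambda>s. ennreal \<bar>f y s\<bar>) t \<le> (\<integral>\<^sup>+s. ennreal \<bar>f y s\<bar> \<partial>lborel)"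
      by (rule nfint_1_le)
    also have "\<dots> < \<infinity>" using f1[of y] unfolding integrable_iff_bounded by simp
    finally show "nfint 1 (\<lambda>s. ennreal \<bar>f y s\<bar>) t < \<infinity>" .
  qed (use b t f0 in auto)
  also have "\<dots> = ennreal (t powr (1 - \<alpha>) / (1 - \<alpha>)) * Z t"
    unfolding Z_def \<alpha>b by (rule nn_integral_cmult) measurable
  also have "\<dots> \<le> ennreal (t powr (1 - \<alpha>) / (1 - \<alpha>)) * ennreal (B' / (1 - \<alpha>) * Mittag_Leffler b (5/8 * C * t powr \<alpha> / (1 - \<alpha>)))"
    by (intro mult_left_mono Zt) simp
  also have "\<dots> = ennreal (Mittag_Leffler b (5/8 * C * t powr \<alpha> / (1 - \<alpha>)) / (1 - \<alpha>)\<^sup>2) * (ennreal (t powr (1 - \<alpha>)) * ennreal B')"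
    using Mittag_Leffler_ge_1[of b "5/8 * C * t powr \<alpha> / (1 - \<alpha>)"] b \<alpha> C B'
    by (simp add: ennreal_mult[symmetric] power2_eq_square mult_ac)
  finally show ?thesis by (simp add: B'(1)[symmetric] B_def b_def)
qed

section \<open>Continuous piecewise linear functions\<close>

definition ramp :: "(nat \<Rightarrow> real) \<Rightarrow> nat \<Rightarrow> real \<Rightarrow> real" where
  "ramp x p y = max 0 (min 1 ((y - x p) / (x (Suc p) - x p)))"

text \<open>The derivative of \<open>ramp\<close> off the nodes; the value 0 at the two corners is a
  convention.\<close>

definition slope :: "(nat \<Rightarrow> real) \<Rightarrow> nat \<Rightarrow> real \<Rightarrow> real" where
  "slope x p y = (if x p < y \<and> y < x (Suc p) then 1 / (x (Suc p) - x p) else 0)"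

lemma ramp_bounds: "0 \<le> ramp x p y" "ramp x p y \<le> 1"
  by (auto simp: ramp_def)

lemma ramp_continuous: "x p < x (Suc p) \<Longrightarrow> continuous_on A (ramp x p)"
  unfolding ramp_def[abs_def] by (intro continuous_intros) auto

lemma ramp_measurable [measurable]: "ramp x p \<in> borel_measurable borel"
  unfolding ramp_def[abs_def] by measurable

lemma slope_measurable [measurable]: "slope x p \<in> borel_measurable borel"
  unfolding slope_def[abs_def] by measurable

lemma ramp_left: "x p < x (Suc p) \<Longrightarrow> y \<le> x p \<Longrightarrow> ramp x p y = 0"
  using divide_nonpos_pos[of "y - x p" "x (Suc p) - x p"] by (auto simp: ramp_def max_def)

lemma ramp_right: "x p < x (Suc p) \<Longrightarrow> x (Suc p) \<le> y \<Longrightarrow> ramp x p y = 1"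
  by (auto simp: ramp_def max_def min_def field_simps)

lemma ramp_mid: "x p < x (Suc p) \<Longrightarrow> x p \<le> y \<Longrightarrow> y \<le> x (Suc p) \<Longrightarrow> ramp x p y = (y - x p) / (x (Suc p) - x p)"
  by (auto simp: ramp_def max_def min_def field_simps)

lemma DERIV_ramp:
  assumes l: "x p < x (Suc p)" and y: "y \<noteq> x p" "y \<noteq> x (Suc p)"
  shows "(ramp x p has_real_derivative slope x p y) (at y)"
proof -
  consider "y < x p" | "x p < y" "y < x (Suc p)" | "x (Suc p) < y" using y by linarith
  then show ?thesis
  proof cases
    case 1
    have "((\<lambda>_. 0) has_real_derivative 0) (at y)" by simp
    then have "(ramp x p has_real_derivative 0) (at y)"
      by (rule has_field_derivative_transform_within_open[where S = "{..<x p}"])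
        (use 1 l in \<open>auto simp: ramp_left\<close>)
    then show ?thesis using 1 by (simp add: slope_def)
  next
    case 2
    have "((\<lambda>y. (y - x p) / (x (Suc p) - x p)) has_real_derivative 1 / (x (Suc p) - x p)) (at y)"
      using l by (auto intro!: derivative_eq_intros)
    then have "(ramp x p has_real_derivative 1 / (x (Suc p) - x p)) (at y)"
      by (rule has_field_derivative_transform_within_open[where S = "{x p<..<x (Suc p)}"])
        (use 2 l in \<open>auto simp: ramp_mid\<close>)
    then show ?thesis using 2 by (simp add: slope_def)
  next
    case 3
    have "((\<lambda>_. 1) has_real_derivative 0) (at y)" by simp
    then have "(ramp x p has_real_derivative 0) (at y)"
      by (rule has_field_derivative_transform_within_open[where S = "{x (Suc p)<..}"])
        (use 3 l in \<open>auto simp: ramp_right\<close>)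
    then show ?thesis using 3 l by (simp add: slope_def)
  qed
qed

lemma partition_mono:
  assumes part: "partition_of L P x" and "p \<le> q" "q \<le> P"
  shows "x p \<le> x q"
  using assms(2,3)
proof (induction q rule: dec_induct)
  case (step q)
  then have "x q < x (Suc q)" using part by (simp add: partition_of_def)
  with step show ?case by simp
qed simp

lemma partition_bounds:
  assumes part: "partition_of L P x" and "p \<le> P"
  shows "0 \<le> x p" "x p \<le> L"
  using partition_mono[OF part, of 0 p] partition_mono[OF part, of p P] assms
  by (auto simp: partition_of_def)

text \<open>As v 0 = 0, the value v y is the sum of the increments up to y: ramps of cells on the
  left have saturated at 1, those on the right are still 0, and the cell of y contributes its affine
  share.\<close>

lemma S_h_expansion:
  assumes part: "partition_of L P x" and v: "v \<in> S_h L P x" and y: "y \<in> {0..L}"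
  shows "v y = (\<Sum>p<P. (v (x (Suc p)) - v (x p)) * ramp x p y)"
proof -
  have x0: "x 0 = 0" "x P = L" and lt: "\<And>p. p < P \<Longrightarrow> x p < x (Suc p)"
    using part by (auto simp: partition_of_def)
  have v0: "v 0 = 0" using v by (simp add: S_h_def)
  have right: "(\<Sum>p<k. (v (x (Suc p)) - v (x p)) * ramp x p y) = v (x k)" if "k \<le> P" "x k \<le> y" for k y
  proof -
    have "(\<Sum>p<k. (v (x (Suc p)) - v (x p)) * ramp x p y) = (\<Sum>p<k. v (x (Suc p)) - v (x p))"
    proof (rule sum.cong[OF refl])
      fix p assume p: "p \<in> {..<k}"
      then have "x (Suc p) \<le> x k" using partition_mono[OF part, of "Suc p" k] that by simp
      then have "ramp x p y = 1" using p that by (intro ramp_right lt) auto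
      then show "(v (x (Suc p)) - v (x p)) * ramp x p y = v (x (Suc p)) - v (x p)" by simp
    qed
    also have "\<dots> = v (x k)" by (simp add: sum_lessThan_telescope[of "\<lambda>p. v (x p)"] x0 v0)
    finally show ?thesis .
  qed
  have "v y = (\<Sum>p<k. (v (x (Suc p)) - v (x p)) * ramp x p y)" if "k \<le> P" "0 \<le> y" "y \<le> x k" for k
    using that
  proof (induction k)
    case 0
    then show ?case using x0 v0 by simp
  next
    case (Suc k)
    have l: "x k < x (Suc k)" using Suc lt by simp
    show ?case
    proof (cases "y \<le> x k")
      case True
      then show ?thesis using Suc l by (simp add: ramp_left)
    next
      case False
      obtain a b where ab: "\<And>z. z \<in> {x k..x (Suc k)} \<Longrightarrow> v z = a + b * z"
        using v Suc.prems(1) unfolding S_h_def by (auto simp: less_eq_Suc_le)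
      have "(\<Sum>p<k. (v (x (Suc p)) - v (x p)) * ramp x p y) = v (x k)"
        using False Suc by (intro right) auto
      moreover have "ramp x k y = (y - x k) / (x (Suc k) - x k)"
        using False Suc l by (intro ramp_mid) auto
      moreover have vk: "v (x k) = a + b * x k" "v (x (Suc k)) = a + b * x (Suc k)" "v y = a + b * y"
        using ab l False Suc by auto
      moreover have "(v (x (Suc k)) - v (x k)) * ((y - x k) / (x (Suc k) - x k)) = b * (y - x k)"
      proof -
        have "v (x (Suc k)) - v (x k) = b * (x (Suc k) - x k)"
          unfolding vk by (simp add: right_diff_distrib)
        then show ?thesis using l by simp
      qed
      ultimately show ?thesis by (simp only: sum.lessThan_Suc) (simp add: right_diff_distrib)
    qed
  qed
  from this[of P] y x0 show ?thesis by simp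
qed

lemma S_h_increments_sum:
  assumes part: "partition_of L P x" and v: "v \<in> S_h L P x"
  shows "(\<Sum>p<P. v (x (Suc p)) - v (x p)) = 0"
  using assms sum_lessThan_telescope[of "\<lambda>p. v (x p)" P] by (simp add: partition_of_def S_h_def)

text \<open>Every ramp is 0 at 0 and 1 at L, so the condition on c is the Dirichlet condition at
  L.\<close>

lemma ramp_sum_in_S_h:
  assumes part: "partition_of L P x" and L: "0 < L" and c: "(\<Sum>p<P. c p) = 0"
  shows "(\<lambda>y. \<Sum>p<P. c p * ramp x p y) \<in> S_h L P x"
proof -
  have x0: "x 0 = 0" "x P = L" and lt: "\<And>p. p < P \<Longrightarrow> x p < x (Suc p)"
    using part by (auto simp: partition_of_def)
  have aff: "\<exists>a b. \<forall>y\<in>{x q..x (Suc q)}. ramp x p y = a + b * y" if "p < P" "q < P" for p q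
  proof -
    consider "p < q" | "p = q" | "q < p" by linarith
    then show ?thesis
    proof cases
      case 1
      then have "x (Suc p) \<le> x q" using that by (intro partition_mono[OF part]) auto
      then show ?thesis using ramp_right[of x p, OF lt[OF that(1)]]
        by (intro exI[of _ 1] exI[of _ 0]) auto
    next
      case 2
      then show ?thesis using ramp_mid[of x p, OF lt[OF that(1)]]
        by (intro exI[of _ "- x p / (x (Suc p) - x p)"] exI[of _ "1 / (x (Suc p) - x p)"])
          (auto simp: diff_divide_distrib)
    next
      case 3
      then have "x (Suc q) \<le> x p" using that by (intro partition_mono[OF part]) auto
      then show ?thesis using ramp_left[of x p, OF lt[OF that(1)]]
        by (intro exI[of _ 0]) auto
    qed
  qed
  show ?thesis
    unfolding S_h_def
  proof (intro CollectI conjI allI impI)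
    show "continuous_on {0..L} (\<lambda>y. \<Sum>p<P. c p * ramp x p y)"
      by (intro continuous_intros ramp_continuous) (use lt in auto)
  next
    fix q assume q: "q < P"
    obtain a b where ab: "\<And>p y. p < P \<Longrightarrow> y \<in> {x q..x (Suc q)} \<Longrightarrow> ramp x p y = a p + b p * y"
      using aff[OF _ q] by metis
    show "\<exists>a b. \<forall>y\<in>{x q..x (Suc q)}. (\<Sum>p<P. c p * ramp x p y) = a + b * y"
      by (rule exI[of _ "\<Sum>p<P. c p * a p"], rule exI[of _ "\<Sum>p<P. c p * b p"])
        (simp add: ab sum_distrib_left sum.distrib algebra_simps)
  next
    have "ramp x p 0 = 0" if "p < P" for p
      using that partition_bounds[OF part, of p] by (intro ramp_left lt) auto
    then show "(\<Sum>p<P. c p * ramp x p 0) = 0" by simp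
    have "ramp x p L = 1" if "p < P" for p
      using that partition_bounds[OF part, of "Suc p"] by (intro ramp_right lt) auto
    then show "(\<Sum>p<P. c p * ramp x p L) = 0" using c by simp
  qed
qed

lemma deriv_ramp_sum:
  assumes part: "partition_of L P x" and y: "y \<in> {0<..<L}" "y \<notin> x ` {..P}"
    and v: "\<And>z. z \<in> {0..L} \<Longrightarrow> v z = (\<Sum>p<P. c p * ramp x p z)"
  shows "deriv v y = (\<Sum>p<P. c p * slope x p y)"
proof (rule DERIV_imp_deriv)
  have lt: "\<And>p. p < P \<Longrightarrow> x p < x (Suc p)" using part by (auto simp: partition_of_def)
  have "((\<lambda>y. \<Sum>p<P. c p * ramp x p y) has_real_derivative (\<Sum>p<P. c p * slope x p y)) (at y)"
    by (intro DERIV_sum DERIV_cmult DERIV_ramp lt) (use y in auto)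
  then show "(v has_real_derivative (\<Sum>p<P. c p * slope x p y)) (at y)"
    by (rule has_field_derivative_transform_within_open[where S = "{0<..<L}"]) (use y v in auto)
qed

lemma integrable_bounded_on_interval:
  fixes f :: "real \<Rightarrow> real"
  assumes "f \<in> borel_measurable (lebesgue_on {a<..<b})" "\<And>y. \<bar>f y\<bar> \<le> K"
  shows "integrable (lebesgue_on {a<..<b}) f"
proof -
  interpret finite_measure "lebesgue_on {a<..<b}"
    by (rule finite_measure_lebesgue_on) simp
  show ?thesis by (rule integrable_const_bound[where B = K]) (use assms in auto)
qed

text \<open>On cell p the function is affine, with left value a and increment c. The integral of its
  square there is l (a^2 + a c + c^2/3), least at a = -c/2 with value l c^2 / 12.\<close>

lemma increment_le_L2:
  assumes part: "partition_of L P x" and p: "p < P"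
  shows "(c p)\<^sup>2 \<le> 12 / (x (Suc p) - x p) * (LINT y|lebesgue_on {0<..<L}. (\<Sum>q<P. c q * ramp x q y)\<^sup>2)"
proof -
  define l where "l = x (Suc p) - x p"
  have lt: "\<And>p. p < P \<Longrightarrow> x p < x (Suc p)" using part by (auto simp: partition_of_def)
  have l: "0 < l" using lt[OF p] by (simp add: l_def)
  define v where "v y = (\<Sum>q<P. c q * ramp x q y)" for y
  define a where "a = (\<Sum>q<p. c q)"
  have vm: "v y = a + c p * (y - x p) / l" if y: "y \<in> {x p..x (Suc p)}" for y
  proof -
    have 1: "c q * ramp x q y = (if q < p then c q else if q = p then c p * (y - x p) / l else 0)" if "q < P" for q
    proof -
      consider "q < p" | "q = p" | "p < q" by linarith
      then show ?thesis
      proof cases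
        case 1
        then have "x (Suc q) \<le> x p" using p by (intro partition_mono[OF part]) auto
        then show ?thesis using 1 y lt[OF that] by (simp add: ramp_right)
      next
        case 2
        then show ?thesis using y lt[OF that] by (simp add: ramp_mid l_def)
      next
        case 3
        then have "x (Suc p) \<le> x q" using that by (intro partition_mono[OF part]) auto
        then show ?thesis using 3 y lt[OF that] by (simp add: ramp_left)
      qed
    qed
    have "{..<P} = {..<p} \<union> {p} \<union> {p<..<P}" using p by auto
    moreover have "v y = (\<Sum>q<P. (if q < p then c q else if q = p then c p * (y - x p) / l else 0))"
      unfolding v_def by (intro sum.cong refl 1) simp
    ultimately have "v y = (\<Sum>q\<in>{..<p} \<union> {p} \<union> {p<..<P}. (if q < p then c q else if q = p then c p * (y - x p) / l else 0))"
      by simp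
    also have "\<dots> = a + c p * (y - x p) / l"
      by (subst sum.union_disjoint, simp, simp, force, subst sum.union_disjoint) (auto simp: a_def)
    finally show ?thesis .
  qed
  have vbd: "\<bar>v y\<bar> \<le> (\<Sum>q<P. \<bar>c q\<bar>)" for y
    unfolding v_def
    by (rule order_trans[OF sum_abs]) (auto intro!: sum_mono simp: abs_mult ramp_bounds mult_left_le)
  have vint: "integrable (lebesgue_on {0<..<L}) (\<lambda>y. (v y)\<^sup>2)"
  proof (rule integrable_bounded_on_interval)
    show "(\<lambda>y. (v y)\<^sup>2) \<in> borel_measurable (lebesgue_on {0<..<L})"
      unfolding v_def by (intro measurable_restrict_space1 measurable_completion) measurable
    show "\<bar>(v y)\<^sup>2\<bar> \<le> (\<Sum>q<P. \<bar>c q\<bar>)\<^sup>2" for y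
      using power_mono[OF vbd[of y], of 2] by simp
  qed
  define G where "G y = a\<^sup>2 * (y - x p) + a * c p / l * (y - x p)\<^sup>2 + (c p / l)\<^sup>2 * (y - x p) ^ 3 / 3" for y
  have "((\<lambda>y. (a + c p * (y - x p) / l)\<^sup>2) has_integral G (x (Suc p)) - G (x p)) {x p..x (Suc p)}"
  proof (rule fundamental_theorem_of_calculus)
    fix y
    have "(G has_real_derivative (a + c p * (y - x p) / l)\<^sup>2) (at y within {x p..x (Suc p)})"
      unfolding G_def by (rule derivative_eq_intros refl | simp)+ (use l in \<open>simp add: power2_eq_square field_simps\<close>)
    then show "(G has_vector_derivative (a + c p * (y - x p) / l)\<^sup>2) (at y within {x p..x (Suc p)})"
      by (simp add: has_real_derivative_iff_has_vector_derivative)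
  qed (use lt[OF p] in simp)
  then have hi: "((\<lambda>y. (v y)\<^sup>2) has_integral G (x (Suc p)) - G (x p)) {x p..x (Suc p)}"
    by (rule has_integral_eq[rotated]) (simp add: vm)
  have "l * (c p)\<^sup>2 / 12 \<le> l * (a\<^sup>2 + a * c p + (c p)\<^sup>2 / 3)"
  proof -
    have "0 \<le> l * (a + c p / 2)\<^sup>2" using l by simp
    then show ?thesis by (simp add: power2_eq_square algebra_simps)
  qed
  also have "\<dots> = G (x (Suc p)) - G (x p)"
    using l by (simp add: G_def l_def[symmetric] power2_eq_square power3_eq_cube field_simps)
  also have "\<dots> = integral {x p..x (Suc p)} (\<lambda>y. (v y)\<^sup>2)" using hi by (simp add: integral_unique)
  also have "\<dots> = integral {x p<..<x (Suc p)} (\<lambda>y. (v y)\<^sup>2)"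
    by (simp add: integral_open_interval_real)
  also have "\<dots> \<le> integral {0<..<L} (\<lambda>y. (v y)\<^sup>2)"
  proof (rule integral_subset_le)
    show "{x p<..<x (Suc p)} \<subseteq> {0<..<L}"
      using partition_bounds[OF part, of p] partition_bounds[OF part, of "Suc p"] p by auto
    show "(\<lambda>y. (v y)\<^sup>2) integrable_on {x p<..<x (Suc p)}"
      using hi by (auto simp: integrable_on_open_interval_real dest: has_integral_integrable)
    show "(\<lambda>y. (v y)\<^sup>2) integrable_on {0<..<L}"
      using vint by (simp add: integrable_on_lebesgue_on)
  qed simp
  also have "\<dots> = (LINT y|lebesgue_on {0<..<L}. (v y)\<^sup>2)"
    using vint by (simp add: lebesgue_integral_eq_integral)
  finally show ?thesis using l by (simp add: v_def l_def[symmetric] field_simps)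
qed

section \<open>Absolute continuity and the Riemann--Liouville derivative\<close>

text \<open>The problem is posed with Lebesgue measurable functions, while the convolution calculus
  works with Borel functions on the whole line. Changing a null set and extending by zero bridges
  the two.\<close>

lemma lebesgue_on_borel_version:
  fixes d :: "real \<Rightarrow> real"
  assumes d: "integrable (lebesgue_on {a<..<b}) d"
  shows "\<exists>d' \<in> borel_measurable borel. integrable lborel d' \<and>
    (\<forall>s. s \<notin> {a<..<b} \<longrightarrow> d' s = 0) \<and> (AE s in lborel. s \<in> {a<..<b} \<longrightarrow> d' s = d s)"
proof -
  define h where "h s = indicator {a<..<b} s * d s" for s
  have h: "integrable lebesgue h"
    using d by (simp add: integrable_restrict_space h_def[abs_def])
  then obtain h' where h': "h' \<in> borel_measurable lborel" "AE s in lborel. h s = h' s"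
    using completion_ex_borel_measurable_real[of h lborel] by auto
  define d' where "d' s = indicator {a<..<b} s * h' s" for s
  have m: "d' \<in> borel_measurable borel" using h'(1) unfolding d'_def[abs_def] by simp
  have ae: "AE s in lborel. h s = d' s"
    using h'(2)
  proof eventually_elim
    case (elim s)
    then show ?case by (cases "s \<in> {a<..<b}") (simp_all add: d'_def h_def)
  qed
  have "integrable lebesgue d'"
    using h by (rule integrable_cong_AE_imp) (use m ae AE_completion[OF ae] in \<open>auto simp: eq_commute intro: measurable_completion\<close>)
  then have "integrable lborel d'" using m by (simp add: integrable_completion)
  then show ?thesis
  proof (intro bexI[OF _ m] conjI)
    show "AE s in lborel. s \<in> {a<..<b} \<longrightarrow> d' s = d s"
      using ae by eventually_elim (auto simp: h_def)
  qed (auto simp: d'_def)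
qed

lemma LINT_lebesgue_on_eq:
  fixes f :: "real \<Rightarrow> real"
  assumes "f \<in> borel_measurable borel"
  shows "(LINT s|lebesgue_on {a<..<b}. f s) = (LINT s|lborel. indicator {a<..<b} s * f s)"
  using assms by (simp add: integral_restrict_space integral_completion)

lemma abs_cont_density:
  assumes "abs_cont T v"
  obtains d where "d \<in> borel_measurable borel" "integrable lborel d"
    "\<And>s. s \<notin> {0<..<T} \<Longrightarrow> d s = 0" "\<And>t. t \<in> {0..T} \<Longrightarrow> v t = v 0 + fint 1 d t"
proof -
  obtain e where e: "integrable (lebesgue_on {0<..<T}) e"
      "\<And>t. t \<in> {0..T} \<Longrightarrow> v t = v 0 + (LINT s|lebesgue_on {0<..<t}. e s)"
    using assms unfolding abs_cont_def by blast
  obtain d where d: "d \<in> borel_measurable borel" "integrable lborel d"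
    "\<And>s. s \<notin> {0<..<T} \<Longrightarrow> d s = 0" "AE s in lborel. s \<in> {0<..<T} \<longrightarrow> d s = e s"
    using lebesgue_on_borel_version[OF e(1)] by metis
  have lint: "(LINT s|lebesgue_on {0<..<t}. e s) = fint 1 d t" if t: "t \<in> {0..T}" for t
  proof -
    have "(LINT s|lebesgue_on {0<..<t}. e s) = (LINT s|lebesgue_on {0<..<t}. d s)"
    proof (rule integral_cong_AE)
      have "{0<..<t} \<subseteq> {0<..<T}" using t by auto
      then show "e \<in> borel_measurable (lebesgue_on {0<..<t})"
        using borel_measurable_integrable[OF e(1)] measurable_restrict_mono by blast
      show "d \<in> borel_measurable (lebesgue_on {0<..<t})"
        using d(1) by (auto intro!: measurable_restrict_space1 measurable_completion)
      have "AE s in lebesgue. s \<in> {0<..<t} \<longrightarrow> e s = d s"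
        using AE_completion[OF d(4)] by eventually_elim (use t in auto)
      then show "AE s in lebesgue_on {0<..<t}. e s = d s"
        by (simp add: AE_restrict_space_iff)
    qed
    also have "\<dots> = (LINT s|lborel. indicator {0<..<t} s * d s)" by (rule LINT_lebesgue_on_eq[OF d(1)])
    also have "\<dots> = fint 1 d t"
      unfolding fint_1 by (intro Bochner_Integration.integral_cong refl) (use d(3) in \<open>auto simp: indicator_def\<close>)
    finally show ?thesis .
  qed
  show thesis
  proof (rule that[OF d(1,2)])
    show "d s = 0" if "s \<notin> {0<..<T}" for s using d(3) that by blast
    show "v t = v 0 + fint 1 d t" if "t \<in> {0..T}" for t
      using e(2)[OF that] lint[OF that] by simp
  qed
qed

text \<open>As d vanishes before 0, convolution with \<open>kern 1\<close> is the gauge integral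
  over {0..s}, to which the differentiation theorem applies.\<close>

lemma AE_DERIV_fint_1:
  assumes [measurable]: "d \<in> borel_measurable borel" and d: "integrable lborel d"
    and d0: "\<And>s. s \<le> 0 \<Longrightarrow> d s = 0"
  shows "AE t in lborel. t \<in> {0<..<T} \<longrightarrow> (fint 1 d has_real_derivative d t) (at t)"
proof -
  have int: "d integrable_on A" if "A \<in> sets borel" for A
  proof -
    have "integrable lborel (\<lambda>s. indicator A s * d s)"
      by (rule Bochner_Integration.integrable_bound[OF d]) (use that in \<open>auto simp: indicator_def\<close>)
    from integrable_on_lborel[OF this] have "(\<lambda>s. if s \<in> A then d s else 0) integrable_on UNIV"
      by (rule integrable_eq) (auto simp: indicator_def)
    then show ?thesis by (simp add: integrable_restrict_UNIV)
  qed
  have eq: "fint 1 d s = integral {0..s} d" for s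
  proof -
    have i: "integrable lborel (\<lambda>r. indicator {..<s} r * d r)"
      by (rule Bochner_Integration.integrable_bound[OF d]) (auto simp: indicator_def)
    have "fint 1 d s = integral UNIV (\<lambda>r. indicator {..<s} r * d r)"
      unfolding fint_1 using integral_lborel[OF i] by simp
    also have "\<dots> = integral UNIV (\<lambda>r. if r \<in> {0..s} then d r else 0)"
      by (rule integral_spike[where S = "{s}"]) (auto simp: indicator_def d0)
    also have "\<dots> = integral {0..s} d" by (rule integral_restrict_UNIV)
    finally show ?thesis .
  qed
  have "negligible {t \<in> {0<..<T}. \<not> ((\<lambda>s. integral {0..s} d) has_real_derivative d t) (at t)}"
    by (rule negligible_not_differentiable_integral) (use int in auto)
  then have "AE t in lebesgue. t \<notin> {t \<in> {0<..<T}. \<not> ((\<lambda>s. integral {0..s} d) has_real_derivative d t) (at t)}"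
    by (intro AE_not_in) (simp add: negligible_iff_null_sets)
  then have "AE t in lborel. t \<notin> {t \<in> {0<..<T}. \<not> ((\<lambda>s. integral {0..s} d) has_real_derivative d t) (at t)}"
    by (simp only: AE_completion_iff)
  then show ?thesis
    by eventually_elim (auto simp: eq[abs_def])
qed

text \<open>I^a and I^1 commute, so I^a of c + I^1 d is a kernel term plus a primitive. The
  integrability serves later to split the fractional integral of a finite sum.\<close>

lemma frac_int_density:
  assumes [measurable]: "d \<in> borel_measurable borel" and d: "integrable lborel d"
    and d0: "\<And>s. s \<le> 0 \<Longrightarrow> d s = 0" and a: "0 < a"
    and v: "\<And>t. t \<in> {0..T} \<Longrightarrow> v t = c + fint 1 d t" and t: "t \<in> {0..T}"
  shows "integrable (lebesgue_on {0<..<t}) (\<lambda>s. omega a (t - s) * v s)"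
    and "frac_int a v t = c * kern (1 + a) t + fint 1 (fint a d) t"
proof -
  have fin: "nfint (1 + a) (\<lambda>s. ennreal \<bar>d s\<bar>) t < \<infinity>" by (rule nfint_1_plus_finite[OF assms(1-4)])
  have z0: "fint 1 d s = 0" if "s \<le> 0" for s
    using d0 that by (intro fint_eq_0) auto
  have i1: "integrable lborel (\<lambda>s. kern a (t - s) * fint 1 d s)"
  proof (rule integrable_kern_mult)
    have "nfint a (\<lambda>s. ennreal \<bar>fint 1 d s\<bar>) t \<le> nfint a (nfint 1 (\<lambda>s. ennreal \<bar>d s\<bar>)) t"
      by (intro nfint_mono abs_fint_le) auto
    also have "\<dots> = nfint (1 + a) (\<lambda>s. ennreal \<bar>d s\<bar>) t"
      using a by (simp add: nfint_nfint add.commute)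
    finally show "nfint a (\<lambda>s. ennreal \<bar>fint 1 d s\<bar>) t < \<infinity>" using fin by simp
  qed (use a in auto)
  have i2: "integrable lborel (\<lambda>s. kern a (t - s) * kern 1 s)"
    by (rule integrable_kern_mult) (use a in \<open>auto simp: nfint_kern\<close>)
  have l2: "(LINT s|lborel. kern a (t - s) * kern 1 s) = kern (1 + a) t"
  proof -
    have "(\<integral>\<^sup>+s. ennreal (kern a (t - s) * kern 1 s) \<partial>lborel) = ennreal (kern (a + 1) t)"
      using a nfint_kern[of a 1 t] by (simp add: ennreal_mult nfint_def)
    then show ?thesis using a by (simp add: integral_eq_nn_integral add.commute)
  qed
  have eq: "indicator {0<..<t} s * (omega a (t - s) * v s) = c * (kern a (t - s) * kern 1 s) + kern a (t - s) * fint 1 d s" for s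
  proof (cases "s \<in> {0<..<t}")
    case True
    then show ?thesis using v[of s] t by (simp add: kern_1) (simp add: kern_def algebra_simps)
  next
    case False
    then show ?thesis using z0[of s] by (cases "s \<le> 0") (auto simp: kern_1)
  qed
  have i3: "integrable lborel (\<lambda>s. c * (kern a (t - s) * kern 1 s) + kern a (t - s) * fint 1 d s)"
    using i1 i2 by auto
  then show "integrable (lebesgue_on {0<..<t}) (\<lambda>s. omega a (t - s) * v s)"
    by (simp add: integrable_restrict_space eq integrable_completion)
  have "frac_int a v t = (LINT s|lborel. c * (kern a (t - s) * kern 1 s) + kern a (t - s) * fint 1 d s)"
    unfolding frac_int_def by (simp add: integral_restrict_space eq integral_completion)
  also have "\<dots> = c * kern (1 + a) t + fint a (fint 1 d) t"
    using i1 i2 by (simp add: l2 fint_def[of a])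
  also have "fint a (fint 1 d) t = fint (1 + a) d t"
    using fin a by (subst fint_fint) (auto simp: add.commute)
  also have "fint (1 + a) d t = fint 1 (fint a d) t"
    using fin a by (subst fint_fint) auto
  finally show "frac_int a v t = c * kern (1 + a) t + fint 1 (fint a d) t" .
qed

lemma DERIV_kern:
  assumes "0 < a" "0 < t"
  shows "(kern (1 + a) has_real_derivative kern a t) (at t)"
proof -
  have G: "Gamma (1 + a) = a * Gamma a"
    using Gamma_plus1[of a] assms nonpos_Ints_nonpos[of a] by (auto simp: add.commute)
  have "((\<lambda>t. t powr a / Gamma (1 + a)) has_real_derivative kern a t) (at t)"
    using assms less_imp_neq[OF Gamma_real_pos[OF assms(1)]]
    by (auto intro!: derivative_eq_intros simp: G kern_def omega_def simp del: Gamma_eq_zero_iff)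
  then show ?thesis
    by (rule has_field_derivative_transform_within_open[where S = "{0<..}"])
      (use assms in \<open>auto simp: kern_def omega_def\<close>)
qed

lemma AE_DERIV_frac_int:
  assumes [measurable]: "d \<in> borel_measurable borel" and d: "integrable lborel d"
    and d0: "\<And>s. s \<le> 0 \<Longrightarrow> d s = 0" and a: "0 < a"
    and v: "\<And>t. t \<in> {0..T} \<Longrightarrow> v t = c + fint 1 d t"
  shows "AE t in lborel. t \<in> {0<..<T} \<longrightarrow>
    (frac_int a v has_real_derivative c * kern a t + fint a d t) (at t)"
proof (cases "0 < T")
  case True
  \<comment> \<open>I^a d is integrable up to T but in general not on the whole line; the cut-off
    changes nothing before T.\<close>
  define e where "e s = indicator {..<T} s * fint a d s" for s
  have [measurable]: "e \<in> borel_measurable borel" unfolding e_def[abs_def] by measurable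
  have e0: "e s = 0" if "s \<le> 0" for s
    using fint_eq_0[of s d a] d0 that by (simp add: e_def)
  have "(\<integral>\<^sup>+s. ennreal (norm (e s)) \<partial>lborel) \<le> nfint 1 (nfint a (\<lambda>s. ennreal \<bar>d s\<bar>)) T"
    unfolding nfint_1[of "nfint a _"]
  proof (rule nn_integral_mono)
    fix s
    show "ennreal (norm (e s)) \<le> nfint a (\<lambda>s. ennreal \<bar>d s\<bar>) s * indicator {..<T} s"
      using abs_fint_le[of d a s] a by (cases "s < T") (auto simp: e_def)
  qed
  also have "\<dots> < \<infinity>"
    using nfint_1_plus_finite[OF assms(1-4), of T] a by (simp add: nfint_nfint)
  finally have "integrable lborel e" by (intro integrableI_bounded) auto
  then have "AE t in lborel. t \<in> {0<..<T} \<longrightarrow> (fint 1 e has_real_derivative e t) (at t)"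
    by (rule AE_DERIV_fint_1[rotated]) (use e0 in auto)
  then show ?thesis
  proof eventually_elim
    case (elim t)
    show ?case
    proof
      assume t: "t \<in> {0<..<T}"
      have "((\<lambda>t. c * kern (1 + a) t + fint 1 e t) has_real_derivative c * kern a t + e t) (at t)"
        using elim t a by (intro DERIV_add DERIV_cmult DERIV_kern) auto
      then have "(frac_int a v has_real_derivative c * kern a t + e t) (at t)"
      proof (rule has_field_derivative_transform_within_open[where S = "{0<..<T}"])
        fix s assume s: "s \<in> {0<..<T}"
        have "fint 1 e s = fint 1 (fint a d) s"
          using s by (intro fint_cong) (auto simp: e_def)
        then show "c * kern (1 + a) s + fint 1 e s = frac_int a v s"
          using frac_int_density(2)[OF assms, of s] s by simp
      qed (use t in auto)
      then show "(frac_int a v has_real_derivative c * kern a t + fint a d t) (at t)"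
        using t by (simp add: e_def)
    qed
  qed
qed simp

section \<open>Estimates at a fixed time\<close>

text \<open>By \<open>S_h_expansion\<close> and \<open>ramp_sum_in_S_h\<close>, the elements of \<open>S_h\<close> are the combinations of
  ramps with coefficient sum zero, the coefficients being the increments between nodes.
  This avoids a separate treatment of boundary hat functions, and the derivatives of the
  basis functions have disjoint supports.\<close>
definition ramp_sum :: "(nat \<Rightarrow> real) \<Rightarrow> nat \<Rightarrow> (nat \<Rightarrow> real) \<Rightarrow> real \<Rightarrow> real" where
  "ramp_sum x P c y = (\<Sum>p<P. c p * ramp x p y)"

definition slope_sum :: "(nat \<Rightarrow> real) \<Rightarrow> nat \<Rightarrow> (nat \<Rightarrow> real) \<Rightarrow> real \<Rightarrow> real" where
  "slope_sum x P c y = (\<Sum>p<P. c p * slope x p y)"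

lemma measurable_Om: "f \<in> borel_measurable borel \<Longrightarrow> f \<in> borel_measurable (Om L)"
  by (intro measurable_restrict_space1 measurable_completion) simp

lemma ramp_sum_measurable [measurable]: "ramp_sum x P c \<in> borel_measurable (Om L)"
  by (rule measurable_Om) (unfold ramp_sum_def[abs_def], measurable)

lemma slope_sum_measurable [measurable]: "slope_sum x P c \<in> borel_measurable (Om L)"
  by (rule measurable_Om) (unfold slope_sum_def[abs_def], measurable)

lemma ramp_sum_square_le: "(ramp_sum x P c y)\<^sup>2 \<le> (\<Sum>p<P. (c p)\<^sup>2) * real P"
proof -
  have "(ramp_sum x P c y)\<^sup>2 \<le> (\<Sum>p<P. (c p)\<^sup>2) * (\<Sum>p<P. (ramp x p y)\<^sup>2)"
    unfolding ramp_sum_def by (rule Cauchy_Schwarz_ineq_sum)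
  also have "(\<Sum>p<P. (ramp x p y)\<^sup>2) \<le> (\<Sum>p<P. 1)"
    by (intro sum_mono power_le_one ramp_bounds)
  finally show ?thesis by (simp add: mult_left_mono sum_nonneg)
qed

lemma slope_sum_square_le:
  assumes "\<And>p. p < P \<Longrightarrow> x p < x (Suc p)"
  shows "(slope_sum x P c y)\<^sup>2 \<le> (\<Sum>p<P. (c p)\<^sup>2) * (\<Sum>p<P. (1 / (x (Suc p) - x p))\<^sup>2)"
proof -
  have "(slope_sum x P c y)\<^sup>2 \<le> (\<Sum>p<P. (c p)\<^sup>2) * (\<Sum>p<P. (slope x p y)\<^sup>2)"
    unfolding slope_sum_def by (rule Cauchy_Schwarz_ineq_sum)
  also have "(\<Sum>p<P. (slope x p y)\<^sup>2) \<le> (\<Sum>p<P. (1 / (x (Suc p) - x p))\<^sup>2)"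
    using assms by (intro sum_mono) (auto simp: slope_def)
  finally show ?thesis by (simp add: mult_left_mono sum_nonneg)
qed

lemma integrable_square_bounded:
  fixes f :: "real \<Rightarrow> real"
  assumes "f \<in> borel_measurable (Om L)" "\<And>y. (f y)\<^sup>2 \<le> K"
  shows "integrable (Om L) (\<lambda>y. (f y)\<^sup>2)"
  by (rule integrable_bounded_on_interval[where K = K]) (use assms in auto)

lemma integral_square_bounded:
  fixes f :: "real \<Rightarrow> real"
  assumes "f \<in> borel_measurable (Om L)" "\<And>y. (f y)\<^sup>2 \<le> K" "0 < L"
  shows "(LINT y|Om L. (f y)\<^sup>2) \<le> L * K"
proof -
  have "(LINT y|Om L. (f y)\<^sup>2) \<le> (LINT y|Om L. K)"
  proof (rule integral_mono)
    show "integrable (Om L) (\<lambda>y. K)"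
      by (rule integrable_bounded_on_interval[where K = "\<bar>K\<bar>"]) auto
  qed (use assms integrable_square_bounded in auto)
  also have "\<dots> = L * K"
    using \<open>0 < L\<close> by (simp add: measure_restrict_space)
  finally show ?thesis .
qed

text \<open>U and W stand for u_0h and its derivative, V and X for I^\<alpha> w' and its derivative,
  k for the kernel. The weights 2, 1, 1 add up to 4, so (p + q + e)^2 / 4 \<le> p^2/2 + q^2 + e^2,
  and -X^2 absorbs the gradient. The term with C/2 covers V^2/2 from the g-term and p^2/2.\<close>

lemma energy_algebra:
  fixes f C k U W V X g e :: real
  assumes "1 + f\<^sup>2 \<le> C"
  shows "- ((k * W + X) * X) + f * (k * U + V) * X + g * V + e * X
    \<le> C / 2 * V\<^sup>2 + (k\<^sup>2 * C * (U\<^sup>2 + W\<^sup>2) + 1/2 * g\<^sup>2 + e\<^sup>2)"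
proof -
  define p q where "p = f * V" and "q = k * (f * U - W)"
  have 1: "(p + q + e) * X - X\<^sup>2 \<le> 1/2 * p\<^sup>2 + q\<^sup>2 + e\<^sup>2"
  proof -
    have "0 \<le> (X - (p + q + e) / 2)\<^sup>2 + 1/4 * (1/2 * (p - 2 * q)\<^sup>2 + 1/2 * (p - 2 * e)\<^sup>2 + (q - e)\<^sup>2)"
      by (intro add_nonneg_nonneg mult_nonneg_nonneg) auto
    also have "\<dots> = 1/2 * p\<^sup>2 + q\<^sup>2 + e\<^sup>2 - ((p + q + e) * X - X\<^sup>2)"
      by (simp add: power2_eq_square field_simps)
    finally show ?thesis by simp
  qed
  have 2: "q\<^sup>2 \<le> k\<^sup>2 * C * (U\<^sup>2 + W\<^sup>2)"
  proof -
    \<comment> \<open>The added square completes Lagrange's identity; this is one source of the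
      combination 1 + F^2.\<close>
    have "(f * U - W)\<^sup>2 \<le> (f * U - W)\<^sup>2 + (f * W + U)\<^sup>2" by simp
    also have "\<dots> = (1 + f\<^sup>2) * (U\<^sup>2 + W\<^sup>2)" by (simp add: power2_eq_square algebra_simps)
    also have "\<dots> \<le> C * (U\<^sup>2 + W\<^sup>2)" using assms by (intro mult_right_mono) auto
    finally have "k\<^sup>2 * (f * U - W)\<^sup>2 \<le> k\<^sup>2 * (C * (U\<^sup>2 + W\<^sup>2))" by (intro mult_left_mono) auto
    then show ?thesis by (simp add: q_def power_mult_distrib mult.assoc)
  qed
  have 3: "g * V \<le> 1/2 * g\<^sup>2 + 1/2 * V\<^sup>2"
    using sum_squares_bound[of g V] by simp
  have 4: "1/2 * V\<^sup>2 + 1/2 * p\<^sup>2 \<le> C / 2 * V\<^sup>2"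
  proof -
    have "(1 + f\<^sup>2) * V\<^sup>2 \<le> C * V\<^sup>2" using assms by (intro mult_right_mono) auto
    then show ?thesis by (simp add: p_def power_mult_distrib algebra_simps)
  qed
  have "- ((k * W + X) * X) + f * (k * U + V) * X + g * V + e * X = (p + q + e) * X - X\<^sup>2 + g * V"
    by (simp add: p_def q_def power2_eq_square algebra_simps)
  then show ?thesis using 1 2 3 4 by linarith
qed

text \<open>The equation at one instant: \<open>f\<close>, \<open>g\<close>, \<open>e\<close> are the values of \<open>F\<close>, \<open>g\<close>, \<open>g\<^sub>*\<close>, and \<open>d\<close>, \<open>A\<close> hold the
  coefficients of the time derivative and of the Riemann--Liouville derivative.\<close>
definition tested_equation ::
    "real \<Rightarrow> nat \<Rightarrow> (nat \<Rightarrow> real) \<Rightarrow> (real \<Rightarrow> real) \<Rightarrow> (real \<Rightarrow> real) \<Rightarrow> (real \<Rightarrow> real) \<Rightarrow>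
     (nat \<Rightarrow> real) \<Rightarrow> (nat \<Rightarrow> real) \<Rightarrow> bool" where
  "tested_equation L P x f g e d A \<longleftrightarrow> (\<forall>v. (\<Sum>p<P. v p) = 0 \<longrightarrow>
      (LINT y|Om L. ramp_sum x P d y * ramp_sum x P v y)
      + (LINT y|Om L. slope_sum x P A y * slope_sum x P v y)
      - (LINT y|Om L. (f y * ramp_sum x P A y) * slope_sum x P v y)
      = (LINT y|Om L. g y * ramp_sum x P v y) + (LINT y|Om L. e y * slope_sum x P v y))"

locale fe_time_slice =
  fixes L :: real and P :: nat and x :: "nat \<Rightarrow> real" and C :: real and f g e :: "real \<Rightarrow> real"
    and d A :: "nat \<Rightarrow> real"
  assumes L: "0 < L" and part: "partition_of L P x"
    and f: "f \<in> borel_measurable (Om L)" and fC: "AE y in Om L. 1 + (f y)\<^sup>2 \<le> C"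
    and g: "g \<in> L2_space L" and e: "e \<in> L2_space L"
    and eq: "tested_equation L P x f g e d A"
begin

lemma lt: "p < P \<Longrightarrow> x p < x (Suc p)"
  using part by (simp add: partition_of_def)

lemma meas [measurable]:
  "f \<in> borel_measurable (Om L)" "g \<in> borel_measurable (Om L)" "e \<in> borel_measurable (Om L)"
  using f g e by (auto simp: L2_space_def)

lemma sq_int: "integrable (Om L) (\<lambda>y. (g y)\<^sup>2)" "integrable (Om L) (\<lambda>y. (e y)\<^sup>2)"
  "integrable (Om L) (\<lambda>y. (ramp_sum x P c y)\<^sup>2)" "integrable (Om L) (\<lambda>y. (slope_sum x P c y)\<^sup>2)"
  using g e by (auto simp: L2_space_def
      intro!: integrable_square_bounded ramp_sum_square_le slope_sum_square_le lt)

lemma f_sq_int: "integrable (Om L) (\<lambda>y. (f y * ramp_sum x P c y)\<^sup>2)"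
proof (rule Bochner_Integration.integrable_bound)
  show "integrable (Om L) (\<lambda>y. C * (ramp_sum x P c y)\<^sup>2)" using sq_int by auto
  show "AE y in Om L. norm ((f y * ramp_sum x P c y)\<^sup>2) \<le> norm (C * (ramp_sum x P c y)\<^sup>2)"
    using fC
  proof eventually_elim
    case (elim y)
    then have "(f y)\<^sup>2 \<le> \<bar>C\<bar>" by linarith
    then show ?case by (simp add: power_mult_distrib abs_mult mult_right_mono)
  qed
qed measurable

lemmas prod_int = integrable_mult_of_squares[of _ "Om L"]

lemma prods_int:
  "integrable (Om L) (\<lambda>y. ramp_sum x P c y * ramp_sum x P v y)"
  "integrable (Om L) (\<lambda>y. slope_sum x P c y * slope_sum x P v y)"
  "integrable (Om L) (\<lambda>y. f y * ramp_sum x P c y * slope_sum x P v y)"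
  "integrable (Om L) (\<lambda>y. g y * ramp_sum x P v y)"
  "integrable (Om L) (\<lambda>y. e y * slope_sum x P v y)"
  by (intro prod_int sq_int f_sq_int; measurable)+

text \<open>A single integral on the right, so that pointwise inequalities can be integrated as they
  stand.\<close>

lemma tested:
  assumes "(\<Sum>p<P. v p) = 0"
  shows "(LINT y|Om L. ramp_sum x P d y * ramp_sum x P v y)
    = (LINT y|Om L. - (slope_sum x P A y * slope_sum x P v y) + f y * ramp_sum x P A y * slope_sum x P v y
         + g y * ramp_sum x P v y + e y * slope_sum x P v y)"
  using eq[unfolded tested_equation_def, rule_format, OF assms] prods_int by simp

text \<open>Testing with the fractional integral of the time derivative.\<close>
lemma energy_estimate:
  assumes D: "(\<Sum>p<P. D p) = 0" and A: "\<And>p. p < P \<Longrightarrow> A p = a p * k + D p"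
  shows "(LINT y|Om L. ramp_sum x P d y * ramp_sum x P D y)
    \<le> C / 2 * (LINT y|Om L. (ramp_sum x P D y)\<^sup>2)
      + (k\<^sup>2 * C * ((LINT y|Om L. (ramp_sum x P a y)\<^sup>2) + (LINT y|Om L. (slope_sum x P a y)\<^sup>2))
         + 1/2 * (LINT y|Om L. (g y)\<^sup>2) + (LINT y|Om L. (e y)\<^sup>2))"
proof -
  have RA: "ramp_sum x P A y = k * ramp_sum x P a y + ramp_sum x P D y" for y
    unfolding ramp_sum_def sum_distrib_left sum.distrib[symmetric]
    by (intro sum.cong) (auto simp: A algebra_simps)
  have SA: "slope_sum x P A y = k * slope_sum x P a y + slope_sum x P D y" for y
    unfolding slope_sum_def sum_distrib_left sum.distrib[symmetric]
    by (intro sum.cong) (auto simp: A algebra_simps)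
  have "(LINT y|Om L. ramp_sum x P d y * ramp_sum x P D y)
    \<le> (LINT y|Om L. C / 2 * (ramp_sum x P D y)\<^sup>2
        + (k\<^sup>2 * C * ((ramp_sum x P a y)\<^sup>2 + (slope_sum x P a y)\<^sup>2) + 1/2 * (g y)\<^sup>2 + (e y)\<^sup>2))"
    unfolding tested[OF D]
  proof (rule integral_mono_AE)
    show "AE y in Om L. - (slope_sum x P A y * slope_sum x P D y) + f y * ramp_sum x P A y * slope_sum x P D y
         + g y * ramp_sum x P D y + e y * slope_sum x P D y
       \<le> C / 2 * (ramp_sum x P D y)\<^sup>2
        + (k\<^sup>2 * C * ((ramp_sum x P a y)\<^sup>2 + (slope_sum x P a y)\<^sup>2) + 1/2 * (g y)\<^sup>2 + (e y)\<^sup>2)"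
      using fC
    proof eventually_elim
      case (elim y)
      show ?case unfolding RA SA by (rule energy_algebra[OF elim])
    qed
  qed (use prods_int sq_int in auto)
  also have "\<dots> = C / 2 * (LINT y|Om L. (ramp_sum x P D y)\<^sup>2)
      + (k\<^sup>2 * C * ((LINT y|Om L. (ramp_sum x P a y)\<^sup>2) + (LINT y|Om L. (slope_sum x P a y)\<^sup>2))
         + 1/2 * (LINT y|Om L. (g y)\<^sup>2) + (LINT y|Om L. (e y)\<^sup>2))"
    using sq_int by simp
  finally show ?thesis .
qed

end

section \<open>Inverse inequality and the size of the time derivative\<close>

definition inverse_const :: "real \<Rightarrow> nat \<Rightarrow> (nat \<Rightarrow> real) \<Rightarrow> real" where
  "inverse_const L P x = 1 + (\<Sum>p<P. 12 / (x (Suc p) - x p)) * (1 + L * (\<Sum>p<P. (1 / (x (Suc p) - x p))\<^sup>2))"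

text \<open>The factor that the absorption argument in \<open>rate_estimate\<close> leaves. It
  depends on the mesh, which is harmless: it serves only to show that the time derivative is square
  integrable.\<close>

definition rate_const :: "real \<Rightarrow> nat \<Rightarrow> (nat \<Rightarrow> real) \<Rightarrow> real \<Rightarrow> real" where
  "rate_const L P x C = (let K = inverse_const L P x in
     2 * K * (1 + 3 * K + 3 * K * L * (C * real P + (\<Sum>p<P. (1 / (x (Suc p) - x p))\<^sup>2))))"

text \<open>Summing \<open>increment_le_L2\<close> over the cells bounds the coefficients by the L2
  norm; the slopes are bounded by the coefficients and the cell lengths.\<close>

lemma inverse_inequality:
  assumes L: "0 < L" and part: "partition_of L P x"
  shows "1 \<le> inverse_const L P x"
    and "p < P \<Longrightarrow> (c p)\<^sup>2 \<le> inverse_const L P x * (LINT y|Om L. (ramp_sum x P c y)\<^sup>2)"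
    and "(LINT y|Om L. (slope_sum x P c y)\<^sup>2) \<le> inverse_const L P x * (LINT y|Om L. (ramp_sum x P c y)\<^sup>2)"
proof -
  have lt: "x p < x (Suc p)" if "p < P" for p using part that by (simp add: partition_of_def)
  define J where "J = (LINT y|Om L. (ramp_sum x P c y)\<^sup>2)"
  define m where "m = (\<Sum>p<P. 12 / (x (Suc p) - x p))"
  define s where "s = (\<Sum>p<P. (1 / (x (Suc p) - x p))\<^sup>2)"
  have J: "0 \<le> J" by (simp add: J_def)
  have m0: "0 \<le> 12 / (x (Suc p) - x p)" if "p < P" for p using lt[OF that] by simp
  have m: "0 \<le> m" and s: "0 \<le> s" unfolding m_def s_def using m0 by (auto intro!: sum_nonneg)
  have K: "inverse_const L P x = 1 + m * (1 + L * s)" by (simp add: inverse_const_def m_def s_def)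
  show "1 \<le> inverse_const L P x" using m s L by (simp add: K)
  have cp: "(c p)\<^sup>2 \<le> 12 / (x (Suc p) - x p) * J" if "p < P" for p
    using increment_le_L2[OF part that, of c] by (simp add: J_def ramp_sum_def)
  then have cs: "(\<Sum>p<P. (c p)\<^sup>2) \<le> m * J"
    unfolding m_def sum_distrib_right by (intro sum_mono) auto
  have mK: "m * J \<le> inverse_const L P x * J" "m * (L * s) * J \<le> inverse_const L P x * J"
    using m s L J by (auto simp: K algebra_simps intro!: mult_right_mono)
  {
    assume p: "p < P"
    have "(c p)\<^sup>2 \<le> (\<Sum>p<P. (c p)\<^sup>2)" using p by (intro member_le_sum) auto
    then show "(c p)\<^sup>2 \<le> inverse_const L P x * (LINT y|Om L. (ramp_sum x P c y)\<^sup>2)"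
      using cs mK unfolding J_def by linarith
  }
  have "(LINT y|Om L. (slope_sum x P c y)\<^sup>2) \<le> L * ((\<Sum>p<P. (c p)\<^sup>2) * s)"
    unfolding s_def by (rule integral_square_bounded) (use L lt in \<open>auto intro!: slope_sum_square_le\<close>)
  also have "\<dots> \<le> L * (m * J * s)" using cs L s by (intro mult_left_mono mult_right_mono) auto
  also have "\<dots> = m * (L * s) * J" by simp
  also have "\<dots> \<le> inverse_const L P x * J" by (rule mK)
  finally show "(LINT y|Om L. (slope_sum x P c y)\<^sup>2) \<le> inverse_const L P x * (LINT y|Om L. (ramp_sum x P c y)\<^sup>2)"
    by (simp add: J_def)
qed

text \<open>Young's inequality with weight 1/(4K) on X^2: after the inverse inequality the gradient
  costs a quarter of the squared norm of the time derivative and g V another quarter, so half of it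
  survives.\<close>

lemma rate_algebra:
  fixes f C K w r V X g e :: real
  assumes "1 + f\<^sup>2 \<le> C" and K: "0 < K"
  shows "- (w * X) + f * r * X + g * V + e * X
    \<le> g\<^sup>2 + 1/4 * V\<^sup>2 + 3 * K * (e\<^sup>2 + w\<^sup>2 + C * r\<^sup>2) + 1 / (4 * K) * X\<^sup>2"
proof -
  define z where "z = e - w + f * r"
  have "0 \<le> K * (z - X / (2 * K))\<^sup>2" using K by simp
  also have "\<dots> = K * z\<^sup>2 - z * X + 1 / (4 * K) * X\<^sup>2"
    using K by (simp add: power2_eq_square field_simps)
  finally have 1: "z * X \<le> K * z\<^sup>2 + 1 / (4 * K) * X\<^sup>2" by simp
  have "z\<^sup>2 \<le> 3 * (e\<^sup>2 + w\<^sup>2 + (f * r)\<^sup>2)"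
  proof -
    have "0 \<le> (e + w)\<^sup>2 + (e - f * r)\<^sup>2 + (w + f * r)\<^sup>2" by simp
    then show ?thesis unfolding z_def by (simp add: power2_eq_square algebra_simps)
  qed
  also have "\<dots> \<le> 3 * (e\<^sup>2 + w\<^sup>2 + C * r\<^sup>2)"
    using mult_right_mono[of "f\<^sup>2" C "r\<^sup>2"] assms by (simp add: power_mult_distrib)
  finally have 2: "K * z\<^sup>2 \<le> 3 * K * (e\<^sup>2 + w\<^sup>2 + C * r\<^sup>2)"
    using K by (simp add: mult_left_mono mult.left_commute mult.assoc)
  have 3: "g * V \<le> g\<^sup>2 + 1/4 * V\<^sup>2"
  proof -
    have "0 \<le> (g - V / 2)\<^sup>2" by simp
    then show ?thesis by (simp add: power2_eq_square field_simps)
  qed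
  have "- (w * X) + f * r * X + g * V + e * X = z * X + g * V" by (simp add: z_def algebra_simps)
  then show ?thesis using 1 2 3 by linarith
qed

text \<open>Testing with the time derivative itself; by the inverse inequality the gradient of the test
  function can be absorbed. This is what makes the time derivative square integrable.\<close>
lemma (in fe_time_slice) rate_estimate:
  assumes d: "(\<Sum>p<P. d p) = 0" and p: "p < P" and C: "0 \<le> C"
  shows "(d p)\<^sup>2 \<le> rate_const L P x C *
    ((LINT y|Om L. (g y)\<^sup>2) + (LINT y|Om L. (e y)\<^sup>2) + (\<Sum>q<P. (A q)\<^sup>2))"
proof -
  define K where "K = inverse_const L P x"
  define s where "s = (\<Sum>p<P. (1 / (x (Suc p) - x p))\<^sup>2)"
  define J where "J = (LINT y|Om L. (ramp_sum x P d y)\<^sup>2)"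
  define N G E where "N = (\<Sum>q<P. (A q)\<^sup>2)" and "G = (LINT y|Om L. (g y)\<^sup>2)" and "E = (LINT y|Om L. (e y)\<^sup>2)"
  have K: "1 \<le> K" and Kd: "(d p)\<^sup>2 \<le> K * J" and KS: "(LINT y|Om L. (slope_sum x P d y)\<^sup>2) \<le> K * J"
    unfolding K_def J_def by (intro inverse_inequality L part p)+
  have nn: "0 \<le> s" "0 \<le> N" "0 \<le> G" "0 \<le> E" "0 \<le> J"
    by (auto simp: s_def N_def G_def E_def J_def intro!: sum_nonneg)
  have "J = (LINT y|Om L. ramp_sum x P d y * ramp_sum x P d y)" by (simp add: J_def power2_eq_square)
  also have "\<dots> \<le> (LINT y|Om L. (g y)\<^sup>2 + 1/4 * (ramp_sum x P d y)\<^sup>2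
      + 3 * K * ((e y)\<^sup>2 + (slope_sum x P A y)\<^sup>2 + C * (ramp_sum x P A y)\<^sup>2) + 1 / (4 * K) * (slope_sum x P d y)\<^sup>2)"
    unfolding tested[OF d]
  proof (rule integral_mono_AE)
    show "AE y in Om L. - (slope_sum x P A y * slope_sum x P d y) + f y * ramp_sum x P A y * slope_sum x P d y
         + g y * ramp_sum x P d y + e y * slope_sum x P d y
       \<le> (g y)\<^sup>2 + 1/4 * (ramp_sum x P d y)\<^sup>2
      + 3 * K * ((e y)\<^sup>2 + (slope_sum x P A y)\<^sup>2 + C * (ramp_sum x P A y)\<^sup>2) + 1 / (4 * K) * (slope_sum x P d y)\<^sup>2"
      using fC by eventually_elim (rule rate_algebra, use K in auto)
  qed (use prods_int sq_int in auto)
  also have "\<dots> = G + 1/4 * J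
      + 3 * K * (E + (LINT y|Om L. (slope_sum x P A y)\<^sup>2) + C * (LINT y|Om L. (ramp_sum x P A y)\<^sup>2))
      + 1 / (4 * K) * (LINT y|Om L. (slope_sum x P d y)\<^sup>2)"
    using sq_int by (simp add: G_def E_def J_def)
  also have "\<dots> \<le> G + 1/4 * J + 3 * K * (E + L * (N * s) + C * (L * (N * real P))) + 1 / (4 * K) * (K * J)"
  proof -
    have "(LINT y|Om L. (slope_sum x P A y)\<^sup>2) \<le> L * (N * s)"
      unfolding N_def s_def by (rule integral_square_bounded) (use L lt in \<open>auto intro!: slope_sum_square_le\<close>)
    moreover have "(LINT y|Om L. (ramp_sum x P A y)\<^sup>2) \<le> L * (N * real P)"
      unfolding N_def by (rule integral_square_bounded) (use L in \<open>auto intro!: ramp_sum_square_le\<close>)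
    ultimately show ?thesis using K C KS
      by (intro add_mono mult_left_mono order_refl) auto
  qed
  also have "1 / (4 * K) * (K * J) = 1/4 * J" using K by simp
  finally have "J \<le> 2 * (G + 3 * K * E + 3 * K * L * (C * real P + s) * N)"
    by (simp add: algebra_simps)
  also have "\<dots> \<le> 2 * ((1 + 3 * K + 3 * K * L * (C * real P + s)) * (G + E + N))"
  proof -
    have "0 \<le> 3 * K * L * (C * real P + s)" "0 \<le> 3 * K" using K L C nn by auto
    then have "0 \<le> 3 * K * G" "0 \<le> 3 * K * N" "0 \<le> 3 * K * L * (C * real P + s) * G" "0 \<le> 3 * K * L * (C * real P + s) * E"
      using nn by (auto intro!: mult_nonneg_nonneg simp del: mult_nonneg_nonneg)
    then show ?thesis using nn by (simp add: distrib_left distrib_right)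
  qed
  finally have "K * J \<le> K * (2 * ((1 + 3 * K + 3 * K * L * (C * real P + s)) * (G + E + N)))"
    using K by (intro mult_left_mono) auto
  then have "(d p)\<^sup>2 \<le> K * (2 * ((1 + 3 * K + 3 * K * L * (C * real P + s)) * (G + E + N)))"
    using Kd by (rule order_trans[rotated])
  moreover have "rate_const L P x C = 2 * K * (1 + 3 * K + 3 * K * L * (C * real P + s))"
    unfolding rate_const_def Let_def K_def s_def ..
  ultimately show ?thesis
    unfolding G_def[symmetric] E_def[symmetric] N_def[symmetric] by (simp only: mult.assoc mult.left_commute[of K 2])
qed

section \<open>The Galerkin solution\<close>

lemma fint_1_diff:
  assumes "integrable lborel d" "integrable lborel e"
  shows "fint 1 (\<lambda>s. d s - e s) t = fint 1 d t - fint 1 e t"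
proof -
  have "integrable lborel (\<lambda>s. indicator {..<t} s * h s)" if "integrable lborel h" for h :: "real \<Rightarrow> real"
    by (rule Bochner_Integration.integrable_bound[OF that])
      (use borel_measurable_integrable[OF that] in \<open>auto simp: indicator_def\<close>)
  then show ?thesis using assms unfolding fint_1 right_diff_distrib by simp
qed

lemma deriv_sum_fint_1:
  assumes w: "\<And>s. s \<in> {0..T} \<Longrightarrow> w s = (\<Sum>p<n. (a p + fint 1 (d p) s) * c p)" and t: "t \<in> {0<..<T}"
    and good: "\<And>p. p < n \<Longrightarrow> (fint 1 (d p) has_real_derivative d p t) (at t)"
  shows "deriv w t = (\<Sum>p<n. d p t * c p)"
proof (rule DERIV_imp_deriv)
  have "((\<lambda>s. \<Sum>p<n. (a p + fint 1 (d p) s) * c p) has_real_derivative (\<Sum>p<n. (0 + d p t) * c p)) (at t)"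
    by (intro DERIV_sum DERIV_cmult_right DERIV_add DERIV_const good) auto
  then have "((\<lambda>s. \<Sum>p<n. (a p + fint 1 (d p) s) * c p) has_real_derivative (\<Sum>p<n. d p t * c p)) (at t)"
    by simp
  then show "(w has_real_derivative (\<Sum>p<n. d p t * c p)) (at t)"
    by (rule has_field_derivative_transform_within_open[where S = "{0<..<T}"]) (use t w in auto)
qed

text \<open>\<open>int\<close> lets \<open>frac_int\<close> be split over the sum. It is required on
  the whole interval because the derivative at t looks at neighbouring times.\<close>

lemma RL_deriv_sum_fint_1:
  assumes w: "\<And>s. s \<in> {0..T} \<Longrightarrow> w s = (\<Sum>p<n. \<delta> p s * c p)" and t: "t \<in> {0<..<T}"
    and int: "\<And>p t. p < n \<Longrightarrow> t \<in> {0..T} \<Longrightarrow> integrable (lebesgue_on {0<..<t}) (\<lambda>s. omega \<alpha> (t - s) * \<delta> p s)"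
    and good: "\<And>p. p < n \<Longrightarrow> (frac_int \<alpha> (\<delta> p) has_real_derivative A p) (at t)"
  shows "RL_deriv \<alpha> w t = (\<Sum>p<n. A p * c p)"
  unfolding RL_deriv_def
proof (rule DERIV_imp_deriv)
  have "((\<lambda>s. \<Sum>p<n. frac_int \<alpha> (\<delta> p) s * c p) has_real_derivative (\<Sum>p<n. A p * c p)) (at t)"
    by (intro DERIV_sum DERIV_cmult_right good) auto
  then show "(frac_int \<alpha> w has_real_derivative (\<Sum>p<n. A p * c p)) (at t)"
  proof (rule has_field_derivative_transform_within_open[where S = "{0<..<T}"])
    fix t assume t: "t \<in> {0<..<T}"
    have "frac_int \<alpha> w t = (LINT s|lebesgue_on {0<..<t}. (\<Sum>p<n. omega \<alpha> (t - s) * \<delta> p s * c p))"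
      unfolding frac_int_def
      by (rule Bochner_Integration.integral_cong) (use t w in \<open>auto simp: sum_distrib_left mult.assoc\<close>)
    also have "\<dots> = (\<Sum>p<n. LINT s|lebesgue_on {0<..<t}. omega \<alpha> (t - s) * \<delta> p s * c p)"
      using int t by (intro Bochner_Integration.integral_sum Bochner_Integration.integrable_mult_left) auto
    finally show "(\<Sum>p<n. frac_int \<alpha> (\<delta> p) t * c p) = frac_int \<alpha> w t"
      by (simp add: frac_int_def)
  qed (use t in auto)
qed

text \<open>Meant for the nodes, where \<open>deriv\<close> of a piecewise linear function carries
  no information.\<close>

lemma L2_inner_cong_off_finite:
  assumes N: "finite N" and eq: "\<And>y. y \<in> {0<..<L} \<Longrightarrow> y \<notin> N \<Longrightarrow> f y * g y = f' y * g' y"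
  shows "L2_inner L f g = (LINT y|Om L. f' y * g' y)"
  unfolding L2_inner_def
proof (rule integral_discrete_difference[where X = "N \<inter> {0<..<L}"])
  show "countable (N \<inter> {0<..<L})" using N by (simp add: countable_finite)
  show "emeasure (Om L) {y} = 0" if "y \<in> N \<inter> {0<..<L}" for y
    using that by (subst emeasure_restrict_space) auto
  show "{y} \<in> sets (Om L)" if "y \<in> N \<inter> {0<..<L}" for y
    using that by (auto simp: sets_restrict_space_iff)
qed (use eq in auto)

lemma L2_norm_square: "(L2_norm L f)\<^sup>2 = (LINT y|Om L. (f y)\<^sup>2)"
  by (simp add: L2_norm_def L2_inner_def power2_eq_square)

text \<open>Reduces the problem to finitely many scalar functions of time, the increments of u
  between nodes. Off one null set all their derivatives exist, and the weak equation becomes a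
  relation between coefficients.\<close>

lemma galerkin_density:
  assumes L: "0 < L" and T: "0 < T" and part: "partition_of L P x" and \<alpha>: "0 < \<alpha>"
    and u0: "u0 \<in> S_h L P x" and sol: "Galerkin_solution \<alpha> L T P x F g gs u0 u"
  defines "a \<equiv> \<lambda>p. u0 (x (Suc p)) - u0 (x p)"
  obtains d where "\<And>p. d p \<in> borel_measurable borel" "\<And>p. integrable lborel (d p)"
    "\<And>p s. s \<notin> {0<..<T} \<Longrightarrow> d p s = 0"
    "\<And>t y. t \<in> {0..T} \<Longrightarrow> y \<in> {0..L} \<Longrightarrow> u t y - u0 y = ramp_sum x P (\<lambda>p. fint 1 (d p) t) y"
    "AE t in lborel. t \<in> {0<..<T} \<longrightarrow> (\<Sum>p<P. d p t) = 0 \<and> (\<Sum>p<P. fint \<alpha> (d p) t) = 0 \<and>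
      tested_equation L P x (F t) (g t) (gs t) (\<lambda>p. d p t) (\<lambda>p. a p * kern \<alpha> t + fint \<alpha> (d p) t)"
proof -
  have uS: "u t \<in> S_h L P x" if "t \<in> {0..T}" for t using sol that by (simp add: Galerkin_solution_def)
  have uini: "u 0 y = u0 y" if "y \<in> {0..L}" for y using sol that by (simp add: Galerkin_solution_def)
  have node: "x p \<in> {0..L}" if "p \<le> P" for p using partition_bounds[OF part that] by simp
  \<comment> \<open>Density 0 beyond P makes the chosen family measurable and integrable at every
    index.\<close>
  have "\<forall>p. \<exists>e. e \<in> borel_measurable borel \<and> integrable lborel e \<and> (\<forall>s. s \<notin> {0<..<T} \<longrightarrow> e s = 0) \<and>
      (p \<le> P \<longrightarrow> (\<forall>t\<in>{0..T}. u t (x p) = u0 (x p) + fint 1 e t))"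
  proof
    fix p
    show "\<exists>e. e \<in> borel_measurable borel \<and> integrable lborel e \<and> (\<forall>s. s \<notin> {0<..<T} \<longrightarrow> e s = 0) \<and>
      (p \<le> P \<longrightarrow> (\<forall>t\<in>{0..T}. u t (x p) = u0 (x p) + fint 1 e t))"
    proof (cases "p \<le> P")
      case True
      then have "abs_cont T (\<lambda>t. u t (x p))" using sol node[OF True] by (simp add: Galerkin_solution_def)
      then obtain e where "e \<in> borel_measurable borel" "integrable lborel e"
        "\<And>s. s \<notin> {0<..<T} \<Longrightarrow> e s = 0" "\<And>t. t \<in> {0..T} \<Longrightarrow> u t (x p) = u 0 (x p) + fint 1 e t"
        by (rule abs_cont_density) blast
      then show ?thesis using uini[OF node[OF True]] by (intro exI[of _ e]) auto
    qed (auto intro!: exI[of _ "\<lambda>_. 0"])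
  qed
  then obtain e where e: "\<And>p. e p \<in> borel_measurable borel" "\<And>p. integrable lborel (e p)"
      "\<And>p s. s \<notin> {0<..<T} \<Longrightarrow> e p s = 0"
      "\<And>p t. p \<le> P \<Longrightarrow> t \<in> {0..T} \<Longrightarrow> u t (x p) = u0 (x p) + fint 1 (e p) t"
    by metis
  define d where "d p s = e (Suc p) s - e p s" for p s
  define \<delta> where "\<delta> p t = u t (x (Suc p)) - u t (x p)" for p t
  have d [measurable]: "d p \<in> borel_measurable borel" for p
    using e(1) unfolding d_def[abs_def] by simp
  have di: "integrable lborel (d p)" for p using e(2) unfolding d_def[abs_def] by simp
  have d0: "d p s = 0" if "s \<notin> {0<..<T}" for p s using e(3) that by (simp add: d_def)
  have d0': "d p s = 0" if "s \<le> 0" for p s using d0 that by simp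
  have \<delta>: "\<delta> p t = a p + fint 1 (d p) t" if "p < P" "t \<in> {0..T}" for p t
    using e(4)[of p t] e(4)[of "Suc p" t] that
    by (simp add: \<delta>_def a_def d_def[abs_def] fint_1_diff e(2))
  have u_eq: "u t y = (\<Sum>p<P. \<delta> p t * ramp x p y)" if "t \<in> {0..T}" "y \<in> {0..L}" for t y
    unfolding \<delta>_def by (rule S_h_expansion[OF part uS[OF that(1)] that(2)])
  have u0_eq: "u0 y = (\<Sum>p<P. a p * ramp x p y)" if "y \<in> {0..L}" for y
    unfolding a_def by (rule S_h_expansion[OF part u0 that])
  have int: "integrable (lebesgue_on {0<..<t}) (\<lambda>s. omega \<alpha> (t - s) * \<delta> p s)" if "p < P" "t \<in> {0..T}" for p t
    by (rule frac_int_density(1)[OF d di d0' \<alpha> \<delta>[OF that(1)] that(2)])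
  have "AE t in lborel. \<forall>p\<in>{..<P}. t \<in> {0<..<T} \<longrightarrow> (fint 1 (d p) has_real_derivative d p t) (at t)"
    by (rule AE_finite_allI) (simp, rule AE_DERIV_fint_1[OF d di d0'])
  moreover have "AE t in lborel. \<forall>p\<in>{..<P}. t \<in> {0<..<T} \<longrightarrow>
      (frac_int \<alpha> (\<delta> p) has_real_derivative a p * kern \<alpha> t + fint \<alpha> (d p) t) (at t)"
  proof (rule AE_finite_allI)
    fix p assume "p \<in> {..<P}"
    then show "AE t in lborel. t \<in> {0<..<T} \<longrightarrow>
      (frac_int \<alpha> (\<delta> p) has_real_derivative a p * kern \<alpha> t + fint \<alpha> (d p) t) (at t)"
      by (intro AE_DERIV_frac_int d di d0' \<alpha> \<delta>) auto
  qed simp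
  moreover have "AE t in lborel. t \<in> {0<..<T} \<longrightarrow> (\<forall>v \<in> S_h L P x.
        L2_inner L (\<lambda>y. deriv (\<lambda>s. u s y) t) v
        + L2_inner L (\<lambda>y. RL_deriv \<alpha> (\<lambda>s. deriv (u s) y) t) (deriv v)
        - L2_inner L (\<lambda>y. F t y * RL_deriv \<alpha> (\<lambda>s. u s y) t) (deriv v)
        = L2_inner L (g t) v + L2_inner L (gs t) (deriv v))"
    using sol unfolding Galerkin_solution_def by (simp add: AE_restrict_space_iff AE_completion_iff)
  ultimately have "AE t in lborel. t \<in> {0<..<T} \<longrightarrow> (\<Sum>p<P. d p t) = 0 \<and> (\<Sum>p<P. fint \<alpha> (d p) t) = 0 \<and>
      tested_equation L P x (F t) (g t) (gs t) (\<lambda>p. d p t) (\<lambda>p. a p * kern \<alpha> t + fint \<alpha> (d p) t)"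
  proof eventually_elim
    case (elim t)
    show ?case
    proof
      assume t: "t \<in> {0<..<T}"
      define A where "A p = a p * kern \<alpha> t + fint \<alpha> (d p) t" for p
      note g1 = elim(1)[rule_format, OF _ t] and g2 = elim(2)[rule_format, OF _ t, folded A_def] and gal = elim(3)[rule_format, OF t, rule_format]
      have D1: "deriv w t = (\<Sum>p<P. d p t * c p)" if "\<And>s. s \<in> {0..T} \<Longrightarrow> w s = (\<Sum>p<P. \<delta> p s * c p)" for w c
        by (rule deriv_sum_fint_1[where a = a and T = T]) (use that \<delta> t g1 in auto)
      have D2: "RL_deriv \<alpha> w t = (\<Sum>p<P. A p * c p)" if "\<And>s. s \<in> {0..T} \<Longrightarrow> w s = (\<Sum>p<P. \<delta> p s * c p)" for w c
        by (rule RL_deriv_sum_fint_1[where \<delta> = \<delta> and T = T]) (use that int t g2 in auto)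
      have sum0: "(\<Sum>p<P. \<delta> p s * 1) = 0" if "s \<in> {0..T}" for s
        using S_h_increments_sum[OF part uS[OF that]] by (simp add: \<delta>_def)
      have a0: "(\<Sum>p<P. a p) = 0"
        using S_h_increments_sum[OF part u0] by (simp add: a_def)
      \<comment> \<open>The increments of u sum to zero at all times. Differentiating this identity
        (\<open>D1\<close> for the zero function and c = 1) makes the time derivative an admissible
        test function; \<open>D2\<close> does the same for I^\<alpha> w'.\<close>
      have sd: "(\<Sum>p<P. d p t) = 0"
        using D1[of "\<lambda>_. 0" "\<lambda>_. 1"] sum0 by simp
      have z: "frac_int \<alpha> (\<lambda>_. 0) = (\<lambda>_. 0)" by (simp add: frac_int_def[abs_def])
      have "(\<Sum>p<P. A p) = 0"
        using D2[of "\<lambda>_. 0" "\<lambda>_. 1"] sum0 by (simp add: RL_deriv_def z)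
      moreover have "(\<Sum>p<P. A p) = (\<Sum>p<P. a p) * kern \<alpha> t + (\<Sum>p<P. fint \<alpha> (d p) t)"
        by (simp add: A_def sum.distrib sum_distrib_right)
      ultimately have sD: "(\<Sum>p<P. fint \<alpha> (d p) t) = 0" using a0 by simp
      let ?N = "x ` {..P}"
      have N: "finite ?N" by simp
      have e1: "deriv (\<lambda>s. u s y) t = ramp_sum x P (\<lambda>p. d p t) y" if "y \<in> {0<..<L}" for y
        unfolding ramp_sum_def by (rule D1) (use that u_eq in auto)
      have e2: "RL_deriv \<alpha> (\<lambda>s. u s y) t = ramp_sum x P A y" if "y \<in> {0<..<L}" for y
        unfolding ramp_sum_def by (rule D2) (use that u_eq in auto)
      \<comment> \<open>Off the nodes, the spatial derivative of u is the slope combination at all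
        times s simultaneously, so it can be inserted before the fractional derivative in time is
        taken.\<close>
      have e3: "RL_deriv \<alpha> (\<lambda>s. deriv (u s) y) t = slope_sum x P A y" if "y \<in> {0<..<L}" "y \<notin> ?N" for y
        unfolding slope_sum_def by (rule D2, rule deriv_ramp_sum[OF part that]) (use u_eq in auto)
      have "tested_equation L P x (F t) (g t) (gs t) (\<lambda>p. d p t) A"
        unfolding tested_equation_def
      proof (intro allI impI)
        fix v :: "nat \<Rightarrow> real" assume v: "(\<Sum>p<P. v p) = 0"
        let ?v = "ramp_sum x P v"
        have vS: "?v \<in> S_h L P x"
          using ramp_sum_in_S_h[OF part L v] unfolding ramp_sum_def[abs_def] .
        have dv: "deriv ?v y = slope_sum x P v y" if "y \<in> {0<..<L}" "y \<notin> ?N" for y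
          unfolding slope_sum_def by (rule deriv_ramp_sum[OF part that]) (simp add: ramp_sum_def)
        have "L2_inner L (\<lambda>y. deriv (\<lambda>s. u s y) t) ?v = (LINT y|Om L. ramp_sum x P (\<lambda>p. d p t) y * ?v y)"
          by (rule L2_inner_cong_off_finite[OF N]) (simp add: e1)
        moreover have "L2_inner L (\<lambda>y. RL_deriv \<alpha> (\<lambda>s. deriv (u s) y) t) (deriv ?v)
            = (LINT y|Om L. slope_sum x P A y * slope_sum x P v y)"
          by (rule L2_inner_cong_off_finite[OF N]) (simp add: e3 dv)
        moreover have "L2_inner L (\<lambda>y. F t y * RL_deriv \<alpha> (\<lambda>s. u s y) t) (deriv ?v)
            = (LINT y|Om L. (F t y * ramp_sum x P A y) * slope_sum x P v y)"
          by (rule L2_inner_cong_off_finite[OF N]) (simp add: e2 dv)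
        moreover have "L2_inner L (gs t) (deriv ?v) = (LINT y|Om L. gs t y * slope_sum x P v y)"
          by (rule L2_inner_cong_off_finite[OF N]) (simp add: dv)
        moreover have "L2_inner L (g t) ?v = (LINT y|Om L. g t y * ?v y)" by (simp add: L2_inner_def)
        ultimately show "(LINT y|Om L. ramp_sum x P (\<lambda>p. d p t) y * ?v y)
          + (LINT y|Om L. slope_sum x P A y * slope_sum x P v y)
          - (LINT y|Om L. (F t y * ramp_sum x P A y) * slope_sum x P v y)
          = (LINT y|Om L. g t y * ?v y) + (LINT y|Om L. gs t y * slope_sum x P v y)"
          using gal[OF vS] by (simp only:)
      qed
      then show "(\<Sum>p<P. d p t) = 0 \<and> (\<Sum>p<P. fint \<alpha> (d p) t) = 0 \<and>
      tested_equation L P x (F t) (g t) (gs t) (\<lambda>p. d p t) (\<lambda>p. a p * kern \<alpha> t + fint \<alpha> (d p) t)"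
        using sd sD unfolding A_def[abs_def] by blast
    qed
  qed
  note ae = this
  have repr: "u t y - u0 y = ramp_sum x P (\<lambda>p. fint 1 (d p) t) y" if "t \<in> {0..T}" "y \<in> {0..L}" for t y
  proof -
    have "u t y - u0 y = (\<Sum>p<P. (\<delta> p t - a p) * ramp x p y)"
      using u_eq[OF that] u0_eq[OF that(2)] by (simp add: sum_subtractf left_diff_distrib)
    also have "\<dots> = ramp_sum x P (\<lambda>p. fint 1 (d p) t) y"
      unfolding ramp_sum_def by (intro sum.cong) (use \<delta>[OF _ that(1)] in auto)
    finally show ?thesis .
  qed
  show thesis by (rule that[OF d di d0 repr ae])
qed

lemma nfint_1_kern_square:
  assumes a: "1/2 < a" "a \<le> 1" and t: "0 < t"
  shows "nfint 1 (\<lambda>s. ennreal ((kern a s)\<^sup>2)) t \<le> ennreal (t powr (2 * a - 1) / (2 * a - 1))"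
proof -
  define c where "c = Gamma (2 * a - 1) / (Gamma a)\<^sup>2"
  have c: "0 \<le> c" using a by (auto simp: c_def intro!: divide_nonneg_nonneg Gamma_real_nonneg)
  have "nfint 1 (\<lambda>s. ennreal ((kern a s)\<^sup>2)) t = nfint 1 (\<lambda>s. ennreal c * ennreal (kern (2 * a - 1) s)) t"
    using kern_square[OF a(1)] a c by (simp add: c_def[symmetric] ennreal_mult)
  also have "\<dots> = ennreal (c * kern (2 * a) t)"
    using a c by (simp add: nfint_cmult nfint_kern ennreal_mult)
  also have "\<dots> \<le> ennreal (t powr (2 * a - 1) / (2 * a - 1))"
    unfolding c_def using a t by (intro ennreal_leI kern_square_bound) auto
  finally show ?thesis .
qed

text \<open>Young's inequality \<open>L\<^sup>1 * L\<^sup>2 \<subseteq> L\<^sup>2\<close>; this is where \<open>\<alpha> > 1/2\<close> enters.\<close>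
lemma nfint_1_fint_square_finite:
  assumes [measurable]: "d \<in> borel_measurable borel" and d: "integrable lborel d"
    and d0: "\<And>s. s \<le> 0 \<Longrightarrow> d s = 0" and a: "1/2 < a"
  shows "nfint 1 (\<lambda>r. ennreal ((fint a d r)\<^sup>2)) t < \<infinity>"
proof -
  define c where "c = Gamma (2 * a - 1) / (Gamma a)\<^sup>2"
  have c: "0 \<le> c" using a by (auto simp: c_def intro!: divide_nonneg_nonneg Gamma_real_nonneg)
  define n where "n = (\<integral>\<^sup>+s. ennreal \<bar>d s\<bar> \<partial>lborel)"
  have n: "n < \<infinity>" using d unfolding n_def integrable_iff_bounded by simp
  have "ennreal ((fint a d r)\<^sup>2) \<le> n * (ennreal c * nfint (2 * a - 1) (\<lambda>s. ennreal \<bar>d s\<bar>) r)" for r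
  proof -
    have "ennreal ((fint a d r)\<^sup>2) = (ennreal \<bar>fint a d r\<bar>)\<^sup>2" by (simp add: ennreal_power)
    also have "\<dots> \<le> (nfint a (\<lambda>s. ennreal \<bar>d s\<bar>) r)\<^sup>2"
      using a by (intro power_mono abs_fint_le) auto
    \<comment> \<open>Cauchy-Schwarz for the measure |d s| ds: one factor is the L1 norm of d, the
      other carries the squared kernel, a multiple of \<open>kern (2 * a - 1)\<close>.\<close>
    also have "nfint a (\<lambda>s. ennreal \<bar>d s\<bar>) r
      = (\<integral>\<^sup>+s. ennreal (sqrt \<bar>d s\<bar>) * ennreal (kern a (r - s) * sqrt \<bar>d s\<bar>) \<partial>lborel)"
    proof -
      have "sqrt \<bar>d s\<bar> * (kern a (r - s) * sqrt \<bar>d s\<bar>) = kern a (r - s) * \<bar>d s\<bar>" for s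
        using real_sqrt_mult_self[of "d s"] by (simp add: mult.left_commute)
      then have "ennreal (sqrt \<bar>d s\<bar>) * ennreal (kern a (r - s) * sqrt \<bar>d s\<bar>) = ennreal (kern a (r - s)) * ennreal \<bar>d s\<bar>" for s
        using a by (subst (1 2) ennreal_mult[symmetric]) auto
      then show ?thesis unfolding nfint_def by simp
    qed
    also have "\<dots>\<^sup>2 \<le> (\<integral>\<^sup>+s. (ennreal (sqrt \<bar>d s\<bar>))\<^sup>2 \<partial>lborel) * (\<integral>\<^sup>+s. (ennreal (kern a (r - s) * sqrt \<bar>d s\<bar>))\<^sup>2 \<partial>lborel)"
      by (intro Cauchy_Schwarz_nn_integral) measurable
    also have "(\<integral>\<^sup>+s. (ennreal (sqrt \<bar>d s\<bar>))\<^sup>2 \<partial>lborel) = n" by (simp add: n_def ennreal_power)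
    also have "(\<integral>\<^sup>+s. (ennreal (kern a (r - s) * sqrt \<bar>d s\<bar>))\<^sup>2 \<partial>lborel)
       = (\<integral>\<^sup>+s. ennreal c * (ennreal (kern (2 * a - 1) (r - s)) * ennreal \<bar>d s\<bar>) \<partial>lborel)"
      using a c by (intro nn_integral_cong)
        (simp add: ennreal_power power_mult_distrib kern_square c_def[symmetric] ennreal_mult[symmetric] mult.assoc)
    also have "\<dots> = ennreal c * nfint (2 * a - 1) (\<lambda>s. ennreal \<bar>d s\<bar>) r"
      unfolding nfint_def by (rule nn_integral_cmult) measurable
    finally show ?thesis .
  qed
  then have "nfint 1 (\<lambda>r. ennreal ((fint a d r)\<^sup>2)) t
    \<le> nfint 1 (\<lambda>r. n * (ennreal c * nfint (2 * a - 1) (\<lambda>s. ennreal \<bar>d s\<bar>) r)) t"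
    by (intro nfint_mono)
  also have "\<dots> = n * (ennreal c * nfint (1 + (2 * a - 1)) (\<lambda>s. ennreal \<bar>d s\<bar>) t)"
    using a by (simp add: nfint_cmult nfint_nfint)
  also have "\<dots> < \<infinity>"
    using n nfint_1_plus_finite[OF assms(1) d d0, of "2 * a - 1" t] a by (simp add: ennreal_mult_less_top)
  finally show ?thesis .
qed

lemma H1_norm_S_h:
  assumes part: "partition_of L P x" and v: "v \<in> S_h L P x"
  defines "a \<equiv> \<lambda>p. v (x (Suc p)) - v (x p)"
  shows "(H1_norm L v)\<^sup>2 = (LINT y|Om L. (ramp_sum x P a y)\<^sup>2) + (LINT y|Om L. (slope_sum x P a y)\<^sup>2)"
proof -
  have v_eq: "v y = (\<Sum>p<P. a p * ramp x p y)" if "y \<in> {0..L}" for y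
    unfolding a_def by (rule S_h_expansion[OF part v that])
  have "(L2_norm L f)\<^sup>2 = (LINT y|Om L. (f' y)\<^sup>2)"
    if "\<And>y. y \<in> {0<..<L} \<Longrightarrow> y \<notin> x ` {..P} \<Longrightarrow> f y = f' y" for f f'
  proof -
    have eq: "L2_inner L f f = (LINT y|Om L. f' y * f' y)"
      by (rule L2_inner_cong_off_finite[where N = "x ` {..P}"]) (use that in auto)
    then have "0 \<le> L2_inner L f f" by simp
    then show ?thesis using eq by (simp add: L2_norm_def power2_eq_square)
  qed
  from this[of v "ramp_sum x P a"] this[of "deriv v" "slope_sum x P a"] show ?thesis
    unfolding H1_norm_def using deriv_ramp_sum[OF part _ _ v_eq] v_eq
    by (simp add: ramp_sum_def slope_sum_def)
qed

text \<open>Stated in \<open>ennreal\<close> because g and \<open>gs\<close> are only integrable in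
  time with values in L2, so the integral of their squared norms may be infinite.\<close>

theorem theorem3p3:
  fixes L T \<alpha> C_F :: real
    and P :: nat and x :: "nat \<Rightarrow> real"
    and F g gs u_h :: "real \<Rightarrow> real \<Rightarrow> real"
    and u0h :: "real \<Rightarrow> real"
  assumes "0 < L" and "0 < T"
    and "partition_of L P x"
    and "F \<in> W1inf_Linf L T"
    and "g \<in> Bochner_L1 T (L2_space L) (L2_norm L)"
    and "gs \<in> Bochner_L1 T (L2_space L) (L2_norm L)"
    and "AE t in lebesgue_on {0<..<T}. AE y in lebesgue_on {0<..<L}. 1 + (F t y)\<^sup>2 \<le> C_F"
    and "1/2 < \<alpha>" and "\<alpha> < 1"
    and "u0h \<in> S_h L P x"
    and "Galerkin_solution \<alpha> L T P x F g gs u0h u_h"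
  shows "\<forall>t\<in>{0..T}.
    ennreal ((L2_norm L (\<lambda>y. u_h t y - u0h y))\<^sup>2)
    \<le> ennreal (Mittag_Leffler (\<alpha>/2) (5/8 * C_F * t powr \<alpha> / (1 - \<alpha>)) / (1 - \<alpha>)\<^sup>2)
      * (ennreal (t powr (1 - \<alpha>))
           * (\<integral>\<^sup>+ s. ennreal (1/2 * (L2_norm L (g s))\<^sup>2 + (L2_norm L (gs s))\<^sup>2)
                \<partial>lebesgue_on {0<..<t})
         + ennreal (C_F * t powr \<alpha> / (2 * \<alpha> - 1) * (H1_norm L u0h)\<^sup>2))"
proof
  fix t assume "t \<in> {0..T}"
  note L = assms(1) and T = assms(2) and part = assms(3) and \<alpha> = assms(8,9) and u0 = assms(10) and sol = assms(11)
  define H where "H = (H1_norm L u0h)\<^sup>2"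
  define I where "I = (\<integral>\<^sup>+ s. ennreal (1/2 * (L2_norm L (g s))\<^sup>2 + (L2_norm L (gs s))\<^sup>2) \<partial>lebesgue_on {0<..<t})"
  define m where "m = Mittag_Leffler (\<alpha>/2) (5/8 * C_F * t powr \<alpha> / (1 - \<alpha>)) / (1 - \<alpha>)\<^sup>2"
  define a where "a p = u0h (x (Suc p)) - u0h (x p)" for p
  have H: "H = (LINT y|Om L. (ramp_sum x P a y)\<^sup>2) + (LINT y|Om L. (slope_sum x P a y)\<^sup>2)"
    unfolding H_def a_def[abs_def] by (rule H1_norm_S_h[OF part u0])
  have H0: "0 \<le> H" by (simp add: H_def)
  \<comment> \<open>Both intervals have positive measure, so an inequality that fails everywhere
    cannot hold almost everywhere.\<close>
  have C0: "0 \<le> C_F"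
  proof (rule ccontr)
    assume "\<not> 0 \<le> C_F"
    then have "\<not> 1 + z\<^sup>2 \<le> C_F" for z :: real using zero_le_power2[of z] by linarith
    then have "AE s in lebesgue_on {0<..<T}. AE y in Om L. False" using assms(7) by simp
    moreover have "\<not> (AE y in Om L. False)"
      using L by (simp add: eventually_False ae_filter_eq_bot_iff emeasure_restrict_space)
    ultimately have "AE s in lebesgue_on {0<..<T}. False" by simp
    then show False using T by (simp add: eventually_False ae_filter_eq_bot_iff emeasure_restrict_space)
  qed
  obtain d where d [measurable]: "\<And>p. d p \<in> borel_measurable borel" and di: "\<And>p. integrable lborel (d p)"
    and d0: "\<And>p s. s \<notin> {0<..<T} \<Longrightarrow> d p s = 0"
    and repr: "\<And>t y. t \<in> {0..T} \<Longrightarrow> y \<in> {0..L} \<Longrightarrow> u_h t y - u0h y = ramp_sum x P (\<lambda>p. fint 1 (d p) t) y"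
    and ae: "AE t in lborel. t \<in> {0<..<T} \<longrightarrow> (\<Sum>p<P. d p t) = 0 \<and> (\<Sum>p<P. fint \<alpha> (d p) t) = 0 \<and>
      tested_equation L P x (F t) (g t) (gs t) (\<lambda>p. d p t) (\<lambda>p. a p * kern \<alpha> t + fint \<alpha> (d p) t)"
    by (rule galerkin_density[OF L T part _ u0 sol, folded a_def]) (use \<alpha> in auto)
  have d0': "d p s = 0" if "s \<le> 0" for p s using d0 that by simp
  have lhs: "ennreal ((L2_norm L (\<lambda>y. u_h t y - u0h y))\<^sup>2)
      = (\<integral>\<^sup>+y. ennreal ((\<Sum>p<P. fint 1 (d p) t * ramp x p y)\<^sup>2) \<partial>Om L)"
  proof -
    have "(L2_norm L (\<lambda>y. u_h t y - u0h y))\<^sup>2 = (LINT y|Om L. (ramp_sum x P (\<lambda>p. fint 1 (d p) t) y)\<^sup>2)"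
      unfolding L2_norm_square by (rule Bochner_Integration.integral_cong) (use repr \<open>t \<in> {0..T}\<close> in auto)
    also have "ennreal \<dots> = (\<integral>\<^sup>+y. ennreal ((ramp_sum x P (\<lambda>p. fint 1 (d p) t) y)\<^sup>2) \<partial>Om L)"
      by (rule nn_integral_eq_integral[symmetric])
        (auto intro!: integrable_square_bounded ramp_sum_square_le)
    finally show ?thesis by (simp add: ramp_sum_def)
  qed
  have "0 < m"
    using Mittag_Leffler_ge_1[of "\<alpha>/2" "5/8 * C_F * t powr \<alpha> / (1 - \<alpha>)"] \<alpha> C0
    unfolding m_def by (intro divide_pos_pos) auto
  have "ennreal ((L2_norm L (\<lambda>y. u_h t y - u0h y))\<^sup>2)
      \<le> ennreal m * (ennreal (t powr (1 - \<alpha>)) * I + ennreal (C_F * t powr \<alpha> / (2 * \<alpha> - 1) * H))"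
  proof -
    consider "t = 0" | "0 < t" "I = \<infinity>" | "0 < t" "I < \<infinity>"
      using \<open>t \<in> {0..T}\<close> by (cases "t = 0"; cases "I = \<infinity>") (auto simp: less_top)
    then show ?thesis
    proof cases
      case 1
      have "fint 1 (d p) t = 0" for p
        using d0' 1 by (intro fint_eq_0) auto
      then show ?thesis unfolding lhs by simp
    next
      case 2
      then show ?thesis using \<open>0 < m\<close> by (simp add: ennreal_mult_top)
    next
      case 3
      note t = \<open>0 < t\<close>
      have tT: "t \<le> T" using \<open>t \<in> {0..T}\<close> by simp
      have gint: "integrable (lebesgue_on {0<..<T}) (\<lambda>s. L2_norm L (g s))"
          "integrable (lebesgue_on {0<..<T}) (\<lambda>s. L2_norm L (gs s))"
        using assms(5,6) by (auto simp: Bochner_L1_def)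
      obtain G where G [measurable]: "G \<in> borel_measurable borel"
        and Gae: "AE s in lborel. s \<in> {0<..<T} \<longrightarrow> G s = L2_norm L (g s)"
        using lebesgue_on_borel_version[OF gint(1)] by blast
      obtain E where E [measurable]: "E \<in> borel_measurable borel"
        and Eae: "AE s in lborel. s \<in> {0<..<T} \<longrightarrow> E s = L2_norm L (gs s)"
        using lebesgue_on_borel_version[OF gint(2)] by blast
      define \<gamma> where "\<gamma> r = 1/2 * (G r)\<^sup>2 + (E r)\<^sup>2" for r
      have [measurable]: "\<gamma> \<in> borel_measurable borel" unfolding \<gamma>_def[abs_def] by measurable
      have \<gamma>0: "0 \<le> \<gamma> r" for r by (simp add: \<gamma>_def)
      have I_eq: "I = (\<integral>\<^sup>+r. ennreal (\<gamma> r) * indicator {0<..<t} r \<partial>lborel)"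
      proof -
        have "I = (\<integral>\<^sup>+ s. ennreal (1/2 * (L2_norm L (g s))\<^sup>2 + (L2_norm L (gs s))\<^sup>2) * indicator {0<..<t} s \<partial>lborel)"
          unfolding I_def by (simp add: nn_integral_restrict_space nn_integral_completion)
        also have "\<dots> = (\<integral>\<^sup>+r. ennreal (\<gamma> r) * indicator {0<..<t} r \<partial>lborel)"
        proof (rule nn_integral_cong_AE)
          show "AE s in lborel. ennreal (1/2 * (L2_norm L (g s))\<^sup>2 + (L2_norm L (gs s))\<^sup>2) * indicator {0<..<t} s
            = ennreal (\<gamma> s) * indicator {0<..<t} s"
            using Gae Eae by eventually_elim (use tT in \<open>auto simp: \<gamma>_def indicator_def\<close>)
        qed
        finally show ?thesis .
      qed
      \<comment> \<open>The term with H is the initial value's share: the fractional derivative of a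
        constant is that constant times \<open>kern \<alpha>\<close>.\<close>
      define \<beta> where "\<beta> r = ennreal ((kern \<alpha> r)\<^sup>2 * C_F * H + \<gamma> r) * indicator {0<..<t} r" for r
      have [measurable]: "\<beta> \<in> borel_measurable borel" unfolding \<beta>_def[abs_def] by measurable
      have slice: "AE r in lborel. r \<in> {0<..<t} \<longrightarrow> (\<Sum>p<P. d p r) = 0 \<and> (\<Sum>p<P. fint \<alpha> (d p) r) = 0
          \<and> 1/2 * (LINT y|Om L. (g r y)\<^sup>2) + (LINT y|Om L. (gs r y)\<^sup>2) = \<gamma> r
          \<and> fe_time_slice L P x C_F (F r) (g r) (gs r) (\<lambda>p. d p r) (\<lambda>p. a p * kern \<alpha> r + fint \<alpha> (d p) r)"
      proof -
        have 1: "AE r in lborel. r \<in> {0<..<T} \<longrightarrow> F r \<in> Linf_space L"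
          using assms(4) by (simp add: W1inf_Linf_def Bochner_Linf_def strongly_measurable_def AE_restrict_space_iff AE_completion_iff)
        have 2: "AE r in lborel. r \<in> {0<..<T} \<longrightarrow> g r \<in> L2_space L"
          using assms(5) by (simp add: Bochner_L1_def strongly_measurable_def AE_restrict_space_iff AE_completion_iff)
        have 3: "AE r in lborel. r \<in> {0<..<T} \<longrightarrow> gs r \<in> L2_space L"
          using assms(6) by (simp add: Bochner_L1_def strongly_measurable_def AE_restrict_space_iff AE_completion_iff)
        have 4: "AE r in lborel. r \<in> {0<..<T} \<longrightarrow> (AE y in Om L. 1 + (F r y)\<^sup>2 \<le> C_F)"
          using AE_restrict_space_iff[of "{0<..<T}" lebesgue "\<lambda>r. AE y in Om L. 1 + (F r y)\<^sup>2 \<le> C_F"] assms(7)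
          by (simp add: AE_completion_iff)
        show ?thesis
          using 1 2 3 4 ae Gae Eae
        proof eventually_elim
          case (elim r)
          show ?case
          proof
            assume r: "r \<in> {0<..<t}"
            then have rT: "r \<in> {0<..<T}" using tT by auto
            note e = elim[rule_format, OF rT]
            have "fe_time_slice L P x C_F (F r) (g r) (gs r) (\<lambda>p. d p r) (\<lambda>p. a p * kern \<alpha> r + fint \<alpha> (d p) r)"
              by unfold_locales (use e L part in \<open>auto simp: Linf_space_def\<close>)
            then show "(\<Sum>p<P. d p r) = 0 \<and> (\<Sum>p<P. fint \<alpha> (d p) r) = 0
              \<and> 1/2 * (LINT y|Om L. (g r y)\<^sup>2) + (LINT y|Om L. (gs r y)\<^sup>2) = \<gamma> r
              \<and> fe_time_slice L P x C_F (F r) (g r) (gs r) (\<lambda>p. d p r) (\<lambda>p. a p * kern \<alpha> r + fint \<alpha> (d p) r)"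
              using e by (simp add: \<gamma>_def L2_norm_square)
          qed
        qed
      qed
      \<comment> \<open>Square integrability of the data is known only up to t, so the densities are
        cut off there; by causality the fractional integrals up to t are unchanged.\<close>
      define f where "f p r = indicator {0<..<t} r * d p r" for p r
      have [measurable]: "f p \<in> borel_measurable borel" for p unfolding f_def[abs_def] by measurable
      have fint_f: "fint c (f p) r = fint c (d p) r" if "r \<le> t" for c p r
        by (rule fint_cong) (use that d0' in \<open>auto simp: f_def indicator_def\<close>)
      have f2: "integrable lborel (\<lambda>r. (f p r)\<^sup>2)" if p: "p < P" for p
      proof -
        define K where "K = rate_const L P x C_F"
        \<comment> \<open>Majorant for \<open>rate_estimate\<close>: the 2 before \<gamma> undoes
          its factor 1/2 at the norm of g, and the squared coefficients are split by (a + b)^2 \<le>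
          2 a^2 + 2 b^2.\<close>
        define B where "B r = 2 * \<gamma> r + (\<Sum>q<P. 2 * (a q)\<^sup>2 * (kern \<alpha> r)\<^sup>2 + 2 * (fint \<alpha> (d q) r)\<^sup>2)" for r
        have fin1: "integrable lborel (\<lambda>r. indicator {0<..<t} r * \<gamma> r)"
        proof (rule integrableI_nonneg)
          have "(\<integral>\<^sup>+r. ennreal (indicator {0<..<t} r * \<gamma> r) \<partial>lborel) = I"
            unfolding I_eq by (intro nn_integral_cong) (auto simp: indicator_def)
          then show "(\<integral>\<^sup>+r. ennreal (indicator {0<..<t} r * \<gamma> r) \<partial>lborel) < \<infinity>" using 3 by simp
        qed (use \<gamma>0 in auto)
        have fin': "integrable lborel (\<lambda>r. indicator {0<..<t} r * (h r)\<^sup>2)"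
          if [measurable]: "h \<in> borel_measurable borel" and "nfint 1 (\<lambda>r. ennreal ((h r)\<^sup>2)) t < \<infinity>" for h :: "real \<Rightarrow> real"
        proof (rule integrableI_nonneg)
          have "(\<integral>\<^sup>+r. ennreal (indicator {0<..<t} r * (h r)\<^sup>2) \<partial>lborel) \<le> nfint 1 (\<lambda>r. ennreal ((h r)\<^sup>2)) t"
            unfolding nfint_1 by (intro nn_integral_mono) (auto simp: indicator_def)
          then show "(\<integral>\<^sup>+r. ennreal (indicator {0<..<t} r * (h r)\<^sup>2) \<partial>lborel) < \<infinity>"
            using that(2) by (rule le_less_trans)
        qed auto
        have fin2: "integrable lborel (\<lambda>r. indicator {0<..<t} r * (kern \<alpha> r)\<^sup>2)"
          by (rule fin') (use nfint_1_kern_square[of \<alpha> t] \<alpha> t in \<open>auto intro: le_less_trans\<close>)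
        have fin3: "integrable lborel (\<lambda>r. indicator {0<..<t} r * (fint \<alpha> (d q) r)\<^sup>2)" for q
          by (rule fin') (use nfint_1_fint_square_finite[OF d di d0' \<alpha>(1)] in auto)
        have "(\<lambda>r. K * (indicator {0<..<t} r * B r)) = (\<lambda>r. K * (2 * (indicator {0<..<t} r * \<gamma> r)
            + (\<Sum>q<P. 2 * (a q)\<^sup>2 * (indicator {0<..<t} r * (kern \<alpha> r)\<^sup>2) + 2 * (indicator {0<..<t} r * (fint \<alpha> (d q) r)\<^sup>2))))"
          by (simp add: B_def distrib_left sum_distrib_left mult_ac)
        moreover have "integrable lborel \<dots>"
          by (intro Bochner_Integration.integrable_mult_right Bochner_Integration.integrable_add Bochner_Integration.integrable_sum fin1 fin2 fin3)
        ultimately have iB: "integrable lborel (\<lambda>r. K * (indicator {0<..<t} r * B r))" by simp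
        show ?thesis
        proof (rule Bochner_Integration.integrable_bound[OF iB])
          show "AE r in lborel. norm ((f p r)\<^sup>2) \<le> norm (K * (indicator {0<..<t} r * B r))"
            using slice
          proof eventually_elim
            case (elim r)
            show ?case
            proof (cases "r \<in> {0<..<t}")
              case True
              note slice_r = elim[rule_format, OF True]
              interpret fe_time_slice L P x C_F "F r" "g r" "gs r" "\<lambda>p. d p r" "\<lambda>p. a p * kern \<alpha> r + fint \<alpha> (d p) r"
                using slice_r by blast
              have "(d p r)\<^sup>2 \<le> K * ((LINT y|Om L. (g r y)\<^sup>2) + (LINT y|Om L. (gs r y)\<^sup>2)
                  + (\<Sum>q<P. (a q * kern \<alpha> r + fint \<alpha> (d q) r)\<^sup>2))"
                unfolding K_def using slice_r by (intro rate_estimate p C0) auto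
              also have "\<dots> \<le> K * B r"
              proof (rule mult_left_mono)
                have "(a q * kern \<alpha> r + fint \<alpha> (d q) r)\<^sup>2 \<le> 2 * (a q)\<^sup>2 * (kern \<alpha> r)\<^sup>2 + 2 * (fint \<alpha> (d q) r)\<^sup>2" for q
                  using sum_squares_bound[of "a q * kern \<alpha> r" "fint \<alpha> (d q) r"]
                  by (simp add: power2_sum power_mult_distrib)
                moreover have "(LINT y|Om L. (g r y)\<^sup>2) + (LINT y|Om L. (gs r y)\<^sup>2) \<le> 2 * \<gamma> r"
                proof -
                  have "0 \<le> (LINT y|Om L. (gs r y)\<^sup>2)" by simp
                  then show ?thesis using slice_r by linarith
                qed
                ultimately show "(LINT y|Om L. (g r y)\<^sup>2) + (LINT y|Om L. (gs r y)\<^sup>2)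
                  + (\<Sum>q<P. (a q * kern \<alpha> r + fint \<alpha> (d q) r)\<^sup>2) \<le> B r"
                  unfolding B_def by (intro add_mono sum_mono)
                have "1 \<le> inverse_const L P x" by (rule inverse_inequality(1)[OF L part])
                then show "0 \<le> K"
                  unfolding K_def rate_const_def Let_def using L C0
                  by (intro mult_nonneg_nonneg add_nonneg_nonneg sum_nonneg) auto
              qed
              finally have "(f p r)\<^sup>2 \<le> K * (indicator {0<..<t} r * B r)" using True by (simp add: f_def)
              then show ?thesis by simp
            qed (simp add: f_def)
          qed
        qed measurable
      qed
      have "finite_measure (Om L)" by (rule finite_measure_lebesgue_on) simp
      then have sf: "sigma_finite_measure (Om L)" by (simp add: finite_measure_def)
      have "(\<integral>\<^sup>+y. ennreal ((\<Sum>p<P. fint 1 (f p) t * ramp x p y)\<^sup>2) \<partial>Om L)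
        \<le> ennreal m * (ennreal (t powr (1 - \<alpha>)) * nfint 1 \<beta> t)"
        unfolding m_def
      proof (rule energy_bound[OF sf])
        show "ramp x p \<in> borel_measurable (Om L)" for p by (rule measurable_Om) simp
        show "integrable (Om L) (\<lambda>y. ramp x p y * ramp x q y)" for p q
        proof (rule integrable_bounded_on_interval[where K = 1])
          show "(\<lambda>y. ramp x p y * ramp x q y) \<in> borel_measurable (Om L)" by (rule measurable_Om) simp
          show "\<bar>ramp x p y * ramp x q y\<bar> \<le> 1" for y
            by (simp add: abs_mult ramp_bounds mult_le_one)
        qed
        show "f p r = 0" if "r \<notin> {0<..<t}" for p r using that by (simp add: f_def)
        show "AE r in lborel. r \<in> {0<..<t} \<longrightarrow>
          ennreal (LINT y|Om L. (\<Sum>p<P. f p r * ramp x p y) * (\<Sum>p<P. fint \<alpha> (f p) r * ramp x p y))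
          \<le> ennreal (C_F / 2 * (LINT y|Om L. (\<Sum>p<P. fint \<alpha> (f p) r * ramp x p y)\<^sup>2)) + \<beta> r"
          using slice
        proof eventually_elim
          case (elim r)
          show ?case
          proof
            assume r: "r \<in> {0<..<t}"
            note slice_r = elim[rule_format, OF r]
            interpret fe_time_slice L P x C_F "F r" "g r" "gs r" "\<lambda>p. d p r" "\<lambda>p. a p * kern \<alpha> r + fint \<alpha> (d p) r"
              using slice_r by blast
            let ?D = "\<lambda>p. fint \<alpha> (d p) r"
            have "(LINT y|Om L. ramp_sum x P (\<lambda>p. d p r) y * ramp_sum x P ?D y)
              \<le> C_F / 2 * (LINT y|Om L. (ramp_sum x P ?D y)\<^sup>2) + ((kern \<alpha> r)\<^sup>2 * C_F * H + \<gamma> r)"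
              using energy_estimate[of ?D a "kern \<alpha> r"] slice_r unfolding H by (simp add: add.assoc)
            then have "ennreal (LINT y|Om L. ramp_sum x P (\<lambda>p. d p r) y * ramp_sum x P ?D y)
              \<le> ennreal (C_F / 2 * (LINT y|Om L. (ramp_sum x P ?D y)\<^sup>2) + ((kern \<alpha> r)\<^sup>2 * C_F * H + \<gamma> r))"
              by (rule ennreal_leI)
            also have "\<dots> = ennreal (C_F / 2 * (LINT y|Om L. (ramp_sum x P ?D y)\<^sup>2)) + \<beta> r"
              using r C0 H0 \<gamma>0[of r] by (simp add: \<beta>_def)
            finally show "ennreal (LINT y|Om L. (\<Sum>p<P. f p r * ramp x p y) * (\<Sum>p<P. fint \<alpha> (f p) r * ramp x p y))
              \<le> ennreal (C_F / 2 * (LINT y|Om L. (\<Sum>p<P. fint \<alpha> (f p) r * ramp x p y)\<^sup>2)) + \<beta> r"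
              using r by (simp add: ramp_sum_def fint_f f_def)
          qed
        qed
      qed (use f2 \<alpha> t C0 in auto)
      also have "(\<integral>\<^sup>+y. ennreal ((\<Sum>p<P. fint 1 (f p) t * ramp x p y)\<^sup>2) \<partial>Om L)
        = ennreal ((L2_norm L (\<lambda>y. u_h t y - u0h y))\<^sup>2)"
        unfolding lhs by (simp add: fint_f)
      also have "nfint 1 \<beta> t \<le> ennreal (C_F * H) * ennreal (t powr (2 * \<alpha> - 1) / (2 * \<alpha> - 1)) + I"
      proof -
        have "nfint 1 \<beta> t \<le> nfint 1 (\<lambda>r. ennreal (C_F * H) * ennreal ((kern \<alpha> r)\<^sup>2) + ennreal (\<gamma> r) * indicator {0<..<t} r) t"
          by (rule nfint_mono) (use C0 H0 \<gamma>0 in \<open>auto simp: \<beta>_def indicator_def ennreal_mult[symmetric] mult_ac\<close>)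
        also have "\<dots> = ennreal (C_F * H) * nfint 1 (\<lambda>r. ennreal ((kern \<alpha> r)\<^sup>2)) t
            + nfint 1 (\<lambda>r. ennreal (\<gamma> r) * indicator {0<..<t} r) t"
          by (simp add: nfint_add nfint_cmult)
        also have "nfint 1 (\<lambda>r. ennreal (\<gamma> r) * indicator {0<..<t} r) t \<le> I"
          unfolding I_eq nfint_1 by (intro nn_integral_mono) (auto simp: indicator_def)
        also have "nfint 1 (\<lambda>r. ennreal ((kern \<alpha> r)\<^sup>2)) t \<le> ennreal (t powr (2 * \<alpha> - 1) / (2 * \<alpha> - 1))"
          using \<alpha> t by (intro nfint_1_kern_square) auto
        finally show ?thesis by (simp add: add_mono mult_left_mono)
      qed
      also have "ennreal (t powr (1 - \<alpha>)) * (ennreal (C_F * H) * ennreal (t powr (2 * \<alpha> - 1) / (2 * \<alpha> - 1)) + I)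
        = ennreal (t powr (1 - \<alpha>)) * I + ennreal (C_F * t powr \<alpha> / (2 * \<alpha> - 1) * H)"
      proof -
        have "t powr (1 - \<alpha>) * (C_F * H * (t powr (2 * \<alpha> - 1) / (2 * \<alpha> - 1))) = C_F * t powr \<alpha> / (2 * \<alpha> - 1) * H"
          using powr_add[of t "1 - \<alpha>" "2 * \<alpha> - 1"] by (simp add: mult_ac)
        then show ?thesis using C0 H0 \<alpha>
          by (simp add: distrib_left ennreal_mult[symmetric] add.commute)
      qed
      finally show ?thesis by (simp add: mult_left_mono)
    qed
  qed
  then show "ennreal ((L2_norm L (\<lambda>y. u_h t y - u0h y))\<^sup>2)
    \<le> ennreal (Mittag_Leffler (\<alpha>/2) (5/8 * C_F * t powr \<alpha> / (1 - \<alpha>)) / (1 - \<alpha>)\<^sup>2)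
      * (ennreal (t powr (1 - \<alpha>))
           * (\<integral>\<^sup>+ s. ennreal (1/2 * (L2_norm L (g s))\<^sup>2 + (L2_norm L (gs s))\<^sup>2)
                \<partial>lebesgue_on {0<..<t})
         + ennreal (C_F * t powr \<alpha> / (2 * \<alpha> - 1) * (H1_norm L u0h)\<^sup>2))"
    by (simp only: m_def I_def H_def)
qed



end
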